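(* Let $N\ge 1$, let $\Omega\subset\mathbb{R}^N$ be a bounded domain, and let $1<p<\infty$. Let $\ell\in\{0,\infty\}$ and let $f\colon\mathbb{R}\to\mathbb{R}$ be a continuous function with $f(0)\ge 0$; put $F(s)=\int_0^s f(t)\,\mathrm{d}t$ for $s\ge 0$. Suppose that there exists a sequence $\{\alpha_n\}\subset(0,\infty)$ such that $\alpha_n\to\ell$ and $f(\alpha_n)=0$ for every $n\in\mathbb{N}$, and that $$-\infty<\liminf_{s\to\ell}\frac{F(s)}{s^p}\le\limsup_{s\to\ell}\frac{F(s)}{s^p}=L^+\in(0,\infty].$$ Then there exists $\overline{\lambda}\in[0,\infty)$ such that, for every $\lambda>\overline{\lambda}$, the problem $$-\Delta_p u=\lambda f(u)\ \text{ in }\Omega,\qquad u=0\ \text{ on }\partial\Omega,$$ has a sequence $\{u_n\}$ of nonnegative and nontrivial bounded solutions such that $\|u_n\|_{L^\infty(\Omega)}\to\ell$. Furthermore, if $L^+=\infty$, then this holds with $\overline{\lambda}=0$.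
   Context: $\Delta_p u=\operatorname{div}(|\nabla u|^{p-2}\nabla u)$ is the $p$-Laplacian. The limits as $s\to\ell$ are taken as $s\to 0^+$ if $\ell=0$ and as $s\to\infty$ if $\ell=\infty$. Bounded solutions are understood in the weak sense: $u\in W^{1,p}_0(\Omega)\cap L^\infty(\Omega)$ with $\int_\Omega|\nabla u|^{p-2}\nabla u\cdot\nabla\varphi=\lambda\int_\Omega f(u)\varphi$ for all $\varphi\in W^{1,p}_0(\Omega)\cap L^\infty(\Omega)$. Nontrivial means not identically zero. *)

theory Defs
  imports "HOL-Analysis.Analysis" "HOL-Probability.Essential_Supremum"
begin

text \<open>Functions on an open set \<open>\<Omega>\<close> are represented by total functions of which only the values on
  \<open>\<Omega>\<close> matter, and almost everywhere equal functions are not identified.\<close>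

text \<open>\<open>C\<^sup>k\<close> functions on the whole space: differentiability together with \<open>C\<^sup>k\<close> partial
  derivatives amounts to being \<open>C\<^sup>k\<^sup>+\<^sup>1\<close>.\<close>

primrec Ck :: "nat \<Rightarrow> ('a::euclidean_space \<Rightarrow> real) \<Rightarrow> bool" where
  "Ck 0 \<phi> \<longleftrightarrow> continuous_on UNIV \<phi>"
| "Ck (Suc k) \<phi> \<longleftrightarrow> (\<forall>x. \<phi> differentiable (at x)) \<and>
     (\<forall>b\<in>Basis. Ck k (\<lambda>x. frechet_derivative \<phi> (at x) b))"

definition test_function :: "'a::euclidean_space set \<Rightarrow> ('a \<Rightarrow> real) \<Rightarrow> bool" where
  "test_function \<Omega> \<phi> \<longleftrightarrow> (\<forall>k. Ck k \<phi>) \<and>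
     compact (closure {x. \<phi> x \<noteq> 0}) \<and> closure {x. \<phi> x \<noteq> 0} \<subseteq> \<Omega>"

definition locally_integrable :: "'a::euclidean_space set \<Rightarrow> ('a \<Rightarrow> 'b::euclidean_space) \<Rightarrow> bool" where
  "locally_integrable \<Omega> u \<longleftrightarrow> (\<forall>K. compact K \<and> K \<subseteq> \<Omega> \<longrightarrow> u absolutely_integrable_on K)"

definition has_weak_gradient ::
    "'a::euclidean_space set \<Rightarrow> ('a \<Rightarrow> real) \<Rightarrow> ('a \<Rightarrow> 'a) \<Rightarrow> bool" where
  "has_weak_gradient \<Omega> u G \<longleftrightarrow> locally_integrable \<Omega> u \<and> locally_integrable \<Omega> G \<and>
     (\<forall>\<phi>. test_function \<Omega> \<phi> \<longrightarrow> (\<forall>b\<in>Basis.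
        (LINT x|lebesgue_on \<Omega>. u x * frechet_derivative \<phi> (at x) b)
          = - (LINT x|lebesgue_on \<Omega>. (G x \<bullet> b) * \<phi> x)))"

text \<open>The weak gradient is unique almost everywhere, so that the choice is immaterial below.\<close>

definition weak_gradient :: "'a::euclidean_space set \<Rightarrow> ('a \<Rightarrow> real) \<Rightarrow> 'a \<Rightarrow> 'a" where
  "weak_gradient \<Omega> u = (SOME G. has_weak_gradient \<Omega> u G)"

definition Lp :: "real \<Rightarrow> 'a::euclidean_space set \<Rightarrow> ('a \<Rightarrow> 'b::euclidean_space) set" where
  "Lp p \<Omega> = {u \<in> borel_measurable (lebesgue_on \<Omega>).
     integrable (lebesgue_on \<Omega>) (\<lambda>x. norm (u x) powr p)}"

definition Linf_norm :: "'a::euclidean_space set \<Rightarrow> ('a \<Rightarrow> real) \<Rightarrow> ereal" where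
  "Linf_norm \<Omega> u = esssup (lebesgue_on \<Omega>) (\<lambda>x. ereal \<bar>u x\<bar>)"

definition Linf :: "'a::euclidean_space set \<Rightarrow> ('a \<Rightarrow> real) set" where
  "Linf \<Omega> = {u \<in> borel_measurable (lebesgue_on \<Omega>). Linf_norm \<Omega> u < \<infinity>}"

definition W1p :: "real \<Rightarrow> 'a::euclidean_space set \<Rightarrow> ('a \<Rightarrow> real) set" where
  "W1p p \<Omega> = {u \<in> Lp p \<Omega>. \<exists>G \<in> Lp p \<Omega>. has_weak_gradient \<Omega> u G}"

definition W1p_norm :: "real \<Rightarrow> 'a::euclidean_space set \<Rightarrow> ('a \<Rightarrow> real) \<Rightarrow> real" where
  "W1p_norm p \<Omega> u = ((LINT x|lebesgue_on \<Omega>. \<bar>u x\<bar> powr p)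
     + (LINT x|lebesgue_on \<Omega>. norm (weak_gradient \<Omega> u x) powr p)) powr (1 / p)"

definition W1p_0 :: "real \<Rightarrow> 'a::euclidean_space set \<Rightarrow> ('a \<Rightarrow> real) set" where
  "W1p_0 p \<Omega> = {u \<in> W1p p \<Omega>. \<exists>\<phi>. (\<forall>n::nat. test_function \<Omega> (\<phi> n)) \<and>
     (\<lambda>n. W1p_norm p \<Omega> (\<lambda>x. \<phi> n x - u x)) \<longlonglongrightarrow> 0}"

text \<open>Bounded weak solutions of \<open>-\<Delta>\<^sub>p u = \<lambda> f(u)\<close> in \<open>\<Omega>\<close>, \<open>u = 0\<close> on the boundary. For \<open>p < 2\<close>
  the integrand on the left vanishes where the gradient does, as it should.\<close>

definition bounded_solution ::
    "real \<Rightarrow> 'a::euclidean_space set \<Rightarrow> real \<Rightarrow> (real \<Rightarrow> real) \<Rightarrow> ('a \<Rightarrow> real) \<Rightarrow> bool" where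
  "bounded_solution p \<Omega> lam f u \<longleftrightarrow> u \<in> W1p_0 p \<Omega> \<inter> Linf \<Omega> \<and>
     (\<forall>\<phi> \<in> W1p_0 p \<Omega> \<inter> Linf \<Omega>.
        (LINT x|lebesgue_on \<Omega>. (norm (weak_gradient \<Omega> u x) powr (p - 2) *\<^sub>R weak_gradient \<Omega> u x)
            \<bullet> weak_gradient \<Omega> \<phi> x)
          = lam * (LINT x|lebesgue_on \<Omega>. f (u x) * \<phi> x))"

text \<open>The filter for \<open>s \<rightarrow> l\<close>, where \<open>l\<close> is \<open>0\<close> (from the right) or \<open>\<infinity>\<close>.\<close>

definition toward :: "ereal \<Rightarrow> real filter" where
  "toward l = (if l = 0 then at_right 0 else at_top)"

end

theory Submission
  imports Defs "HOL-Complex_Analysis.Great_Picard"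
begin

text \<open>The zeros \<open>\<alpha>\<^sub>n\<close> of \<open>f\<close> act as barriers. Replace \<open>f\<close> by \<open>g(s) = f(min(max(s, 0), \<alpha>\<^sub>n))\<close>, which is
  \<open>f(0) \<ge> 0\<close> for negative \<open>s\<close> and \<open>f(\<alpha>\<^sub>n) = 0\<close> beyond \<open>\<alpha>\<^sub>n\<close>. The antiderivative \<open>\<Phi>\<close> of \<open>g\<close> does not decrease
  when its argument is clipped to \<open>[0, \<alpha>\<^sub>n]\<close>, and clipping does not increase the gradient energy. So
  a minimiser \<open>u\<^sub>n\<close> of
  \<open>I(u) = (\<integral>|\<nabla>u|\<^sup>p) / p - \<lambda> \<integral>\<Phi>(u)\<close> among the functions with \<open>0 \<le> u \<le> \<alpha>\<^sub>n\<close> minimises \<open>I\<close> on the whole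
  Sobolev space, its Euler--Lagrange equation holds for every test direction, and it solves the
  original problem because \<open>g = f\<close> on the range of \<open>u\<^sub>n\<close> (\<open>truncated_solution\<close>).

  The values of \<open>I\<close> at multiples \<open>s w\<close> of a plateau function \<open>w\<close> (equal to 1 on a set \<open>K\<close>, zero off a box \<open>B\<close>,
  with \<open>B - K\<close> small) control these minimisers: if \<open>F(s) \<ge> c s\<^sup>p\<close>, and \<open>F(t) \<ge> - C t\<^sup>p - D\<close> for \<open>0 \<le> t \<le> s\<close>, then
  \<open>I(s w) \<le> s\<^sup>p ((\<integral>|\<nabla>w|\<^sup>p) / p - \<lambda> (c |K| - C |B - K|)) + \<lambda> D |B - K|\<close> (\<open>plateau_energy\<close>). The upper limit
  \<open>L\<^sup>+ > c\<close> supplies such \<open>s\<close> arbitrarily close to \<open>\<ell>\<close>, the lower limit supplies \<open>C\<close>, and the factor of \<open>s\<^sup>p\<close>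
  is negative for large \<open>\<lambda>\<close>, or for any \<open>\<lambda> > 0\<close> if \<open>c\<close> can be taken arbitrarily large. If \<open>\<ell> = 0\<close>, then \<open>D = 0\<close>
  and the minimum of \<open>I\<close> is negative, so \<open>u\<^sub>n\<close> is nontrivial, while \<open>u\<^sub>n \<le> \<alpha>\<^sub>n \<rightarrow> 0\<close> (\<open>small_solutions\<close>).
  If \<open>\<ell> = \<infinity>\<close>, then the minima tend to \<open>-\<infinity>\<close>, which forces the norms to infinity, because \<open>I\<close> is bounded below
  on each set of functions with values in \<open>[0, R]\<close> (\<open>large_solutions\<close>).

  The existence of minimisers rests on two facts about the closure of the test functions in \<open>W\<^sup>1\<^sup>,\<^sup>p\<close>. If
  functions \<open>u\<^sub>k\<close> converge in \<open>L\<^sup>p\<close> and their gradients are bounded in \<open>L\<^sup>p\<close>, then the limit belongs to the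
  space, and its energy is at most the limit of the energies (\<open>sob0_weak_closure\<close>): by uniform
  convexity of \<open>|\<cdot>|\<^sup>p\<close>, convex combinations of the \<open>u\<^sub>k\<close> with nearly minimal energy have gradients that form a
  Cauchy sequence. And bounded sequences have subsequences that converge almost everywhere
  (\<open>sob0_AE_compact\<close>), since functions with bounded gradients are close in \<open>L\<^sup>1\<close> to their averages over
  the cells of a fine grid. The first fact, applied to smooth contractions of test functions, also shows that
  clipping does not increase the energy (\<open>sob0_clip\<close>).\<close>

section \<open>Smooth functions\<close>

abbreviation smooth :: "('a::euclidean_space \<Rightarrow> real) \<Rightarrow> bool" where
  "smooth \<phi> \<equiv> \<forall>k. Ck k \<phi>"

abbreviation pderiv_at :: "('a::euclidean_space \<Rightarrow> real) \<Rightarrow> 'a \<Rightarrow> 'a \<Rightarrow> real" where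
  "pderiv_at \<phi> b \<equiv> (\<lambda>x. frechet_derivative \<phi> (at x) b)"

lemma Ck_Suc_imp_Ck: "Ck (Suc k) \<phi> \<Longrightarrow> Ck k \<phi>"
proof (induction k arbitrary: \<phi>)
  case 0
  then show ?case
    by (auto intro!: continuous_at_imp_continuous_on differentiable_imp_continuous_within)
next
  case (Suc k)
  then show ?case by (metis Ck.simps(2))
qed

lemma Ck_SucI:
  assumes "\<And>x. (\<phi> has_derivative D x) (at x)" and "\<And>b. b \<in> Basis \<Longrightarrow> Ck k (\<lambda>x. D x b)"
  shows "Ck (Suc k) \<phi>"
proof -
  have "frechet_derivative \<phi> (at x) = D x" for x
    using assms(1) by (metis frechet_derivative_at)
  with assms show ?thesis by (auto simp: differentiable_def)
qed

lemma Ck_SucD: "Ck (Suc k) \<phi> \<Longrightarrow> (\<phi> has_derivative frechet_derivative \<phi> (at x)) (at x)"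
  by (simp add: frechet_derivative_works)

lemma Ck_const: "Ck k (\<lambda>x. c)"
proof (induction k arbitrary: c)
  case (Suc k)
  show ?case by (rule Ck_SucI[where D="\<lambda>x y. 0"]) (use Suc in auto)
qed auto

lemma Ck_add: "Ck k f \<Longrightarrow> Ck k g \<Longrightarrow> Ck k (\<lambda>x. f x + g x)"
proof (induction k arbitrary: f g)
  case 0 then show ?case by (auto intro: continuous_intros)
next
  case (Suc k)
  show ?case
    by (rule Ck_SucI[where D="\<lambda>x y. frechet_derivative f (at x) y + frechet_derivative g (at x) y"])
       (use Suc in \<open>auto intro!: has_derivative_add simp: frechet_derivative_works[symmetric]\<close>)
qed

lemma Ck_mult: "Ck k f \<Longrightarrow> Ck k g \<Longrightarrow> Ck k (\<lambda>x. f x * g x)"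
proof (induction k arbitrary: f g)
  case 0 then show ?case by (auto intro: continuous_intros)
next
  case (Suc k)
  note fg = Ck_Suc_imp_Ck[OF Suc.prems(1)] Ck_Suc_imp_Ck[OF Suc.prems(2)]
  show ?case
  proof (rule Ck_SucI[where D="\<lambda>x y. f x * frechet_derivative g (at x) y + frechet_derivative f (at x) y * g x"])
    show "((\<lambda>x. f x * g x) has_derivative
         (\<lambda>y. f x * frechet_derivative g (at x) y + frechet_derivative f (at x) y * g x)) (at x)" for x
      by (rule has_derivative_mult) (use Suc.prems in \<open>auto simp: frechet_derivative_works[symmetric]\<close>)
    show "Ck k (\<lambda>x. f x * frechet_derivative g (at x) b + frechet_derivative f (at x) b * g x)"
      if "b \<in> Basis" for b
      using Suc.prems fg that by (intro Ck_add Suc.IH) auto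
  qed
qed

lemma Ck_diff: "Ck k f \<Longrightarrow> Ck k g \<Longrightarrow> Ck k (\<lambda>x. f x - g x)"
  using Ck_add[of k f "\<lambda>x. (-1) * g x"] Ck_mult[OF Ck_const[of k "-1"], of g] by simp

lemma Ck_prod:
  "finite A \<Longrightarrow> (\<And>i. i \<in> A \<Longrightarrow> Ck k (f i)) \<Longrightarrow> Ck k (\<lambda>x. \<Prod>i\<in>A. f i x)"
  by (induction A rule: finite_induct) (auto intro: Ck_const Ck_mult)

lemma Ck_inner: "Ck k (\<lambda>x. x \<bullet> b)"
proof (cases k)
  case 0
  then show ?thesis by (auto intro: continuous_intros)
next
  case (Suc k')
  show ?thesis unfolding Suc
    by (rule Ck_SucI[where D="\<lambda>x y. y \<bullet> b"]) (auto intro!: derivative_eq_intros Ck_const)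
qed

lemma Ck_compose:
  fixes g :: "real \<Rightarrow> real"
  shows "Ck k g \<Longrightarrow> Ck k f \<Longrightarrow> Ck k (\<lambda>x. g (f x))"
proof (induction k arbitrary: f g)
  case 0 then show ?case by (auto intro: continuous_on_compose2)
next
  case (Suc k)
  have g1: "frechet_derivative g (at y) z = z * frechet_derivative g (at y) 1" for y z
    using linear_frechet_derivative[of g "at y"] Suc.prems(1) linear_cmul[of "frechet_derivative g (at y)" z 1]
    by simp
  show ?case
  proof (rule Ck_SucI[where D="\<lambda>x y. frechet_derivative f (at x) y * frechet_derivative g (at (f x)) 1"])
    fix x
    have "((\<lambda>x. g (f x)) has_derivative (\<lambda>y. frechet_derivative g (at (f x)) (frechet_derivative f (at x) y))) (at x)"
      by (rule has_derivative_compose[OF Ck_SucD[OF Suc.prems(2)] Ck_SucD[OF Suc.prems(1)]])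
    then show "((\<lambda>x. g (f x)) has_derivative
         (\<lambda>y. frechet_derivative f (at x) y * frechet_derivative g (at (f x)) 1)) (at x)"
      by (subst (asm) g1)
    show "Ck k (\<lambda>x. frechet_derivative f (at x) b * frechet_derivative g (at (f x)) 1)"
      if "b \<in> Basis" for b
      using Suc.prems Ck_Suc_imp_Ck[OF Suc.prems(2)] that
      by (intro Ck_mult Suc.IH[of "\<lambda>y. frechet_derivative g (at y) 1"]) auto
  qed
qed

text \<open>Smoothness by coinduction: it suffices to exhibit a family that is closed under differentiation.\<close>

lemma smooth_of_derivative_closed:
  fixes g :: "real \<Rightarrow> real"
  assumes "g \<in> X" and "\<And>g. g \<in> X \<Longrightarrow> \<exists>g'\<in>X. \<forall>s. (g has_real_derivative g' s) (at s)"
  shows "smooth g"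
proof
  fix k show "Ck k g" using assms(1)
  proof (induction k arbitrary: g)
    case 0
    then obtain g' where "\<forall>s. (g has_real_derivative g' s) (at s)" using assms(2) by blast
    then show ?case by (auto intro!: continuous_at_imp_continuous_on dest: DERIV_isCont)
  next
    case (Suc k)
    then obtain g' where g': "g' \<in> X" "\<forall>s. (g has_real_derivative g' s) (at s)" using assms(2) by blast
    show ?case
      by (rule Ck_SucI[where D="\<lambda>s y. g' s * y"])
         (use g' Suc in \<open>auto simp: has_field_derivative_def\<close>)
  qed
qed

definition smooth_step :: "real \<Rightarrow> real" where
  "smooth_step x = (if x > 0 then exp (- (1 / x)) else 0)"

lemma poly_exp_minus_tendsto_0: "((\<lambda>y::real. poly P y * exp (- y)) \<longlongrightarrow> 0) at_top"
proof (induction P)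
  case 0
  then show ?case by simp
next
  case (pCons a P)
  have "((\<lambda>y::real. y ^ n / exp y) \<longlongrightarrow> 0) at_top" for n by (rule tendsto_power_div_exp_0)
  then have term_tendsto: "((\<lambda>y::real. c * (y ^ n / exp y)) \<longlongrightarrow> 0) at_top" for n c
    by (rule tendsto_mult_right_zero)
  have "((\<lambda>y::real. \<Sum>i\<le>degree (pCons a P). coeff (pCons a P) i * (y ^ i / exp y)) \<longlongrightarrow> 0) at_top"
    by (rule tendsto_null_sum) (rule term_tendsto)
  then show ?case
    by (simp add: poly_altdef exp_minus divide_inverse sum_distrib_right mult.assoc del: coeff_pCons)
qed

text \<open>The functions \<open>P(1 / x) exp(- 1 / x)\<close> for \<open>x > 0\<close>, extended by zero, with \<open>P\<close> a polynomial, form a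
  family closed under differentiation; at the origin the difference quotient is \<open>y P(y) exp(- y)\<close>
  with \<open>y = 1 / x \<rightarrow> \<infinity>\<close>.\<close>

lemma smooth_smooth_step: "smooth smooth_step"
proof (rule smooth_of_derivative_closed[where
      X = "range (\<lambda>P x. if x > 0 then poly P (1 / x) * exp (- (1 / x)) else 0)"])
  show "smooth_step \<in> range (\<lambda>P x. if x > 0 then poly P (1 / x) * exp (- (1 / x)) else 0)"
    by (rule range_eqI[where x="1"]) (auto simp: smooth_step_def fun_eq_iff)
next
  fix g :: "real \<Rightarrow> real"
  assume "g \<in> range (\<lambda>P x. if x > 0 then poly P (1 / x) * exp (- (1 / x)) else 0)"
  then obtain P where g: "g = (\<lambda>x. if x > 0 then poly P (1 / x) * exp (- (1 / x)) else 0)" by blast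
  define Q where "Q = [:0,0,1:] * (P - pderiv P)"
  define g' where "g' = (\<lambda>x::real. if x > 0 then poly Q (1 / x) * exp (- (1 / x)) else 0)"
  have "(g has_real_derivative g' x) (at x)" for x
  proof -
    consider "x > 0" | "x < 0" | "x = 0" by linarith
    then show ?thesis
    proof cases
      case 1
      have "((\<lambda>x. poly P (1 / x) * exp (- (1 / x))) has_real_derivative g' x) (at x)"
        using 1 by (auto intro!: derivative_eq_intros DERIV_chain2[OF poly_DERIV]
            simp: g'_def Q_def field_simps power2_eq_square)
      moreover have "\<forall>\<^sub>F y in nhds x. g y = poly P (1 / y) * exp (- (1 / y))"
        using eventually_nhds_in_open[of "{0<..}" x] 1 by (auto simp: g elim: eventually_mono)
      ultimately show ?thesis by (subst DERIV_cong_ev[OF refl _ refl])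
    next
      case 2
      have "\<forall>\<^sub>F y in nhds x. g y = 0"
        using eventually_nhds_in_open[of "{..<0}" x] 2 by (auto simp: g elim: eventually_mono)
      then show ?thesis using 2 by (subst DERIV_cong_ev[OF refl _ refl]) (auto simp: g'_def)
    next
      case 3
      have g0: "g 0 = 0" by (simp add: g)
      have L: "((\<lambda>h. g h / h) \<longlongrightarrow> 0) (at_left 0)"
        by (rule tendsto_eventually) (auto simp: g eventually_at_left_field intro!: exI[of _ "-1"])
      have "((\<lambda>y::real. poly (pCons 0 P) y * exp (- y)) \<longlongrightarrow> 0) at_top"
        by (rule poly_exp_minus_tendsto_0)
      then have "((\<lambda>x. poly (pCons 0 P) (inverse x) * exp (- (inverse x))) \<longlongrightarrow> 0) (at_right 0)"
        by (rule filterlim_compose[OF _ filterlim_inverse_at_top_right])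
      moreover have "\<forall>\<^sub>F h in at_right 0. poly (pCons 0 P) (inverse h) * exp (- (inverse h)) = g h / h"
        using eventually_at_right_less[of "0::real"]
        by eventually_elim (auto simp: g field_simps)
      ultimately have R: "((\<lambda>h. g h / h) \<longlongrightarrow> 0) (at_right 0)"
        by (rule Lim_transform_eventually)
      show ?thesis
        using L R unfolding 3 DERIV_def by (simp add: g'_def filterlim_split_at g0)
    qed
  qed
  then show "\<exists>g'\<in>range (\<lambda>P x. if x > 0 then poly P (1 / x) * exp (- (1 / x)) else 0).
      \<forall>s. (g has_real_derivative g' s) (at s)"
    by (intro bexI[of _ g'] allI) (auto simp: g'_def)
qed

lemma smooth_step_bounds: "0 \<le> smooth_step x" "smooth_step x \<le> 1"
  "smooth_step x > 0 \<longleftrightarrow> x > 0" "smooth_step x = 0 \<longleftrightarrow> x \<le> 0"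
  by (auto simp: smooth_step_def)

lemma smooth_step_scaled_tendsto:
  "(\<lambda>n. smooth_step (real (Suc n) * x)) \<longlonglongrightarrow> (if x > 0 then 1 else 0)"
proof (cases "x > 0")
  case True
  have "(\<lambda>n. exp (- (1 / x * inverse (real (Suc n))))) \<longlonglongrightarrow> exp (- (1 / x * 0))"
    by (intro tendsto_intros LIMSEQ_inverse_real_of_nat)
  moreover have "smooth_step (real (Suc n) * x) = exp (- (1 / x * inverse (real (Suc n))))" for n
    using True by (simp add: smooth_step_def field_simps add_pos_nonneg)
  ultimately show ?thesis using True by simp
next
  case False
  then have "smooth_step (real (Suc n) * x) = 0" for n
    by (simp add: smooth_step_bounds mult_le_0_iff)
  with False show ?thesis by simp
qed

text \<open>The exponential profile is rescaled with \<open>n\<close> while the support stays the closed box, so that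
  the bumps fill the box as \<open>n\<close> grows.\<close>

definition box_bump :: "nat \<Rightarrow> 'a::euclidean_space \<Rightarrow> 'a \<Rightarrow> 'a \<Rightarrow> real" where
  "box_bump n a c x = (\<Prod>b\<in>Basis. smooth_step (real (Suc n) * (x \<bullet> b - a \<bullet> b)) *
                                   smooth_step (real (Suc n) * (c \<bullet> b - x \<bullet> b)))"

lemma smooth_box_bump: "smooth (box_bump n a c)"
  unfolding box_bump_def
  by (intro allI Ck_prod Ck_mult Ck_compose[OF smooth_smooth_step[rule_format]] Ck_diff Ck_const Ck_inner) auto

lemma box_bump_bounds: "0 \<le> box_bump n a c x" "box_bump n a c x \<le> 1"
  unfolding box_bump_def
  by (auto intro!: prod_nonneg prod_le_1 mult_le_one smooth_step_bounds mult_nonneg_nonneg)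

lemma box_bump_eq_0_iff: "box_bump n a c x = 0 \<longleftrightarrow> x \<notin> box a c"
  unfolding box_bump_def
  by (auto simp: mem_box smooth_step_bounds mult_le_0_iff not_less)

lemma box_bump_tendsto: "(\<lambda>n. box_bump n a c x) \<longlonglongrightarrow> indicator (box a c) x"
proof -
  have "(\<lambda>n. box_bump n a c x) \<longlonglongrightarrow> (\<Prod>b\<in>Basis. (if x \<bullet> b - a \<bullet> b > 0 then 1 else 0) *
                                            (if c \<bullet> b - x \<bullet> b > 0 then 1 else 0))"
    unfolding box_bump_def by (intro tendsto_intros smooth_step_scaled_tendsto)
  also have "(\<Prod>b\<in>Basis. (if x \<bullet> b - a \<bullet> b > 0 then 1 else 0) *
                 (if c \<bullet> b - x \<bullet> b > 0 then 1 else 0)) = (indicator (box a c) x :: real)"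
  proof (cases "x \<in> box a c")
    case True then show ?thesis by (auto simp: mem_box)
  next
    case False
    then obtain b where "b \<in> Basis" "\<not> (a \<bullet> b < x \<bullet> b \<and> x \<bullet> b < c \<bullet> b)" by (auto simp: mem_box)
    with False show ?thesis by (auto intro!: prod_zero bexI[of _ b])
  qed
  finally show ?thesis .
qed

section \<open>Test functions\<close>

lemma test_function_smooth: "test_function \<Omega> \<phi> \<Longrightarrow> smooth \<phi>"
  by (simp add: test_function_def)

lemma test_functionI:
  assumes "smooth \<phi>" and "compact K" and "K \<subseteq> \<Omega>" and "\<And>x. x \<notin> K \<Longrightarrow> \<phi> x = 0"
  shows "test_function \<Omega> \<phi>"
proof -
  have "closure {x. \<phi> x \<noteq> 0} \<subseteq> K"
    using assms by (intro closure_minimal) (auto simp: compact_imp_closed)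
  with assms show ?thesis unfolding test_function_def
    by (metis closed_closure compact_Int_closed inf.absorb_iff2 subset_trans)
qed

lemma test_function_support:
  assumes "test_function \<Omega> \<phi>"
  shows "\<exists>K. compact K \<and> K \<subseteq> \<Omega> \<and> (\<forall>x. x \<notin> K \<longrightarrow> \<phi> x = 0)"
proof (intro exI conjI allI impI)
  show "compact (closure {x. \<phi> x \<noteq> 0})" "closure {x. \<phi> x \<noteq> 0} \<subseteq> \<Omega>"
    using assms unfolding test_function_def by blast+
  show "\<phi> x = 0" if "x \<notin> closure {x. \<phi> x \<noteq> 0}" for x
    using that subsetD[OF closure_subset, of x "{x. \<phi> x \<noteq> 0}"] by blast
qed

lemma test_function_zero_outside: "test_function \<Omega> \<phi> \<Longrightarrow> x \<notin> \<Omega> \<Longrightarrow> \<phi> x = 0"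
  using test_function_support by blast

lemma test_function_zero: "test_function \<Omega> (\<lambda>x. 0)"
  by (rule test_functionI[where K="{}"]) (auto intro: Ck_const)

lemma test_function_add:
  assumes "test_function \<Omega> \<phi>" "test_function \<Omega> \<psi>"
  shows "test_function \<Omega> (\<lambda>x. \<phi> x + \<psi> x)"
proof -
  obtain K where K: "compact K" "K \<subseteq> \<Omega>" "\<And>x. x \<notin> K \<Longrightarrow> \<phi> x = 0" using test_function_support[OF assms(1)] by blast
  obtain L where L: "compact L" "L \<subseteq> \<Omega>" "\<And>x. x \<notin> L \<Longrightarrow> \<psi> x = 0" using test_function_support[OF assms(2)] by blast
  show ?thesis
    by (rule test_functionI[where K="K \<union> L"]) (use K L assms in \<open>auto intro!: Ck_add simp: test_function_def\<close>)
qed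

lemma test_function_mult:
  assumes "test_function \<Omega> \<phi>" "smooth \<psi>"
  shows "test_function \<Omega> (\<lambda>x. \<phi> x * \<psi> x)"
proof -
  obtain K where K: "compact K" "K \<subseteq> \<Omega>" "\<And>x. x \<notin> K \<Longrightarrow> \<phi> x = 0" using test_function_support[OF assms(1)] by blast
  show ?thesis
    by (rule test_functionI[where K=K]) (use K assms in \<open>auto intro!: Ck_mult simp: test_function_def\<close>)
qed

lemma test_function_scale: "test_function \<Omega> \<phi> \<Longrightarrow> test_function \<Omega> (\<lambda>x. c * \<phi> x)"
  using test_function_mult[of \<Omega> \<phi> "\<lambda>x. c"] by (simp add: mult.commute Ck_const)

lemma test_function_compose:
  fixes g :: "real \<Rightarrow> real"
  assumes "test_function \<Omega> \<phi>" "smooth g" "g 0 = 0"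
  shows "test_function \<Omega> (\<lambda>x. g (\<phi> x))"
proof -
  obtain K where K: "compact K" "K \<subseteq> \<Omega>" "\<And>x. x \<notin> K \<Longrightarrow> \<phi> x = 0" using test_function_support[OF assms(1)] by blast
  have "smooth (\<lambda>x. g (\<phi> x))"
    using Ck_compose[of _ g \<phi>] assms(2) test_function_smooth[OF assms(1)] by simp
  then show ?thesis
    by (rule test_functionI[where K=K]) (use K assms(3) in auto)
qed

lemma test_function_box_bump: "cbox a c \<subseteq> \<Omega> \<Longrightarrow> test_function \<Omega> (box_bump n a c)"
  by (rule test_functionI[where K="cbox a c"])
     (use box_subset_cbox in \<open>auto simp: smooth_box_bump box_bump_eq_0_iff\<close>)

lemma test_function_has_derivative:
  "test_function \<Omega> \<phi> \<Longrightarrow> (\<phi> has_derivative frechet_derivative \<phi> (at x)) (at x)"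
  using Ck_SucD[of 0 \<phi>] test_function_smooth by blast

lemma test_function_continuous: "test_function \<Omega> \<phi> \<Longrightarrow> continuous_on UNIV \<phi>"
  using test_function_smooth Ck.simps(1) by blast

lemma test_function_pderiv:
  assumes "test_function \<Omega> \<phi>" "b \<in> Basis"
  shows "test_function \<Omega> (pderiv_at \<phi> b)"
proof -
  obtain K where K: "compact K" "K \<subseteq> \<Omega>" "\<And>x. x \<notin> K \<Longrightarrow> \<phi> x = 0" using test_function_support[OF assms(1)] by blast
  have "frechet_derivative \<phi> (at x) b = 0" if "x \<notin> K" for x
  proof -
    have "(\<phi> has_derivative (\<lambda>h. 0)) (at x)"
      by (rule has_derivative_transform_within_open[of "\<lambda>x. 0" _ _ _ "- K"])
         (use K that in \<open>auto simp: compact_imp_closed open_Compl\<close>)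
    then show ?thesis by (metis frechet_derivative_at)
  qed
  moreover have "smooth (pderiv_at \<phi> b)"
    using test_function_smooth[OF assms(1)] assms(2) Ck.simps(2)[of _ \<phi>] by blast
  ultimately show ?thesis
    by (intro test_functionI[where K=K] K) auto
qed

definition grad :: "('a::euclidean_space \<Rightarrow> real) \<Rightarrow> 'a \<Rightarrow> 'a" where
  "grad \<phi> x = (\<Sum>b\<in>Basis. frechet_derivative \<phi> (at x) b *\<^sub>R b)"

lemma grad_inner_Basis: "b \<in> Basis \<Longrightarrow> grad \<phi> x \<bullet> b = frechet_derivative \<phi> (at x) b"
  unfolding grad_def inner_sum_left inner_scaleR_left by (simp add: inner_Basis if_distrib cong: if_cong)

lemma has_derivative_grad:
  assumes "(\<phi> has_derivative frechet_derivative \<phi> (at x)) (at x)"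
  shows "(\<phi> has_derivative (\<lambda>h. grad \<phi> x \<bullet> h)) (at x)"
proof -
  interpret bounded_linear "frechet_derivative \<phi> (at x)"
    using assms by (rule has_derivative_bounded_linear)
  have "frechet_derivative \<phi> (at x) h = grad \<phi> x \<bullet> h" for h
  proof -
    have "frechet_derivative \<phi> (at x) h = frechet_derivative \<phi> (at x) (\<Sum>b\<in>Basis. (h \<bullet> b) *\<^sub>R b)"
      by (simp add: euclidean_representation)
    also have "\<dots> = (\<Sum>b\<in>Basis. (h \<bullet> b) * frechet_derivative \<phi> (at x) b)"
      unfolding sum scale by simp
    also have "\<dots> = grad \<phi> x \<bullet> h"
      unfolding grad_def inner_sum_left inner_scaleR_left by (intro sum.cong) (auto simp: inner_commute)
    finally show ?thesis .
  qed
  then have "frechet_derivative \<phi> (at x) = (\<lambda>h. grad \<phi> x \<bullet> h)" by (rule ext)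
  with assms show ?thesis by metis
qed

section \<open>Integrals of p-th powers\<close>

lemma powr_convex_nonneg:
  fixes x y p t :: real
  assumes "1 \<le> p" "0 \<le> x" "0 \<le> y" "0 \<le> t" "t \<le> 1"
  shows "((1 - t) * x + t * y) powr p \<le> (1 - t) * x powr p + t * y powr p"
proof -
  have shrink: "(s * z) powr p \<le> s * z powr p" if "0 \<le> s" "s \<le> 1" "0 \<le> z" for s z :: real
  proof -
    have "s powr p \<le> s"
      using that assms(1) powr_mono'[of 1 p s] by (cases "s = 0") auto
    then have "s powr p * z powr p \<le> s * z powr p"
      by (rule mult_right_mono) simp
    with that show ?thesis by (simp add: powr_mult)
  qed
  consider "x = 0" | "y = 0" | "x > 0" "y > 0" using assms by linarith
  then show ?thesis
  proof cases
    case 1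
    with shrink[of t y] assms show ?thesis by simp
  next
    case 2
    with shrink[of "1 - t" x] assms show ?thesis by simp
  next
    case 3
    with convex_onD[OF powr_convex[OF assms(1)], of t x y] assms show ?thesis by simp
  qed
qed

lemma norm_powr_convex:
  fixes a b :: "'a::real_normed_vector"
  assumes "1 \<le> p" "0 \<le> t" "t \<le> 1"
  shows "norm ((1 - t) *\<^sub>R a + t *\<^sub>R b) powr p \<le> (1 - t) * norm a powr p + t * norm b powr p"
proof -
  have "norm ((1 - t) *\<^sub>R a + t *\<^sub>R b) \<le> (1 - t) * norm a + t * norm b"
    using norm_triangle_ineq[of "(1 - t) *\<^sub>R a" "t *\<^sub>R b"] assms by simp
  then have "norm ((1 - t) *\<^sub>R a + t *\<^sub>R b) powr p \<le> ((1 - t) * norm a + t * norm b) powr p"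
    using assms by (intro powr_mono2) auto
  also have "\<dots> \<le> (1 - t) * norm a powr p + t * norm b powr p"
    using assms by (intro powr_convex_nonneg) auto
  finally show ?thesis .
qed

text \<open>The weights are those of convexity applied to \<open>a + b = (1 - t) (a / (1 - t)) + t (b / t)\<close>.
  For \<open>t = 1 / 2\<close> this is a triangle inequality with a constant; as \<open>t \<rightarrow> 0\<close> the first weight tends
  to 1, which makes the \<open>L\<^sup>p\<close> norm upper semicontinuous (\<open>Lpow_upper_limit\<close>).\<close>

lemma norm_add_powr_le:
  fixes a b :: "'a::real_normed_vector"
  assumes "1 \<le> p" "0 < t" "t < 1"
  shows "norm (a + b) powr p \<le> (1 - t) powr (1 - p) * norm a powr p + t powr (1 - p) * norm b powr p"
proof -
  have *: "s * norm (c /\<^sub>R s) powr p = s powr (1 - p) * norm c powr p" if "s > 0" for s and c :: 'a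
    using that by (simp add: powr_divide powr_diff divide_inverse powr_mult inverse_powr powr_minus)
  have "norm ((1 - t) *\<^sub>R (a /\<^sub>R (1 - t)) + t *\<^sub>R (b /\<^sub>R t)) powr p
      \<le> (1 - t) * norm (a /\<^sub>R (1 - t)) powr p + t * norm (b /\<^sub>R t) powr p"
    using assms by (intro norm_powr_convex) auto
  then show ?thesis
    using assms by (subst (asm) *, simp, subst (asm) *, simp) simp
qed

text \<open>This elementary inequality yields the inclusion of \<open>L\<^sup>p\<close> in \<open>L\<^sup>1\<close> on sets of finite measure, with
  smallness in \<open>L\<^sup>p\<close> implying smallness in \<open>L\<^sup>1\<close>: choose \<open>e\<close> first.\<close>

lemma norm_le_eps_powr:
  fixes a :: "'a::real_normed_vector"
  assumes "1 < p" "0 < e"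
  shows "norm a \<le> e + e powr (1 - p) * norm a powr p"
proof (cases "norm a \<le> e")
  case False
  have "norm a = norm a powr (1 - p) * norm a powr p"
    using False assms by (simp add: powr_add[symmetric])
  also have "\<dots> \<le> e powr (1 - p) * norm a powr p"
    using False assms by (intro mult_right_mono powr_mono2') auto
  finally show ?thesis using assms by linarith
qed (simp add: add_increasing2)

definition Lpow :: "real \<Rightarrow> 'a::euclidean_space set \<Rightarrow> ('a \<Rightarrow> 'b::euclidean_space) \<Rightarrow> real" where
  "Lpow p \<Omega> v = (LINT x|lebesgue_on \<Omega>. norm (v x) powr p)"

lemma Lpow_nonneg: "0 \<le> Lpow p \<Omega> v"
  by (simp add: Lpow_def)

lemma Lp_measurable: "v \<in> Lp p \<Omega> \<Longrightarrow> v \<in> borel_measurable (lebesgue_on \<Omega>)"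
  by (simp add: Lp_def)

lemma Lp_integrable: "v \<in> Lp p \<Omega> \<Longrightarrow> integrable (lebesgue_on \<Omega>) (\<lambda>x. norm (v x) powr p)"
  by (simp add: Lp_def)

lemma Lp_dominated:
  assumes "v \<in> borel_measurable (lebesgue_on \<Omega>)" "integrable (lebesgue_on \<Omega>) w"
    "AE x in lebesgue_on \<Omega>. norm (v x) powr p \<le> w x"
  shows "v \<in> Lp p \<Omega>" "Lpow p \<Omega> v \<le> (LINT x|lebesgue_on \<Omega>. w x)"
proof -
  have [measurable]: "v \<in> borel_measurable (lebesgue_on \<Omega>)" by fact
  have i: "integrable (lebesgue_on \<Omega>) (\<lambda>x. norm (v x) powr p)"
    by (rule Bochner_Integration.integrable_bound[OF assms(2)]) (use assms(3) in \<open>auto\<close>)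
  then show "v \<in> Lp p \<Omega>" using assms by (simp add: Lp_def)
  show "Lpow p \<Omega> v \<le> (LINT x|lebesgue_on \<Omega>. w x)"
    unfolding Lpow_def by (rule integral_mono_AE[OF i assms(2,3)])
qed

text \<open>Lebesgue measure is complete.\<close>

lemma borel_measurable_lebesgue_on_AE:
  fixes v w :: "'a::euclidean_space \<Rightarrow> 'b::topological_space"
  assumes "\<Omega> \<in> sets lebesgue" "v \<in> borel_measurable (lebesgue_on \<Omega>)" "AE x in lebesgue_on \<Omega>. v x = w x"
  shows "w \<in> borel_measurable (lebesgue_on \<Omega>)"
proof (rule measurableI)
  fix A :: "'b set" assume "A \<in> sets borel"

  have "v -` A \<inter> \<Omega> \<in> sets (lebesgue_on \<Omega>)"
    using measurable_sets[OF assms(2) \<open>A \<in> sets borel\<close>] by simp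
  then have "v -` A \<inter> \<Omega> \<in> sets lebesgue"
    using assms(1) by (auto simp: sets_restrict_space)
  moreover have "AE x in lebesgue. x \<in> v -` A \<inter> \<Omega> \<longleftrightarrow> x \<in> w -` A \<inter> \<Omega>"
    using assms(3) unfolding AE_restrict_space_iff[OF sets.Int[OF assms(1) sets.top]]
    by eventually_elim auto
  ultimately have "w -` A \<inter> \<Omega> \<in> sets lebesgue"
    by (intro completion.in_sets_AE[of "v -` A \<inter> \<Omega>" "w -` A \<inter> \<Omega>" lborel]) auto
  then show "w -` A \<inter> space (lebesgue_on \<Omega>) \<in> sets (lebesgue_on \<Omega>)"
    using assms(1) by (simp add: sets_restrict_space_iff)
qed auto

locale lp_domain =
  fixes \<Omega> :: "'a::euclidean_space set" and p :: real
  assumes open_domain: "open \<Omega>" and bounded_domain: "bounded \<Omega>" and p_gt_1: "1 < p"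
begin

abbreviation "M \<equiv> lebesgue_on \<Omega>"

lemma domain_lmeasurable: "\<Omega> \<in> lmeasurable"
  using open_domain bounded_domain by (simp add: lmeasurable_open)

lemma domain_sets [measurable, simp]: "\<Omega> \<in> sets lebesgue"
  using domain_lmeasurable by blast

sublocale finite_measure M
  by (rule finite_measure_lebesgue_on[OF domain_lmeasurable])

lemma borel_measurable_lebesgue_onI: "v \<in> borel_measurable borel \<Longrightarrow> v \<in> borel_measurable M"
  by (intro measurable_restrict_space1 measurable_completion) simp

lemma Lp_AE_cong:
  assumes "v \<in> Lp p \<Omega>" "AE x in M. v x = w x"
  shows "w \<in> Lp p \<Omega>" "Lpow p \<Omega> w = Lpow p \<Omega> v"
proof -
  have wm[measurable]: "w \<in> borel_measurable M"
    by (rule borel_measurable_lebesgue_on_AE[OF domain_sets Lp_measurable[OF assms(1)] assms(2)])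
  have [measurable]: "v \<in> borel_measurable M" using assms(1) by (rule Lp_measurable)
  have ae: "AE x in M. norm (v x) powr p = norm (w x) powr p"
    using assms(2) by eventually_elim simp
  have "integrable M (\<lambda>x. norm (w x) powr p)"
    by (rule integrable_cong_AE_imp[OF Lp_integrable[OF assms(1)]]) (use ae in auto)
  then show "w \<in> Lp p \<Omega>" using wm by (simp add: Lp_def)
  show "Lpow p \<Omega> w = Lpow p \<Omega> v"
    unfolding Lpow_def by (rule integral_cong_AE) (use ae in auto)
qed

lemma Lp_add_bound:
  assumes "v \<in> Lp p \<Omega>" "w \<in> Lp p \<Omega>" "0 < t" "t < 1"
  shows "(\<lambda>x. v x + w x) \<in> Lp p \<Omega>"
    "Lpow p \<Omega> (\<lambda>x. v x + w x) \<le> (1 - t) powr (1 - p) * Lpow p \<Omega> v + t powr (1 - p) * Lpow p \<Omega> w"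
proof -
  let ?w = "\<lambda>x. (1 - t) powr (1 - p) * norm (v x) powr p + t powr (1 - p) * norm (w x) powr p"
  have m: "(\<lambda>x. v x + w x) \<in> borel_measurable M"
    using assms by (intro borel_measurable_add Lp_measurable)
  have i: "integrable M ?w"
    using assms by (intro Bochner_Integration.integrable_add integrable_mult_right Lp_integrable)
  have ae: "AE x in M. norm (v x + w x) powr p \<le> ?w x"
    using assms p_gt_1 by (intro AE_I2 norm_add_powr_le) auto
  show "(\<lambda>x. v x + w x) \<in> Lp p \<Omega>" by (rule Lp_dominated(1)[OF m i ae])
  have "Lpow p \<Omega> (\<lambda>x. v x + w x) \<le> (LINT x|M. ?w x)" by (rule Lp_dominated(2)[OF m i ae])
  also have "\<dots> = (1 - t) powr (1 - p) * Lpow p \<Omega> v + t powr (1 - p) * Lpow p \<Omega> w"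
    unfolding Lpow_def using assms by (simp add: Lp_integrable)
  finally show "Lpow p \<Omega> (\<lambda>x. v x + w x) \<le> \<dots>" .
qed

lemma Lp_scaleR:
  assumes "v \<in> Lp p \<Omega>"
  shows "(\<lambda>x. c *\<^sub>R v x) \<in> Lp p \<Omega>" "Lpow p \<Omega> (\<lambda>x. c *\<^sub>R v x) = \<bar>c\<bar> powr p * Lpow p \<Omega> v"
proof -
  have e: "norm (c *\<^sub>R v x) powr p = \<bar>c\<bar> powr p * norm (v x) powr p" for x
    by (simp add: powr_mult)
  have "integrable M (\<lambda>x. norm (c *\<^sub>R v x) powr p)"
    unfolding e using assms by (intro integrable_mult_right Lp_integrable)
  moreover have "(\<lambda>x. c *\<^sub>R v x) \<in> borel_measurable M"
    using Lp_measurable[OF assms] by (intro borel_measurable_scaleR) auto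
  ultimately show "(\<lambda>x. c *\<^sub>R v x) \<in> Lp p \<Omega>" by (simp add: Lp_def)
  show "Lpow p \<Omega> (\<lambda>x. c *\<^sub>R v x) = \<bar>c\<bar> powr p * Lpow p \<Omega> v"
    unfolding Lpow_def e by simp
qed

lemma Lp_add: "v \<in> Lp p \<Omega> \<Longrightarrow> w \<in> Lp p \<Omega> \<Longrightarrow> (\<lambda>x. v x + w x) \<in> Lp p \<Omega>"
  by (rule Lp_add_bound(1)[of _ _ "1/2"]) auto

lemma Lp_diff: "v \<in> Lp p \<Omega> \<Longrightarrow> w \<in> Lp p \<Omega> \<Longrightarrow> (\<lambda>x. v x - w x) \<in> Lp p \<Omega>"
  using Lp_add[OF _ Lp_scaleR(1)[of w "-1"]] by simp

lemma Lpow_triangle: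
  assumes "v \<in> Lp p \<Omega>" "w \<in> Lp p \<Omega>" "z \<in> Lp p \<Omega>"
  shows "Lpow p \<Omega> (\<lambda>x. v x - z x) \<le>
    (1/2) powr (1 - p) * (Lpow p \<Omega> (\<lambda>x. v x - w x) + Lpow p \<Omega> (\<lambda>x. w x - z x))"
  using Lp_add_bound(2)[OF Lp_diff[OF assms(1,2)] Lp_diff[OF assms(2,3)], of "1/2"]
  by (simp add: distrib_left)

lemma Lpow_tendsto_0I:
  fixes v :: "nat \<Rightarrow> 'a \<Rightarrow> 'b::euclidean_space"
  assumes "\<And>n. Lpow p \<Omega> (v n) \<le> a n" "a \<longlonglongrightarrow> 0"
  shows "(\<lambda>n. Lpow p \<Omega> (v n)) \<longlonglongrightarrow> 0"
  by (rule tendsto_sandwich[OF _ _ tendsto_const assms(2)]) (auto simp: assms(1) Lpow_nonneg)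

lemma Lpow_tendsto_trans:
  assumes "\<And>n. v n \<in> Lp p \<Omega>" "\<And>n. w n \<in> Lp p \<Omega>" "\<And>n. z n \<in> Lp p \<Omega>"
    "(\<lambda>n. Lpow p \<Omega> (\<lambda>x. v n x - w n x)) \<longlonglongrightarrow> 0" "(\<lambda>n. Lpow p \<Omega> (\<lambda>x. w n x - z n x)) \<longlonglongrightarrow> 0"
  shows "(\<lambda>n. Lpow p \<Omega> (\<lambda>x. v n x - z n x)) \<longlonglongrightarrow> 0"
proof (rule Lpow_tendsto_0I)
  show "Lpow p \<Omega> (\<lambda>x. v n x - z n x) \<le>
    (1/2) powr (1 - p) * (Lpow p \<Omega> (\<lambda>x. v n x - w n x) + Lpow p \<Omega> (\<lambda>x. w n x - z n x))" for n
    by (rule Lpow_triangle) (use assms in auto)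
  show "(\<lambda>n. (1/2) powr (1 - p) * (Lpow p \<Omega> (\<lambda>x. v n x - w n x) + Lpow p \<Omega> (\<lambda>x. w n x - z n x))) \<longlonglongrightarrow> 0"
    using tendsto_mult_right_zero[OF tendsto_add_zero[OF assms(4,5)]] by simp
qed

lemma Lp_imp_integrable:
  assumes "v \<in> Lp p \<Omega>"
  shows "integrable M v"
    "0 < e \<Longrightarrow> (LINT x|M. norm (v x)) \<le> e * measure M \<Omega> + e powr (1 - p) * Lpow p \<Omega> v"
proof -
  have b: "norm (v x) \<le> e + e powr (1 - p) * norm (v x) powr p" if "0 < e" for x e
    using norm_le_eps_powr[OF p_gt_1 that] .
  have i: "integrable M (\<lambda>x. e + e powr (1 - p) * norm (v x) powr p)" for e
    using Lp_integrable[OF assms] by simp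
  show iv: "integrable M v"
    by (rule Bochner_Integration.integrable_bound[OF i[of 1]])
       (use Lp_measurable[OF assms] b[of 1] in \<open>auto intro!: AE_I2 order_trans[OF _ abs_ge_self]\<close>)
  show "(LINT x|M. norm (v x)) \<le> e * measure M \<Omega> + e powr (1 - p) * Lpow p \<Omega> v" if "0 < e"
  proof -
    have "(LINT x|M. norm (v x)) \<le> (LINT x|M. e + e powr (1 - p) * norm (v x) powr p)"
      by (intro integral_mono integrable_norm iv i b that)
    also have "\<dots> = e * measure M \<Omega> + e powr (1 - p) * Lpow p \<Omega> v"
      using Lp_integrable[OF assms] by (simp add: Lpow_def)
    finally show ?thesis .
  qed
qed

lemma L1_small_of_Lpow_small:
  assumes "0 < e"
  obtains d where "0 < d"
    "\<And>v :: 'a \<Rightarrow> 'b::euclidean_space. v \<in> Lp p \<Omega> \<Longrightarrow> Lpow p \<Omega> v < d \<Longrightarrow> (LINT x|M. norm (v x)) < e"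
proof -
  \<comment> \<open>The term \<open>1\<close> keeps the denominator positive when the domain is null.\<close>
  define e' where "e' = e / (2 * (measure M \<Omega> + 1))"
  have m: "0 \<le> measure M \<Omega>" by simp
  have e': "0 < e'" using assms m by (simp add: e'_def add_nonneg_pos)
  have e'm: "e' * measure M \<Omega> \<le> e / 2"
    using assms m by (simp add: e'_def field_simps add_pos_nonneg mult_left_mono)
  define d where "d = (e / 2) / e' powr (1 - p)"
  have "0 < d" using e' assms by (simp add: d_def)
  moreover have "(LINT x|M. norm (v x)) < e" if "v \<in> Lp p \<Omega>" "Lpow p \<Omega> v < d"
    for v :: "'a \<Rightarrow> 'b"
  proof -
    have "e' powr (1 - p) * Lpow p \<Omega> v < e / 2"
      using that(2) e' by (simp add: d_def field_simps)
    then show ?thesis using Lp_imp_integrable(2)[OF that(1) e'] e'm by linarith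
  qed
  ultimately show ?thesis using that by blast
qed

lemma L1_tendsto_of_Lpow_tendsto:
  fixes v :: "nat \<Rightarrow> 'a \<Rightarrow> 'b::euclidean_space"
  assumes "\<And>n. v n \<in> Lp p \<Omega>" "(\<lambda>n. Lpow p \<Omega> (v n)) \<longlonglongrightarrow> 0"
  shows "(\<lambda>n. LINT x|M. norm (v n x)) \<longlonglongrightarrow> 0"
proof (rule LIMSEQ_I)
  fix e :: real assume "0 < e"
  then obtain d where d: "0 < d"
    "\<And>v :: 'a \<Rightarrow> 'b. v \<in> Lp p \<Omega> \<Longrightarrow> Lpow p \<Omega> v < d \<Longrightarrow> (LINT x|M. norm (v x)) < e"
    using L1_small_of_Lpow_small[where ?'b='b] by blast
  obtain n0 where "\<forall>n\<ge>n0. norm (Lpow p \<Omega> (v n) - 0) < d"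
    using LIMSEQ_D[OF assms(2) d(1)] by blast
  then show "\<exists>n0. \<forall>n\<ge>n0. norm ((LINT x|M. norm (v n x)) - 0) < e"
    using d(2)[OF assms(1)] by (intro exI[of _ n0]) auto
qed

lemma AE_subseq_of_Lpow_tendsto:
  fixes v :: "nat \<Rightarrow> 'a \<Rightarrow> 'b::euclidean_space"
  assumes "\<And>n. v n \<in> Lp p \<Omega>" "w \<in> Lp p \<Omega>" "(\<lambda>n. Lpow p \<Omega> (\<lambda>x. v n x - w x)) \<longlonglongrightarrow> 0"
  obtains r where "strict_mono r" "AE x in M. (\<lambda>n. v (r n) x) \<longlonglongrightarrow> w x"
proof -
  have "\<exists>r::nat\<Rightarrow>nat. strict_mono r \<and> (AE x in M. (\<lambda>n. v (r n) x - w x) \<longlonglongrightarrow> 0)"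
    using assms by (intro tendsto_L1_AE_subseq L1_tendsto_of_Lpow_tendsto Lp_imp_integrable Lp_diff)
  then obtain r :: "nat \<Rightarrow> nat" where r: "strict_mono r" "AE x in M. (\<lambda>n. v (r n) x - w x) \<longlonglongrightarrow> 0"
    by blast
  from r(2) have "AE x in M. (\<lambda>n. v (r n) x) \<longlonglongrightarrow> w x"
    by eventually_elim (simp add: LIM_zero_iff)
  with r(1) that show ?thesis by blast
qed

lemma Lp_Fatou:
  fixes v :: "nat \<Rightarrow> 'a \<Rightarrow> 'b::euclidean_space"
  assumes v: "\<And>n. v n \<in> Lp p \<Omega>" and w[measurable]: "w \<in> borel_measurable M"
    and lim: "AE x in M. (\<lambda>n. v n x) \<longlonglongrightarrow> w x" and C: "\<forall>\<^sub>F n in sequentially. Lpow p \<Omega> (v n) \<le> C"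
  shows "w \<in> Lp p \<Omega>" "Lpow p \<Omega> w \<le> C"
proof -
  have [measurable]: "v n \<in> borel_measurable M" for n using v by (rule Lp_measurable)
  have C0: "0 \<le> C"
    using eventually_happens'[OF sequentially_bot C] Lpow_nonneg[of p \<Omega>] order_trans by blast
  have "AE x in M. ennreal (norm (w x) powr p) = liminf (\<lambda>n. ennreal (norm (v n x) powr p))"
    using lim
  proof eventually_elim
    case (elim x)
    have "(\<lambda>n. norm (v n x) powr p) \<longlonglongrightarrow> norm (w x) powr p"
      using elim p_gt_1 by (intro tendsto_powr2 tendsto_norm tendsto_const) auto
    then have "(\<lambda>n. ennreal (norm (v n x) powr p)) \<longlonglongrightarrow> ennreal (norm (w x) powr p)"
      by (intro tendsto_ennrealI)
    then show ?case by (intro lim_imp_Liminf[symmetric]) auto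
  qed
  then have "(\<integral>\<^sup>+x. norm (w x) powr p \<partial>M) = (\<integral>\<^sup>+x. liminf (\<lambda>n. ennreal (norm (v n x) powr p)) \<partial>M)"
    by (rule nn_integral_cong_AE)
  also have "\<dots> \<le> liminf (\<lambda>n. \<integral>\<^sup>+x. norm (v n x) powr p \<partial>M)"
    by (rule nn_integral_liminf) simp
  also have "\<dots> = liminf (\<lambda>n. ennreal (Lpow p \<Omega> (v n)))"
    unfolding Lpow_def using Lp_integrable[OF v] by (simp add: nn_integral_eq_integral)
  also have "\<dots> \<le> ennreal C"
  proof -
    have "liminf (\<lambda>n. ennreal (Lpow p \<Omega> (v n))) \<le> limsup (\<lambda>n. ennreal (Lpow p \<Omega> (v n)))"
      by (rule Liminf_le_Limsup) simp
    also have "\<dots> \<le> ennreal C"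
      by (rule Limsup_bounded) (use C in \<open>auto elim: eventually_mono intro: ennreal_leI\<close>)
    finally show ?thesis .
  qed
  finally have le: "(\<integral>\<^sup>+x. norm (w x) powr p \<partial>M) \<le> ennreal C" .
  then have i: "integrable M (\<lambda>x. norm (w x) powr p)"
    by (intro integrableI_bounded) (auto intro: le_less_trans)
  then show "w \<in> Lp p \<Omega>" by (simp add: Lp_def)
  have "ennreal (Lpow p \<Omega> w) \<le> ennreal C"
    using le unfolding Lpow_def by (subst (asm) nn_integral_eq_integral[OF i]) auto
  then show "Lpow p \<Omega> w \<le> C" using C0 by simp
qed

text \<open>A Cauchy sequence in \<open>L\<^sup>p\<close> is one in \<open>L\<^sup>1\<close> and has a subsequence converging almost everywhere; Fatou's
  lemma bounds the distance of each member from the limit of the subsequence.\<close>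

lemma Lp_complete:
  fixes v :: "nat \<Rightarrow> 'a \<Rightarrow> 'b::euclidean_space"
  assumes v: "\<And>n. v n \<in> Lp p \<Omega>"
    and cauchy: "\<And>e. 0 < e \<Longrightarrow> \<exists>n0. \<forall>m\<ge>n0. \<forall>n\<ge>n0. Lpow p \<Omega> (\<lambda>x. v m x - v n x) < e"
  obtains w where "w \<in> Lp p \<Omega>" "(\<lambda>n. Lpow p \<Omega> (\<lambda>x. v n x - w x)) \<longlonglongrightarrow> 0"
proof -
  have [measurable]: "v n \<in> borel_measurable M" for n using v by (rule Lp_measurable)
  have "\<exists>n0. \<forall>m\<ge>n0. \<forall>n\<ge>n0. LINT x|M. norm (v m x - v n x) < e" if "0 < e" for e
  proof -
    obtain d where d: "0 < d"
      "\<And>v :: 'a \<Rightarrow> 'b. v \<in> Lp p \<Omega> \<Longrightarrow> Lpow p \<Omega> v < d \<Longrightarrow> (LINT x|M. norm (v x)) < e"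
      using L1_small_of_Lpow_small[OF \<open>0 < e\<close>, where ?'b='b] by blast
    with cauchy[OF d(1)] show ?thesis using Lp_diff[OF v v] by blast
  qed
  then obtain r where r: "strict_mono r" "AE x in M. Cauchy (\<lambda>i. v (r i) x)"
    using cauchy_L1_AE_cauchy_subseq[of M v] Lp_imp_integrable(1)[OF v] by blast
  define w where "w x = lim (\<lambda>i. v (r i) x)" for x
  have wm: "w \<in> borel_measurable M"
    unfolding w_def by measurable
  have lim: "AE x in M. (\<lambda>i. v (r i) x) \<longlonglongrightarrow> w x"
    using r(2) by eventually_elim (simp add: w_def Cauchy_convergent convergent_LIMSEQ_iff[symmetric])
  have *: "(\<lambda>x. v n x - w x) \<in> Lp p \<Omega> \<and> Lpow p \<Omega> (\<lambda>x. v n x - w x) \<le> e"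
    if n0: "\<forall>m\<ge>n0. \<forall>n\<ge>n0. Lpow p \<Omega> (\<lambda>x. v m x - v n x) < e" "n \<ge> n0" for n n0 e
  proof -
    have l: "AE x in M. (\<lambda>i. v n x - v (r i) x) \<longlonglongrightarrow> v n x - w x"
      using lim by eventually_elim (intro tendsto_intros)
    have "\<forall>\<^sub>F i in sequentially. r i \<ge> n0"
      using filterlim_subseq[OF r(1)] by (simp add: filterlim_at_top)
    then have "\<forall>\<^sub>F i in sequentially. Lpow p \<Omega> (\<lambda>x. v n x - v (r i) x) \<le> e"
      by eventually_elim (use n0 in \<open>auto intro: less_imp_le\<close>)
    with l show ?thesis
      using Lp_Fatou[of "\<lambda>i x. v n x - v (r i) x" "\<lambda>x. v n x - w x" e] Lp_diff[OF v v] wm by simp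
  qed
  obtain n1 where "\<forall>m\<ge>n1. \<forall>n\<ge>n1. Lpow p \<Omega> (\<lambda>x. v m x - v n x) < 1"
    using cauchy[of 1] by auto
  then have "(\<lambda>x. v n1 x - w x) \<in> Lp p \<Omega>"
    using * by blast
  then have "(\<lambda>x. v n1 x - (v n1 x - w x)) \<in> Lp p \<Omega>"
    by (rule Lp_diff[OF v])
  then have w: "w \<in> Lp p \<Omega>" by simp
  have "(\<lambda>n. Lpow p \<Omega> (\<lambda>x. v n x - w x)) \<longlonglongrightarrow> 0"
  proof (rule LIMSEQ_I)
    fix e :: real assume "0 < e"
    then obtain n0 where "\<forall>m\<ge>n0. \<forall>n\<ge>n0. Lpow p \<Omega> (\<lambda>x. v m x - v n x) < e / 2"
      using cauchy[of "e/2"] by auto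
    then show "\<exists>n0. \<forall>n\<ge>n0. norm (Lpow p \<Omega> (\<lambda>x. v n x - w x) - 0) < e"
    proof (intro exI[of _ n0] allI impI)
      fix n assume "n0 \<le> n"
      with * \<open>\<forall>m\<ge>n0. \<forall>n\<ge>n0. Lpow p \<Omega> (\<lambda>x. v m x - v n x) < e / 2\<close>
      have "Lpow p \<Omega> (\<lambda>x. v n x - w x) \<le> e / 2" by blast
      with \<open>0 < e\<close> show "norm (Lpow p \<Omega> (\<lambda>x. v n x - w x) - 0) < e"
        using Lpow_nonneg[of p \<Omega> "\<lambda>x. v n x - w x"] by simp
    qed
  qed
  with w that show ?thesis by blast
qed

lemma Lp_bounded:
  fixes v :: "'a \<Rightarrow> 'b::euclidean_space"
  assumes [measurable]: "v \<in> borel_measurable M" and "AE x in M. norm (v x) \<le> C"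
  shows "v \<in> Lp p \<Omega>"
proof (rule Lp_dominated(1)[where w="\<lambda>x. \<bar>C\<bar> powr p"])
  show "AE x in M. norm (v x) powr p \<le> \<bar>C\<bar> powr p"
    using assms(2) by eventually_elim (use p_gt_1 in \<open>auto intro!: powr_mono2\<close>)
qed auto

end

section \<open>Integration by parts and uniqueness of weak gradients\<close>

lemma continuous_compact_support:
  fixes v :: "'a::euclidean_space \<Rightarrow> 'b::euclidean_space"
  assumes "continuous_on UNIV v" "compact K" "\<And>x. x \<notin> K \<Longrightarrow> v x = 0"
  shows "integrable lborel v" "\<exists>C\<ge>0. \<forall>x. norm (v x) \<le> C"
proof -
  have "(\<lambda>x. indicator K x *\<^sub>R v x) = v"
    using assms(3) by (auto simp: fun_eq_iff indicator_def)
  with borel_integrable_compact[OF assms(2) continuous_on_subset[OF assms(1)]]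
  show "integrable lborel v" by simp
  have "bounded (v ` K)"
    using assms by (intro compact_imp_bounded compact_continuous_image) (auto intro: continuous_on_subset)
  then obtain C where "\<forall>x\<in>K. norm (v x) \<le> C" by (auto simp: bounded_iff)
  then have "norm (v x) \<le> max C 0" for x
    using assms(3)[of x] by (cases "x \<in> K") (auto simp: le_max_iff_disj)
  then show "\<exists>C\<ge>0. \<forall>x. norm (v x) \<le> C" by (meson max.cobounded2)
qed

lemma test_function_integrable: "test_function \<Omega> \<phi> \<Longrightarrow> integrable lborel \<phi>"
  using test_function_support continuous_compact_support(1) test_function_continuous by blast

lemma test_function_bounded:
  assumes "test_function \<Omega> \<phi>"
  shows "\<exists>C\<ge>0. \<forall>x. \<bar>\<phi> x\<bar> \<le> C"
proof -
  obtain K where "compact K" "\<And>x. x \<notin> K \<Longrightarrow> \<phi> x = 0" using test_function_support[OF assms] by blast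
  from continuous_compact_support(2)[OF test_function_continuous[OF assms] this] show ?thesis by simp
qed

lemma test_function_borel: "test_function \<Omega> \<phi> \<Longrightarrow> \<phi> \<in> borel_measurable borel"
  by (intro borel_measurable_continuous_onI test_function_continuous)

lemma lborel_integral_translation:
  fixes v :: "'a::euclidean_space \<Rightarrow> real"
  assumes "v \<in> borel_measurable borel"
  shows "(LINT x|lborel. v (c + x)) = (LINT x|lborel. v x)"
proof -
  have "(LINT x|lborel. v x) = (LINT x|distr lborel borel ((+) c). v x)"
    by (simp add: lborel_distr_plus)
  also have "\<dots> = (LINT x|lborel. v (c + x))"
    using assms by (intro integral_distr) auto
  finally show ?thesis by simp
qed

lemma lborel_integrable_translation:
  fixes v :: "'a::euclidean_space \<Rightarrow> real"
  assumes "integrable lborel v"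
  shows "integrable lborel (\<lambda>x. v (c + x))"
proof -
  have "integrable (distr lborel borel ((+) c)) v" using assms by (simp add: lborel_distr_plus)
  then show ?thesis by (rule integrable_distr[rotated]) simp
qed

lemma test_function_along_line:
  assumes "test_function \<Omega> \<phi>"
  shows "((\<lambda>t. \<phi> (x + t *\<^sub>R h)) has_real_derivative grad \<phi> (x + t *\<^sub>R h) \<bullet> h) (at t)"
proof -
  have "((\<lambda>t. \<phi> (x + t *\<^sub>R h)) has_derivative (\<lambda>s. grad \<phi> (x + t *\<^sub>R h) \<bullet> (s *\<^sub>R h))) (at t)"
    by (rule has_derivative_compose[OF _ has_derivative_grad[OF test_function_has_derivative[OF assms]],
          of "\<lambda>t. x + t *\<^sub>R h"]) (auto intro!: derivative_eq_intros)
  then show ?thesis by (simp add: has_field_derivative_def mult.commute[of _ "grad \<phi> (x + t *\<^sub>R h) \<bullet> h"])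
qed

text \<open>The integral of \<open>\<phi>\<close> is invariant under translation, so the difference quotients of \<open>\<phi>\<close>
  have integral zero, and they converge boundedly to the partial derivative.\<close>

lemma integral_pderiv_eq_0:
  fixes \<phi> :: "'a::euclidean_space \<Rightarrow> real"
  assumes "test_function \<Omega> \<phi>" "b \<in> Basis"
  shows "(LINT x|lborel. frechet_derivative \<phi> (at x) b) = 0"
proof -
  obtain K where K: "compact K" "\<And>x. x \<notin> K \<Longrightarrow> \<phi> x = 0" using test_function_support[OF assms(1)] by blast
  obtain R where R: "0 < R" "\<And>x. x \<in> K \<Longrightarrow> norm x \<le> R"
    using compact_imp_bounded[OF K(1)] by (auto simp: bounded_pos)
  obtain C where C: "0 \<le> C" "\<And>x. \<bar>frechet_derivative \<phi> (at x) b\<bar> \<le> C"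
    using test_function_bounded[OF test_function_pderiv[OF assms]] by blast
  have [measurable]: "\<phi> \<in> borel_measurable borel" by (rule test_function_borel[OF assms(1)])
  define t where "t n = inverse (real (Suc n))" for n
  have t: "0 < t n" "t n \<le> 1" for n by (auto simp: t_def divide_simps)
  have t0: "t \<longlonglongrightarrow> 0" unfolding t_def by (rule LIMSEQ_inverse_real_of_nat)
  define q where "q n x = (\<phi> (t n *\<^sub>R b + x) - \<phi> x) / t n" for n x
  have [measurable]: "q n \<in> borel_measurable borel" for n unfolding q_def by measurable
  have deriv: "((\<lambda>s. \<phi> (x + s *\<^sub>R b)) has_real_derivative frechet_derivative \<phi> (at (x + s *\<^sub>R b)) b) (at s)" for x s
    using test_function_along_line[OF assms(1), of x b s] grad_inner_Basis[OF assms(2), of \<phi>] by simp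
  have bound: "\<bar>q n x\<bar> \<le> C" for n x
  proof -
    have "\<exists>z>0. z < t n \<and> \<phi> (x + t n *\<^sub>R b) - \<phi> (x + 0 *\<^sub>R b) = (t n - 0) * frechet_derivative \<phi> (at (x + z *\<^sub>R b)) b"
      by (rule MVT2[OF t(1)]) (rule deriv)
    then obtain z where "\<phi> (x + t n *\<^sub>R b) - \<phi> x = t n * frechet_derivative \<phi> (at (x + z *\<^sub>R b)) b" by auto
    then have "q n x = frechet_derivative \<phi> (at (x + z *\<^sub>R b)) b"
      using t(1)[of n] by (simp add: q_def add.commute)
    then show ?thesis using C(2) by simp
  qed
  have supp: "q n x = 0" if "x \<notin> cball 0 (R + 1)" for n x
  proof -
    have x: "norm x > R + 1" using that by simp
    have "norm (t n *\<^sub>R b + x) \<ge> norm x - norm (t n *\<^sub>R b)"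
      by (metis add.commute norm_diff_ineq)
    moreover have "norm (t n *\<^sub>R b) \<le> 1" using t[of n] assms(2) by simp
    ultimately have "t n *\<^sub>R b + x \<notin> K" "x \<notin> K" using x R(1) R(2)[of x] R(2)[of "t n *\<^sub>R b + x"] by auto
    then show ?thesis by (simp add: q_def K(2))
  qed
  have lim: "(\<lambda>n. LINT x|lborel. q n x) \<longlonglongrightarrow> (LINT x|lborel. frechet_derivative \<phi> (at x) b)"
  proof (rule integral_dominated_convergence[where w="\<lambda>x. indicator (cball 0 (R + 1)) x *\<^sub>R C"])
    show "(\<lambda>x. frechet_derivative \<phi> (at x) b) \<in> borel_measurable lborel"
      using test_function_borel[OF test_function_pderiv[OF assms]] by simp
    show "integrable lborel (\<lambda>x::'a. indicator (cball 0 (R + 1)) x *\<^sub>R C)"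
      by (rule borel_integrable_compact) auto
    show "AE x in lborel. norm (q n x) \<le> indicator (cball 0 (R + 1)) x *\<^sub>R C" for n
    proof (rule AE_I2)
      fix x show "norm (q n x) \<le> indicator (cball 0 (R + 1)) x *\<^sub>R C"
        using bound[of n x] supp[of x n] by (cases "x \<in> cball 0 (R + 1)") auto
    qed
    show "AE x in lborel. (\<lambda>n. q n x) \<longlonglongrightarrow> frechet_derivative \<phi> (at x) b"
    proof (rule AE_I2)
      fix x
      have "((\<lambda>h. (\<phi> (x + (0 + h) *\<^sub>R b) - \<phi> (x + 0 *\<^sub>R b)) / h) \<longlongrightarrow> frechet_derivative \<phi> (at (x + 0 *\<^sub>R b)) b) (at 0)"
        using deriv[of x 0] unfolding DERIV_def .
      moreover have "filterlim t (at 0) sequentially"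
        unfolding filterlim_at using t0 t by (auto intro!: always_eventually simp: less_imp_neq[symmetric])
      ultimately have "(\<lambda>n. (\<phi> (x + (0 + t n) *\<^sub>R b) - \<phi> (x + 0 *\<^sub>R b)) / t n) \<longlonglongrightarrow> frechet_derivative \<phi> (at (x + 0 *\<^sub>R b)) b"
        by (rule filterlim_compose)
      then show "(\<lambda>n. q n x) \<longlonglongrightarrow> frechet_derivative \<phi> (at x) b"
        by (simp add: q_def add.commute)
    qed
  qed simp
  have "(LINT x|lborel. q n x) = 0" for n
    unfolding q_def using lborel_integrable_translation[OF test_function_integrable[OF assms(1)], of "t n *\<^sub>R b"]
      test_function_integrable[OF assms(1)]
    by (simp add: lborel_integral_translation)
  with lim show ?thesis by (simp add: LIMSEQ_const_iff)
qed

lemma frechet_derivative_mult_test: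
  assumes "test_function \<Omega> \<phi>" "test_function \<Omega> \<psi>"
  shows "frechet_derivative (\<lambda>x. \<phi> x * \<psi> x) (at x) b =
    \<phi> x * frechet_derivative \<psi> (at x) b + frechet_derivative \<phi> (at x) b * \<psi> x"
  using frechet_derivative_at[OF has_derivative_mult[OF test_function_has_derivative[OF assms(1)]
        test_function_has_derivative[OF assms(2)]], symmetric]
  by (simp add: fun_eq_iff)

lemma integral_by_parts_test:
  fixes \<phi> :: "'a::euclidean_space \<Rightarrow> real"
  assumes "test_function \<Omega> \<phi>" "test_function \<Omega> \<psi>" "b \<in> Basis"
  shows "(LINT x|lborel. \<phi> x * frechet_derivative \<psi> (at x) b)
     = - (LINT x|lborel. (grad \<phi> x \<bullet> b) * \<psi> x)"
proof -
  have t: "test_function \<Omega> (\<lambda>x. \<phi> x * frechet_derivative \<psi> (at x) b)"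
    "test_function \<Omega> (\<lambda>x. frechet_derivative \<phi> (at x) b * \<psi> x)"
    by (intro test_function_mult test_function_pderiv assms test_function_smooth[OF assms(2)]
        test_function_smooth[OF test_function_pderiv[OF assms(2,3)]])+
  have "0 = (LINT x|lborel. frechet_derivative (\<lambda>x. \<phi> x * \<psi> x) (at x) b)"
    by (rule integral_pderiv_eq_0[symmetric, OF test_function_mult[OF assms(1) test_function_smooth[OF assms(2)]] assms(3)])
  also have "\<dots> = (LINT x|lborel. \<phi> x * frechet_derivative \<psi> (at x) b)
     + (LINT x|lborel. frechet_derivative \<phi> (at x) b * \<psi> x)"
    unfolding frechet_derivative_mult_test[OF assms(1,2)]
    by (intro Bochner_Integration.integral_add test_function_integrable[OF t(1)] test_function_integrable[OF t(2)])
  finally show ?thesis by (simp add: grad_inner_Basis[OF assms(3)])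
qed

lemma integral_lebesgue_on_eq_lborel:
  fixes v :: "'a::euclidean_space \<Rightarrow> real"
  assumes "\<Omega> \<in> sets lebesgue" "v \<in> borel_measurable borel" "\<And>x. x \<notin> \<Omega> \<Longrightarrow> v x = 0"
  shows "(LINT x|lebesgue_on \<Omega>. v x) = (LINT x|lborel. v x)"
proof -
  have "(\<lambda>x. if x \<in> \<Omega> then v x else 0) = v" using assms(3) by auto
  then have "(LINT x|lebesgue_on \<Omega>. v x) = (LINT x|lebesgue. v x)"
    using Lebesgue_Measure.integral_restrict_UNIV[OF assms(1), of v] by simp
  with assms(2) show ?thesis by (simp add: integral_completion)
qed

lemma AE_lebesgue_on_cover:
  assumes "open \<Omega>" and "\<And>a c. cbox a c \<subseteq> \<Omega> \<Longrightarrow> AE x in lebesgue. x \<in> cbox a c \<longrightarrow> P x"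
  shows "AE x in lebesgue_on \<Omega>. P x"
proof -
  obtain D where D: "countable D" "D \<subseteq> Pow \<Omega>" "\<And>X. X \<in> D \<Longrightarrow> \<exists>a b. X = cbox a b" "\<Union>D = \<Omega>"
    using open_countable_Union_open_cbox[OF assms(1)] by blast
  have "AE x in lebesgue. \<forall>X\<in>D. x \<in> X \<longrightarrow> P x"
    using D assms(2) by (subst AE_ball_countable) (auto, blast)
  then have "AE x in lebesgue. x \<in> \<Omega> \<longrightarrow> P x"
    by eventually_elim (use D(4) in blast)
  moreover have "\<Omega> \<in> sets lebesgue" using assms(1) by (simp add: borel_open)
  ultimately show ?thesis by (subst AE_restrict_space_iff) auto
qed

text \<open>The fundamental lemma of the calculus of variations. The bumps converge boundedly to the
  indicator of a box, so the integral over every box vanishes, and Lebesgue's differentiation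
  theorem applies.\<close>

lemma AE_zero_if_orthogonal_to_tests:
  fixes g :: "'a::euclidean_space \<Rightarrow> real"
  assumes "open \<Omega>" and g: "locally_integrable \<Omega> g"
    and orth: "\<And>\<phi>. test_function \<Omega> \<phi> \<Longrightarrow> (LINT x|lebesgue_on \<Omega>. g x * \<phi> x) = 0"
  shows "AE x in lebesgue_on \<Omega>. g x = 0"
proof (rule AE_lebesgue_on_cover[OF assms(1)])
  fix a0 c0 :: 'a assume sub0: "cbox a0 c0 \<subseteq> \<Omega>"
  have \<Omega>: "\<Omega> \<in> sets lebesgue" using assms(1) by (simp add: borel_open)
  have int: "g absolutely_integrable_on cbox a c" if "cbox a c \<subseteq> \<Omega>" for a c
    using g that by (auto simp: locally_integrable_def)
  have zero: "integral (cbox a c) g = 0" if sub: "cbox a c \<subseteq> \<Omega>" for a c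
  proof -
    have i: "integrable lebesgue (\<lambda>x. indicator (cbox a c) x *\<^sub>R g x)"
      using int[OF sub] by (simp add: set_integrable_def)
    have "(\<lambda>n. LINT x|lebesgue. (indicator (cbox a c) x *\<^sub>R g x) * box_bump n a c x) \<longlonglongrightarrow>
        (LINT x|lebesgue. (indicator (cbox a c) x *\<^sub>R g x) * indicator (box a c) x)"
    proof (rule integral_dominated_convergence[where w="\<lambda>x. \<bar>indicator (cbox a c) x *\<^sub>R g x\<bar>"])
      have m: "(\<lambda>x. indicator (cbox a c) x *\<^sub>R g x) \<in> borel_measurable lebesgue" using i by auto
      have "box_bump n a c \<in> borel_measurable borel" for n
        using test_function_borel[OF test_function_box_bump[OF order_refl]] .
      then have "box_bump n a c \<in> borel_measurable lebesgue" for n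
        by (intro measurable_completion) simp
      then show "(\<lambda>x. (indicator (cbox a c) x *\<^sub>R g x) * box_bump n a c x) \<in> borel_measurable lebesgue" for n
        using m by (intro borel_measurable_times)
      show "(\<lambda>x. (indicator (cbox a c) x *\<^sub>R g x) * indicator (box a c) x) \<in> borel_measurable lebesgue"
        using m by (intro borel_measurable_times borel_measurable_indicator) (auto simp: borel_open)
      show "integrable lebesgue (\<lambda>x. \<bar>indicator (cbox a c) x *\<^sub>R g x\<bar>)" using i by (rule integrable_abs)
      show "AE x in lebesgue. (\<lambda>n. (indicator (cbox a c) x *\<^sub>R g x) * box_bump n a c x) \<longlonglongrightarrow>
          (indicator (cbox a c) x *\<^sub>R g x) * indicator (box a c) x"
        by (intro AE_I2 tendsto_mult tendsto_const box_bump_tendsto)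
      show "AE x in lebesgue. norm ((indicator (cbox a c) x *\<^sub>R g x) * box_bump n a c x)
          \<le> \<bar>indicator (cbox a c) x *\<^sub>R g x\<bar>" for n
        unfolding real_norm_def abs_mult
        by (intro AE_I2 mult_left_le) (auto simp: box_bump_bounds)
    qed
    moreover have "(LINT x|lebesgue. (indicator (cbox a c) x *\<^sub>R g x) * box_bump n a c x) = 0" for n
    proof -
      have "(\<lambda>x. (indicator (cbox a c) x *\<^sub>R g x) * box_bump n a c x)
          = (\<lambda>x. if x \<in> \<Omega> then g x * box_bump n a c x else 0)"
        using sub box_subset_cbox[of a c] box_bump_eq_0_iff[of n a c]
        by (auto simp: fun_eq_iff indicator_def)
      with orth[OF test_function_box_bump[OF sub, of n]] Lebesgue_Measure.integral_restrict_UNIV[OF \<Omega>, of "\<lambda>x. g x * box_bump n a c x"]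
      show ?thesis by simp
    qed
    ultimately have "(LINT x|lebesgue. (indicator (cbox a c) x *\<^sub>R g x) * indicator (box a c) x) = 0"
      by (simp add: LIMSEQ_const_iff)
    moreover have "(\<lambda>x. (indicator (cbox a c) x *\<^sub>R g x) * indicator (box a c) x) = (\<lambda>x. indicator (box a c) x *\<^sub>R g x)"
      using box_subset_cbox[of a c] by (auto simp: fun_eq_iff indicator_def)
    ultimately have "(LINT x:box a c|lebesgue. g x) = 0" by (simp add: set_lebesgue_integral_def)
    moreover have "g absolutely_integrable_on box a c"
      using int[OF sub] absolutely_integrable_on_open_interval[of a c g] by simp
    ultimately have "integral (box a c) g = 0"
      using set_lebesgue_integral_eq_integral(2)[of "box a c" g] by simp
    then show ?thesis by (simp add: integral_open_interval)
  qed
  define f where "f x = (if x \<in> cbox a0 c0 then g x else 0)" for x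
  have fi: "f integrable_on cbox a b" for a b
  proof -
    have "g integrable_on cbox a0 c0"
      using int[OF sub0] by (rule set_lebesgue_integral_eq_integral(1))
    then have "f integrable_on UNIV"
      unfolding f_def by (simp add: integrable_restrict_UNIV)
    then show ?thesis by (rule integrable_on_subcbox) auto
  qed
  obtain N where N: "negligible N"
    "\<And>x e. \<lbrakk>x \<notin> N; 0 < e\<rbrakk> \<Longrightarrow> \<exists>d>0. \<forall>h. 0 < h \<and> h < d \<longrightarrow>
        norm (integral (cbox x (x + h *\<^sub>R One)) f /\<^sub>R h ^ DIM('a) - f x) < e"
    using integrable_ccontinuous_explicit[OF fi] by blast
  have "g x = 0" if x: "x \<in> box a0 c0" "x \<notin> N" for x
  proof (rule ccontr)
    assume "g x \<noteq> 0"
    then obtain d where d: "d > 0" "\<And>h. 0 < h \<Longrightarrow> h < d \<Longrightarrow>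
        norm (integral (cbox x (x + h *\<^sub>R One)) f /\<^sub>R h ^ DIM('a) - f x) < \<bar>g x\<bar>"
      using N(2)[OF x(2), of "\<bar>g x\<bar>"] by auto
    obtain e where e: "e > 0" "ball x e \<subseteq> box a0 c0"
      using x(1) open_box openE by blast
    \<comment> \<open>So small that the cube with corner \<open>x\<close> and side \<open>h\<close> stays inside the box.\<close>
    define h where "h = min (d / 2) (e / (2 * real DIM('a)))"
    have h: "0 < h" "h < d" "h * real DIM('a) < e"
      using d e DIM_positive[where 'a='a] by (auto simp: h_def min_def field_simps)
    have sub: "cbox x (x + h *\<^sub>R One) \<subseteq> cbox a0 c0"
    proof
      fix y assume y: "y \<in> cbox x (x + h *\<^sub>R One)"
      have "norm (y - x) \<le> (\<Sum>b\<in>Basis. \<bar>(y - x) \<bullet> b\<bar>)" by (rule norm_le_l1)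
      also have "\<dots> \<le> (\<Sum>b\<in>(Basis::'a set). h)"
        using y by (intro sum_mono) (auto simp: mem_box algebra_simps)
      also have "\<dots> = h * real DIM('a)" by simp
      finally have "y \<in> ball x e" using h(3) by (simp add: dist_norm norm_minus_commute)
      with e(2) box_subset_cbox show "y \<in> cbox a0 c0" by blast
    qed
    have "integral (cbox x (x + h *\<^sub>R One)) f = integral (cbox x (x + h *\<^sub>R One)) g"
      using sub by (intro integral_cong) (auto simp: f_def)
    also have "\<dots> = 0" using zero sub sub0 by blast
    finally have "norm (f x) < \<bar>g x\<bar>" using d(2)[OF h(1,2)] by simp
    moreover have "f x = g x" using x(1) box_subset_cbox by (auto simp: f_def)
    ultimately show False by simp
  qed
  moreover have "N \<union> (cbox a0 c0 - box a0 c0) \<in> null_sets lebesgue"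
    using N(1) negligible_frontier_interval[of a0 c0] by (simp add: negligible_iff_null_sets[symmetric])
  ultimately show "AE x in lebesgue. x \<in> cbox a0 c0 \<longrightarrow> g x = 0"
    by (intro AE_I'[of "N \<union> (cbox a0 c0 - box a0 c0)"]) auto
qed

lemma locally_integrable_test_integrable:
  fixes v :: "'a::euclidean_space \<Rightarrow> 'b::euclidean_space"
  assumes "\<Omega> \<in> sets lebesgue" "test_function \<Omega> \<phi>" "locally_integrable \<Omega> v"
  shows "integrable (lebesgue_on \<Omega>) (\<lambda>x. \<phi> x *\<^sub>R v x)"
proof -
  obtain K where K: "compact K" "K \<subseteq> \<Omega>" "\<And>x. x \<notin> K \<Longrightarrow> \<phi> x = 0"
    using test_function_support[OF assms(2)] by blast
  obtain C where C: "0 \<le> C" "\<And>x. \<bar>\<phi> x\<bar> \<le> C" using test_function_bounded[OF assms(2)] by blast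
  have i: "integrable lebesgue (\<lambda>x. indicator K x *\<^sub>R v x)"
    using assms(3) K unfolding locally_integrable_def set_integrable_def by blast
  have "\<phi> \<in> borel_measurable lebesgue"
    using test_function_borel[OF assms(2)] by (intro measurable_completion) simp
  then have m: "(\<lambda>x. \<phi> x *\<^sub>R (indicator K x *\<^sub>R v x)) \<in> borel_measurable lebesgue"
    using borel_measurable_integrable[OF i] borel_measurable_scaleR by blast
  have "integrable lebesgue (\<lambda>x. \<phi> x *\<^sub>R (indicator K x *\<^sub>R v x))"
    by (rule Bochner_Integration.integrable_bound[OF integrable_scaleR_right[OF i, of C] m])
       (use C in \<open>auto intro!: AE_I2 mult_right_mono simp: indicator_def\<close>)
  moreover have "(\<lambda>x. \<phi> x *\<^sub>R (indicator K x *\<^sub>R v x)) = (\<lambda>x. indicator \<Omega> x *\<^sub>R (\<phi> x *\<^sub>R v x))"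
    using K by (auto simp: fun_eq_iff indicator_def)
  ultimately show ?thesis using assms(1) by (simp add: integrable_restrict_space)
qed

lemma has_weak_gradient_AE_unique:
  assumes "open \<Omega>" "has_weak_gradient \<Omega> u G" "has_weak_gradient \<Omega> u H"
  shows "AE x in lebesgue_on \<Omega>. G x = H x"
proof -
  have loc: "locally_integrable \<Omega> (\<lambda>x. (G x - H x) \<bullet> b)" for b
    unfolding locally_integrable_def
  proof (intro allI impI)
    fix K assume K: "compact K \<and> K \<subseteq> \<Omega>"
    have "integrable lebesgue (\<lambda>x. indicator K x *\<^sub>R G x)" "integrable lebesgue (\<lambda>x. indicator K x *\<^sub>R H x)"
      using assms(2,3) K unfolding has_weak_gradient_def locally_integrable_def set_integrable_def by auto
    then have "integrable lebesgue (\<lambda>x. (indicator K x *\<^sub>R G x - indicator K x *\<^sub>R H x) \<bullet> b)"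
      by (intro integrable_inner_left Bochner_Integration.integrable_diff)
    then show "(\<lambda>x. (G x - H x) \<bullet> b) absolutely_integrable_on K"
      by (simp add: set_integrable_def scaleR_diff_right[symmetric])
  qed
  have "AE x in lebesgue_on \<Omega>. (G x - H x) \<bullet> b = 0" if b: "b \<in> Basis" for b
  proof (rule AE_zero_if_orthogonal_to_tests[OF assms(1) loc])
    fix \<phi> :: "'a \<Rightarrow> real" assume \<phi>: "test_function \<Omega> \<phi>"
    have i: "integrable (lebesgue_on \<Omega>) (\<lambda>x. (K x \<bullet> b) * \<phi> x)" if K: "locally_integrable \<Omega> K" for K
      using integrable_inner_left[OF locally_integrable_test_integrable[OF _ \<phi> K], of b] assms(1)
      by (simp add: borel_open mult.commute)
    show "(LINT x|lebesgue_on \<Omega>. (G x - H x) \<bullet> b * \<phi> x) = 0"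
      using assms(2,3) \<phi> b i unfolding has_weak_gradient_def
      by (simp add: inner_diff_left left_diff_distrib)
  qed
  then have "AE x in lebesgue_on \<Omega>. \<forall>b\<in>Basis. (G x - H x) \<bullet> b = 0"
    by (simp add: AE_finite_all)
  then show ?thesis
    by eventually_elim (metis euclidean_all_zero_iff right_minus_eq)
qed

section \<open>The Sobolev space with zero boundary values\<close>

lemma grad_add:
  assumes "test_function \<Omega> \<phi>" "test_function \<Omega> \<psi>"
  shows "grad (\<lambda>x. \<phi> x + \<psi> x) x = grad \<phi> x + grad \<psi> x"
  using frechet_derivative_at[OF has_derivative_add[OF test_function_has_derivative[OF assms(1)]
        test_function_has_derivative[OF assms(2)]], of x, symmetric]
  by (simp add: grad_def scaleR_add_left sum.distrib)

lemma grad_scale: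
  assumes "test_function \<Omega> \<phi>"
  shows "grad (\<lambda>x. c * \<phi> x) x = c *\<^sub>R grad \<phi> x"
  using frechet_derivative_at[OF has_derivative_mult_right[OF test_function_has_derivative[OF assms], of c], of x, symmetric]
  by (simp add: grad_def scaleR_sum_right)

lemma grad_continuous:
  assumes "test_function \<Omega> \<phi>"
  shows "continuous_on UNIV (grad \<phi>)"
  unfolding grad_def
  by (intro continuous_on_sum continuous_on_scaleR continuous_on_const
      test_function_continuous[OF test_function_pderiv[OF assms]])

lemma grad_borel: "test_function \<Omega> \<phi> \<Longrightarrow> grad \<phi> \<in> borel_measurable borel"
  by (intro borel_measurable_continuous_onI grad_continuous)

lemma grad_support:
  assumes "test_function \<Omega> \<phi>"
  shows "\<exists>K. compact K \<and> K \<subseteq> \<Omega> \<and> (\<forall>x. x \<notin> K \<longrightarrow> \<phi> x = 0 \<and> grad \<phi> x = 0)"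
proof -
  obtain K where K: "compact K" "K \<subseteq> \<Omega>" "\<And>x. x \<notin> K \<Longrightarrow> \<phi> x = 0"
    using test_function_support[OF assms] by blast
  have "grad \<phi> x = 0" if "x \<notin> K" for x
  proof -
    have "(\<phi> has_derivative (\<lambda>h. 0)) (at x)"
      by (rule has_derivative_transform_within_open[of "\<lambda>x. 0" _ _ _ "- K"])
         (use K that in \<open>auto simp: compact_imp_closed open_Compl\<close>)
    then show ?thesis unfolding grad_def by (simp add: frechet_derivative_at[symmetric])
  qed
  with K show ?thesis by blast
qed

lemma locally_integrable_diff:
  "locally_integrable \<Omega> u \<Longrightarrow> locally_integrable \<Omega> v \<Longrightarrow> locally_integrable \<Omega> (\<lambda>x. u x - v x)"
  unfolding locally_integrable_def by (auto intro: set_integral_diff(1))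

lemma has_weak_gradient_diff:
  assumes \<Omega>: "\<Omega> \<in> sets lebesgue" and u: "has_weak_gradient \<Omega> u G" and v: "has_weak_gradient \<Omega> v H"
  shows "has_weak_gradient \<Omega> (\<lambda>x. u x - v x) (\<lambda>x. G x - H x)"
proof -
  have loc: "locally_integrable \<Omega> u" "locally_integrable \<Omega> G" "locally_integrable \<Omega> v" "locally_integrable \<Omega> H"
    using u v by (auto simp: has_weak_gradient_def)
  have "(LINT x|lebesgue_on \<Omega>. (u x - v x) * frechet_derivative \<psi> (at x) b)
        = - (LINT x|lebesgue_on \<Omega>. ((G x - H x) \<bullet> b) * \<psi> x)"
    if \<psi>: "test_function \<Omega> \<psi>" and b: "b \<in> Basis" for \<psi> b
  proof -
    have 1: "integrable (lebesgue_on \<Omega>) (\<lambda>x. w x * frechet_derivative \<psi> (at x) b)"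
      if "locally_integrable \<Omega> w" for w :: "'a \<Rightarrow> real"
      using locally_integrable_test_integrable[OF \<Omega> test_function_pderiv[OF \<psi> b] that]
      by (simp add: mult.commute)
    have 2: "integrable (lebesgue_on \<Omega>) (\<lambda>x. (w x \<bullet> b) * \<psi> x)"
      if "locally_integrable \<Omega> w" for w :: "'a \<Rightarrow> 'a"
      using integrable_inner_left[OF locally_integrable_test_integrable[OF \<Omega> \<psi> that], of b]
      by (simp add: mult.commute)
    have "(LINT x|lebesgue_on \<Omega>. u x * frechet_derivative \<psi> (at x) b)
          = - (LINT x|lebesgue_on \<Omega>. (G x \<bullet> b) * \<psi> x)"
      "(LINT x|lebesgue_on \<Omega>. v x * frechet_derivative \<psi> (at x) b)
          = - (LINT x|lebesgue_on \<Omega>. (H x \<bullet> b) * \<psi> x)"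
      using u v \<psi> b by (auto simp: has_weak_gradient_def)
    then show ?thesis
      by (simp add: inner_diff_left left_diff_distrib 1 2 loc)
  qed
  with loc show ?thesis by (auto simp: has_weak_gradient_def intro: locally_integrable_diff)
qed

context lp_domain
begin

lemma test_function_Lp:
  assumes "test_function \<Omega> \<phi>"
  shows "\<phi> \<in> Lp p \<Omega>" "grad \<phi> \<in> Lp p \<Omega>"
proof -
  obtain K where K: "compact K" "K \<subseteq> \<Omega>" "\<And>x. x \<notin> K \<Longrightarrow> \<phi> x = 0" "\<And>x. x \<notin> K \<Longrightarrow> grad \<phi> x = 0"
    using grad_support[OF assms] by blast
  obtain C D where "\<forall>x. norm (\<phi> x) \<le> C" "\<forall>x. norm (grad \<phi> x) \<le> D"
    using continuous_compact_support(2)[OF test_function_continuous[OF assms] K(1,3)]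
      continuous_compact_support(2)[OF grad_continuous[OF assms] K(1,4)] by blast
  then show "\<phi> \<in> Lp p \<Omega>" "grad \<phi> \<in> Lp p \<Omega>"
    using borel_measurable_lebesgue_onI[OF test_function_borel[OF assms]]
      borel_measurable_lebesgue_onI[OF grad_borel[OF assms]]
    by (auto intro: Lp_bounded[where C=C] Lp_bounded[where C=D])
qed

text \<open>Membership in the closure of the test functions, with the gradient as an explicit second
  component; \<open>W1p_0_iff_sob0\<close> below identifies it with the space of the problem.\<close>

definition sob0 :: "('a \<Rightarrow> real) \<Rightarrow> ('a \<Rightarrow> 'a) \<Rightarrow> bool" where
  "sob0 u G \<longleftrightarrow> u \<in> Lp p \<Omega> \<and> G \<in> Lp p \<Omega> \<and> (\<exists>\<phi>. (\<forall>n::nat. test_function \<Omega> (\<phi> n)) \<and>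
     (\<lambda>n. Lpow p \<Omega> (\<lambda>x. \<phi> n x - u x)) \<longlonglongrightarrow> 0 \<and>
     (\<lambda>n. Lpow p \<Omega> (\<lambda>x. grad (\<phi> n) x - G x)) \<longlonglongrightarrow> 0)"

lemma sob0_Lp: "sob0 u G \<Longrightarrow> u \<in> Lp p \<Omega>" "sob0 u G \<Longrightarrow> G \<in> Lp p \<Omega>"
  by (auto simp: sob0_def)

lemma sob0_test_function: "test_function \<Omega> \<phi> \<Longrightarrow> sob0 \<phi> (grad \<phi>)"
  unfolding sob0_def using p_gt_1
  by (auto simp: test_function_Lp Lpow_def intro!: exI[of _ "\<lambda>n. \<phi>"])

lemma sob0_zero: "sob0 (\<lambda>x. 0) (\<lambda>x. 0)"
proof -
  have "grad (\<lambda>x::'a. 0::real) = (\<lambda>x. 0)"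
    by (auto simp: grad_def fun_eq_iff frechet_derivative_const)
  with sob0_test_function[OF test_function_zero] show ?thesis by simp
qed

lemma sob0_AE_cong:
  assumes "sob0 u G" "AE x in M. u x = v x" "AE x in M. G x = H x"
  shows "sob0 v H"
proof -
  obtain \<phi> where \<phi>: "\<And>n::nat. test_function \<Omega> (\<phi> n)"
     "(\<lambda>n. Lpow p \<Omega> (\<lambda>x. \<phi> n x - u x)) \<longlonglongrightarrow> 0"
     "(\<lambda>n. Lpow p \<Omega> (\<lambda>x. grad (\<phi> n) x - G x)) \<longlonglongrightarrow> 0" using assms(1) unfolding sob0_def by blast
  have u: "AE x in M. \<phi> n x - u x = \<phi> n x - v x" for n
    using assms(2) by eventually_elim simp
  have G: "AE x in M. grad (\<phi> n) x - G x = grad (\<phi> n) x - H x" for n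
    using assms(3) by eventually_elim simp
  have "Lpow p \<Omega> (\<lambda>x. \<phi> n x - v x) = Lpow p \<Omega> (\<lambda>x. \<phi> n x - u x)" for n
    by (rule Lp_AE_cong(2)[OF Lp_diff[OF test_function_Lp(1)[OF \<phi>(1)] sob0_Lp(1)[OF assms(1)]] u])
  moreover have "Lpow p \<Omega> (\<lambda>x. grad (\<phi> n) x - H x) = Lpow p \<Omega> (\<lambda>x. grad (\<phi> n) x - G x)" for n
    by (rule Lp_AE_cong(2)[OF Lp_diff[OF test_function_Lp(2)[OF \<phi>(1)] sob0_Lp(2)[OF assms(1)]] G])
  ultimately show ?thesis
    unfolding sob0_def using Lp_AE_cong(1)[OF sob0_Lp(1)[OF assms(1)] assms(2)]
      Lp_AE_cong(1)[OF sob0_Lp(2)[OF assms(1)] assms(3)] \<phi> by (intro conjI exI[of _ \<phi>]) simp_all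
qed

lemma Lpow_add_tendsto_0:
  assumes "\<And>n. v n \<in> Lp p \<Omega>" "\<And>n. w n \<in> Lp p \<Omega>"
    "(\<lambda>n. Lpow p \<Omega> (v n)) \<longlonglongrightarrow> 0" "(\<lambda>n. Lpow p \<Omega> (w n)) \<longlonglongrightarrow> 0"
  shows "(\<lambda>n. Lpow p \<Omega> (\<lambda>x. v n x + w n x)) \<longlonglongrightarrow> 0"
proof (rule Lpow_tendsto_0I)
  show "Lpow p \<Omega> (\<lambda>x. v n x + w n x) \<le> (1 - 1/2) powr (1 - p) * Lpow p \<Omega> (v n) + (1/2) powr (1 - p) * Lpow p \<Omega> (w n)" for n
    by (rule Lp_add_bound(2)) (use assms in auto)
  show "(\<lambda>n. (1 - 1/2) powr (1 - p) * Lpow p \<Omega> (v n) + (1/2) powr (1 - p) * Lpow p \<Omega> (w n)) \<longlonglongrightarrow> 0"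
    by (intro tendsto_add_zero tendsto_mult_right_zero assms)
qed

lemma Lpow_scale_tendsto_0:
  assumes "\<And>n. v n \<in> Lp p \<Omega>" "(\<lambda>n. Lpow p \<Omega> (v n)) \<longlonglongrightarrow> 0"
  shows "(\<lambda>n. Lpow p \<Omega> (\<lambda>x. c *\<^sub>R v n x)) \<longlonglongrightarrow> 0"
  using tendsto_mult_right_zero[OF assms(2), of "\<bar>c\<bar> powr p"] by (simp add: Lp_scaleR(2)[OF assms(1)])

lemma sob0_add:
  assumes "sob0 u G" "sob0 v H"
  shows "sob0 (\<lambda>x. u x + v x) (\<lambda>x. G x + H x)"
proof -
  obtain \<phi> where \<phi>: "\<And>n::nat. test_function \<Omega> (\<phi> n)"
     "(\<lambda>n. Lpow p \<Omega> (\<lambda>x. \<phi> n x - u x)) \<longlonglongrightarrow> 0"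
     "(\<lambda>n. Lpow p \<Omega> (\<lambda>x. grad (\<phi> n) x - G x)) \<longlonglongrightarrow> 0" using assms(1) unfolding sob0_def by blast
  obtain \<psi> where \<psi>: "\<And>n::nat. test_function \<Omega> (\<psi> n)"
     "(\<lambda>n. Lpow p \<Omega> (\<lambda>x. \<psi> n x - v x)) \<longlonglongrightarrow> 0"
     "(\<lambda>n. Lpow p \<Omega> (\<lambda>x. grad (\<psi> n) x - H x)) \<longlonglongrightarrow> 0" using assms(2) unfolding sob0_def by blast
  note L = sob0_Lp[OF assms(1)] sob0_Lp[OF assms(2)] test_function_Lp[OF \<phi>(1)] test_function_Lp[OF \<psi>(1)]
  have "(\<lambda>n. Lpow p \<Omega> (\<lambda>x. (\<phi> n x - u x) + (\<psi> n x - v x))) \<longlonglongrightarrow> 0"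
    "(\<lambda>n. Lpow p \<Omega> (\<lambda>x. (grad (\<phi> n) x - G x) + (grad (\<psi> n) x - H x))) \<longlonglongrightarrow> 0"
    by (intro Lpow_add_tendsto_0 Lp_diff L \<phi> \<psi>)+
  then show ?thesis unfolding sob0_def
    by (intro conjI Lp_add L exI[of _ "\<lambda>n x. \<phi> n x + \<psi> n x"] allI test_function_add \<phi>(1) \<psi>(1))
       (simp_all add: grad_add[OF \<phi>(1) \<psi>(1)] algebra_simps)
qed

lemma sob0_scale:
  assumes "sob0 u G"
  shows "sob0 (\<lambda>x. c * u x) (\<lambda>x. c *\<^sub>R G x)"
proof -
  obtain \<phi> where \<phi>: "\<And>n::nat. test_function \<Omega> (\<phi> n)"
     "(\<lambda>n. Lpow p \<Omega> (\<lambda>x. \<phi> n x - u x)) \<longlonglongrightarrow> 0"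
     "(\<lambda>n. Lpow p \<Omega> (\<lambda>x. grad (\<phi> n) x - G x)) \<longlonglongrightarrow> 0" using assms(1) unfolding sob0_def by blast
  note L = sob0_Lp[OF assms(1)] test_function_Lp[OF \<phi>(1)]
  have "(\<lambda>n. Lpow p \<Omega> (\<lambda>x. c *\<^sub>R (\<phi> n x - u x))) \<longlonglongrightarrow> 0"
    "(\<lambda>n. Lpow p \<Omega> (\<lambda>x. c *\<^sub>R (grad (\<phi> n) x - G x))) \<longlonglongrightarrow> 0"
    by (intro Lpow_scale_tendsto_0 Lp_diff L \<phi>)+
  then have "(\<lambda>n. Lpow p \<Omega> (\<lambda>x. c * \<phi> n x - c * u x)) \<longlonglongrightarrow> 0"
    "(\<lambda>n. Lpow p \<Omega> (\<lambda>x. grad (\<lambda>x. c * \<phi> n x) x - c *\<^sub>R G x)) \<longlonglongrightarrow> 0"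
    by (simp_all add: grad_scale[OF \<phi>(1)] right_diff_distrib scaleR_diff_right)
  moreover have "(\<lambda>x. c * u x) \<in> Lp p \<Omega>" "(\<lambda>x. c *\<^sub>R G x) \<in> Lp p \<Omega>"
    using Lp_scaleR(1)[OF L(1), of c] Lp_scaleR(1)[OF L(2), of c] by simp_all
  ultimately show ?thesis unfolding sob0_def
    using test_function_scale[OF \<phi>(1)] by (intro conjI exI[of _ "\<lambda>n x. c * \<phi> n x"] allI)
qed

lemma sob0_diff:
  assumes "sob0 u G" "sob0 v H"
  shows "sob0 (\<lambda>x. u x - v x) (\<lambda>x. G x - H x)"
  using sob0_add[OF assms(1) sob0_scale[OF assms(2), of "-1"]] by simp

lemma sob0_approx:
  assumes "sob0 u G" "0 < e"
  shows "\<exists>\<phi>. test_function \<Omega> \<phi> \<and> Lpow p \<Omega> (\<lambda>x. \<phi> x - u x) \<le> e \<and> Lpow p \<Omega> (\<lambda>x. grad \<phi> x - G x) \<le> e"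
proof -
  obtain \<phi> where \<phi>: "\<And>n::nat. test_function \<Omega> (\<phi> n)"
    "(\<lambda>k. Lpow p \<Omega> (\<lambda>x. \<phi> k x - u x)) \<longlonglongrightarrow> 0"
    "(\<lambda>k. Lpow p \<Omega> (\<lambda>x. grad (\<phi> k) x - G x)) \<longlonglongrightarrow> 0" using assms(1) unfolding sob0_def by blast
  from eventually_conj[OF order_tendstoD(2)[OF \<phi>(2) assms(2)] order_tendstoD(2)[OF \<phi>(3) assms(2)]]
  obtain k where "Lpow p \<Omega> (\<lambda>x. \<phi> k x - u x) < e" "Lpow p \<Omega> (\<lambda>x. grad (\<phi> k) x - G x) < e"
    by (auto simp: eventually_sequentially)
  with \<phi>(1) show ?thesis by (intro exI[of _ "\<phi> k"]) auto
qed

lemma sob0_closed: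
  assumes "\<And>n::nat. sob0 (u n) (G n)" "v \<in> Lp p \<Omega>" "H \<in> Lp p \<Omega>"
    "(\<lambda>n. Lpow p \<Omega> (\<lambda>x. u n x - v x)) \<longlonglongrightarrow> 0" "(\<lambda>n. Lpow p \<Omega> (\<lambda>x. G n x - H x)) \<longlonglongrightarrow> 0"
  shows "sob0 v H"
proof -
  have "\<exists>\<phi>. test_function \<Omega> \<phi> \<and> Lpow p \<Omega> (\<lambda>x. \<phi> x - u n x) \<le> inverse (real (Suc n)) \<and>
      Lpow p \<Omega> (\<lambda>x. grad \<phi> x - G n x) \<le> inverse (real (Suc n))" for n
    by (rule sob0_approx[OF assms(1)]) simp
  then obtain \<phi> where \<phi>: "\<And>n. test_function \<Omega> (\<phi> n)"
    "\<And>n. Lpow p \<Omega> (\<lambda>x. \<phi> n x - u n x) \<le> inverse (real (Suc n))"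
    "\<And>n. Lpow p \<Omega> (\<lambda>x. grad (\<phi> n) x - G n x) \<le> inverse (real (Suc n))" by metis
  have "(\<lambda>n. Lpow p \<Omega> (\<lambda>x. \<phi> n x - u n x)) \<longlonglongrightarrow> 0" "(\<lambda>n. Lpow p \<Omega> (\<lambda>x. grad (\<phi> n) x - G n x)) \<longlonglongrightarrow> 0"
    by (rule Lpow_tendsto_0I[OF \<phi>(2) LIMSEQ_inverse_real_of_nat] Lpow_tendsto_0I[OF \<phi>(3) LIMSEQ_inverse_real_of_nat])+
  then have "(\<lambda>n. Lpow p \<Omega> (\<lambda>x. \<phi> n x - v x)) \<longlonglongrightarrow> 0" "(\<lambda>n. Lpow p \<Omega> (\<lambda>x. grad (\<phi> n) x - H x)) \<longlonglongrightarrow> 0"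
    using Lpow_tendsto_trans[OF test_function_Lp(1)[OF \<phi>(1)] sob0_Lp(1)[OF assms(1)] assms(2) _ assms(4)]
      Lpow_tendsto_trans[OF test_function_Lp(2)[OF \<phi>(1)] sob0_Lp(2)[OF assms(1)] assms(3) _ assms(5)] by auto
  with \<phi>(1) assms(2,3) show ?thesis unfolding sob0_def by blast
qed

text \<open>Convergence in \<open>L\<^sup>p\<close> implies convergence of integrals against bounded functions; with smooth
  compactly supported \<open>z\<close> this passes integration by parts to the limit.\<close>

lemma integral_inner_tendsto:
  fixes v :: "nat \<Rightarrow> 'a \<Rightarrow> 'b::euclidean_space"
  assumes v: "\<And>n. v n \<in> Lp p \<Omega>" and w: "w \<in> Lp p \<Omega>" and lim: "(\<lambda>n. Lpow p \<Omega> (\<lambda>x. v n x - w x)) \<longlonglongrightarrow> 0"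
    and z[measurable]: "z \<in> borel_measurable M" and C: "\<And>x. norm (z x) \<le> C"
  shows "(\<lambda>n. LINT x|M. v n x \<bullet> z x) \<longlonglongrightarrow> (LINT x|M. w x \<bullet> z x)"
proof -
  have i: "integrable M (\<lambda>x. y x \<bullet> z x)" if y: "y \<in> Lp p \<Omega>" for y :: "'a \<Rightarrow> 'b"
  proof (rule Bochner_Integration.integrable_bound)
    show "integrable M (\<lambda>x. C * norm (y x))" using Lp_imp_integrable(1)[OF y] by simp
    show "(\<lambda>x. y x \<bullet> z x) \<in> borel_measurable M" using Lp_measurable[OF y] by (intro borel_measurable_inner z)
    have "\<bar>y x \<bullet> z x\<bar> \<le> C * norm (y x)" for x
      using Cauchy_Schwarz_ineq2[of "y x" "z x"] mult_left_mono[OF C[of x] norm_ge_zero[of "y x"]]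
      by (simp add: mult.commute)
    then show "AE x in M. norm (y x \<bullet> z x) \<le> norm (C * norm (y x))"
      by (auto intro!: AE_I2 order_trans[OF _ abs_ge_self])
  qed
  have "(\<lambda>n. C * (LINT x|M. norm (v n x - w x))) \<longlonglongrightarrow> 0"
    by (intro tendsto_mult_right_zero L1_tendsto_of_Lpow_tendsto Lp_diff v w lim)
  moreover have "norm ((LINT x|M. v n x \<bullet> z x) - (LINT x|M. w x \<bullet> z x)) \<le> C * (LINT x|M. norm (v n x - w x))" for n
  proof -
    have d: "(\<lambda>x. v n x - w x) \<in> Lp p \<Omega>" by (intro Lp_diff v w)
    have "(LINT x|M. v n x \<bullet> z x) - (LINT x|M. w x \<bullet> z x) = (LINT x|M. (v n x - w x) \<bullet> z x)"
      by (simp add: i v w inner_diff_left)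
    also have "norm \<dots> \<le> (LINT x|M. norm ((v n x - w x) \<bullet> z x))" by (rule integral_norm_bound)
    also have "\<dots> \<le> (LINT x|M. C * norm (v n x - w x))"
    proof (intro integral_mono integrable_norm i d integrable_mult_right Lp_imp_integrable)
      show "norm ((v n x - w x) \<bullet> z x) \<le> C * norm (v n x - w x)" for x
        using Cauchy_Schwarz_ineq2[of "v n x - w x" "z x"] mult_left_mono[OF C[of x] norm_ge_zero[of "v n x - w x"]]
        by (simp add: mult.commute)
    qed
    finally show ?thesis by simp
  qed
  ultimately have "(\<lambda>n. (LINT x|M. v n x \<bullet> z x) - (LINT x|M. w x \<bullet> z x)) \<longlonglongrightarrow> 0"
    using Lim_null_comparison[OF always_eventually, of "\<lambda>n. (LINT x|M. v n x \<bullet> z x) - (LINT x|M. w x \<bullet> z x)"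
        "\<lambda>n. C * (LINT x|M. norm (v n x - w x))" sequentially] by blast
  then show ?thesis by (rule LIM_zero_cancel)
qed

lemma Lp_locally_integrable:
  fixes v :: "'a \<Rightarrow> 'b::euclidean_space"
  assumes "v \<in> Lp p \<Omega>"
  shows "locally_integrable \<Omega> v"
  unfolding locally_integrable_def
proof (intro allI impI)
  fix K :: "'a set" assume K: "compact K \<and> K \<subseteq> \<Omega>"
  have "integrable lebesgue (\<lambda>x. indicator \<Omega> x *\<^sub>R v x)"
    using Lp_imp_integrable(1)[OF assms] by (simp add: integrable_restrict_space)
  from integrable_mult_indicator[OF _ this, of K]
  have "integrable lebesgue (\<lambda>x. indicator K x *\<^sub>R (indicator \<Omega> x *\<^sub>R v x))"
    using K by (simp add: compact_imp_closed)
  moreover have "(\<lambda>x. indicator K x *\<^sub>R (indicator \<Omega> x *\<^sub>R v x)) = (\<lambda>x. indicator K x *\<^sub>R v x)"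
    using K by (auto simp: fun_eq_iff indicator_def)
  ultimately show "v absolutely_integrable_on K" by (simp only: set_integrable_def)
qed

lemma sob0_has_weak_gradient:
  assumes "sob0 u G"
  shows "has_weak_gradient \<Omega> u G"
  unfolding has_weak_gradient_def
proof (intro conjI allI impI ballI Lp_locally_integrable sob0_Lp[OF assms])
  fix \<psi> :: "'a \<Rightarrow> real" and b :: 'a assume \<psi>: "test_function \<Omega> \<psi>" and b: "b \<in> Basis"
  obtain \<phi> where \<phi>: "\<And>n::nat. test_function \<Omega> (\<phi> n)"
     "(\<lambda>n. Lpow p \<Omega> (\<lambda>x. \<phi> n x - u x)) \<longlonglongrightarrow> 0"
     "(\<lambda>n. Lpow p \<Omega> (\<lambda>x. grad (\<phi> n) x - G x)) \<longlonglongrightarrow> 0" using assms(1) unfolding sob0_def by blast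
  note L = sob0_Lp[OF assms(1)] test_function_Lp[OF \<phi>(1)]
  note \<psi>' = test_function_pderiv[OF \<psi> b]
  obtain C D where CD: "\<And>x. \<bar>\<psi> x\<bar> \<le> C" "\<And>x. \<bar>frechet_derivative \<psi> (at x) b\<bar> \<le> D"
    using test_function_bounded[OF \<psi>] test_function_bounded[OF \<psi>'] by blast
  have m: "\<psi> \<in> borel_measurable M" "pderiv_at \<psi> b \<in> borel_measurable M"
    using test_function_borel[OF \<psi>] test_function_borel[OF \<psi>'] by (auto intro: borel_measurable_lebesgue_onI)
  have "(\<lambda>n. LINT x|M. \<phi> n x \<bullet> frechet_derivative \<psi> (at x) b) \<longlonglongrightarrow> (LINT x|M. u x \<bullet> frechet_derivative \<psi> (at x) b)"
    by (rule integral_inner_tendsto[where C=D]) (use L \<phi> m CD in auto)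
  then have 1: "(\<lambda>n. LINT x|M. \<phi> n x * frechet_derivative \<psi> (at x) b) \<longlonglongrightarrow> (LINT x|M. u x * frechet_derivative \<psi> (at x) b)"
    by simp
  have "(\<lambda>n. LINT x|M. grad (\<phi> n) x \<bullet> (\<psi> x *\<^sub>R b)) \<longlonglongrightarrow> (LINT x|M. G x \<bullet> (\<psi> x *\<^sub>R b))"
    by (rule integral_inner_tendsto[where C=C]) (use L \<phi> m CD b in auto)
  then have 2: "(\<lambda>n. - (LINT x|M. (grad (\<phi> n) x \<bullet> b) * \<psi> x)) \<longlonglongrightarrow> - (LINT x|M. (G x \<bullet> b) * \<psi> x)"
    by (intro tendsto_minus) (simp add: mult.commute)
  have "(LINT x|M. \<phi> n x * frechet_derivative \<psi> (at x) b) = - (LINT x|M. (grad (\<phi> n) x \<bullet> b) * \<psi> x)" for n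
  proof -
    have "(LINT x|M. \<phi> n x * frechet_derivative \<psi> (at x) b) = (LINT x|lborel. \<phi> n x * frechet_derivative \<psi> (at x) b)"
      using test_function_borel[OF \<phi>(1)] test_function_borel[OF \<psi>'] test_function_zero_outside[OF \<phi>(1)]
      by (intro integral_lebesgue_on_eq_lborel) auto
    also have "\<dots> = - (LINT x|lborel. (grad (\<phi> n) x \<bullet> b) * \<psi> x)"
      by (rule integral_by_parts_test[OF \<phi>(1) \<psi> b])
    also have "(LINT x|lborel. (grad (\<phi> n) x \<bullet> b) * \<psi> x) = (LINT x|M. (grad (\<phi> n) x \<bullet> b) * \<psi> x)"
      using grad_borel[OF \<phi>(1)] test_function_borel[OF \<psi>] test_function_zero_outside[OF \<psi>]
      by (intro integral_lebesgue_on_eq_lborel[symmetric]) auto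
    finally show ?thesis .
  qed
  with 1 have "(\<lambda>n. - (LINT x|M. (grad (\<phi> n) x \<bullet> b) * \<psi> x)) \<longlonglongrightarrow> (LINT x|M. u x * frechet_derivative \<psi> (at x) b)"
    by simp
  from LIMSEQ_unique[OF this 2]
  show "(LINT x|M. u x * frechet_derivative \<psi> (at x) b) = - (LINT x|M. (G x \<bullet> b) * \<psi> x)" .
qed

lemma weak_gradient_AE_eq:
  assumes "has_weak_gradient \<Omega> u G"
  shows "AE x in M. G x = weak_gradient \<Omega> u x"
proof -
  have "has_weak_gradient \<Omega> u (weak_gradient \<Omega> u)"
    unfolding weak_gradient_def using assms someI[of "has_weak_gradient \<Omega> u" G] by simp
  then show ?thesis by (rule has_weak_gradient_AE_unique[OF open_domain assms])
qed

lemma W1p_norm_eq: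
  assumes "G \<in> Lp p \<Omega>" "has_weak_gradient \<Omega> u G"
  shows "W1p_norm p \<Omega> u = (Lpow p \<Omega> u + Lpow p \<Omega> G) powr (1 / p)"
  using Lp_AE_cong(2)[OF assms(1) weak_gradient_AE_eq[OF assms(2)]]
  by (simp add: W1p_norm_def Lpow_def)

text \<open>The difference between a test function and \<open>u\<close> has a weak gradient that is unique almost
  everywhere, so the norm of the difference is computed with the gradients at hand.\<close>

lemma W1p_0_iff_sob0: "u \<in> W1p_0 p \<Omega> \<longleftrightarrow> (\<exists>G. sob0 u G)"
proof
  assume u: "u \<in> W1p_0 p \<Omega>"
  then obtain G \<phi> where uL: "u \<in> Lp p \<Omega>" and G: "G \<in> Lp p \<Omega>" "has_weak_gradient \<Omega> u G"
    and \<phi>: "\<And>n::nat. test_function \<Omega> (\<phi> n)" and lim: "(\<lambda>n. W1p_norm p \<Omega> (\<lambda>x. \<phi> n x - u x)) \<longlonglongrightarrow> 0"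
    unfolding W1p_0_def W1p_def by blast
  define a where "a n = Lpow p \<Omega> (\<lambda>x. \<phi> n x - u x)" for n
  define b where "b n = Lpow p \<Omega> (\<lambda>x. grad (\<phi> n) x - G x)" for n
  have ab: "0 \<le> a n" "0 \<le> b n" for n by (auto simp: a_def b_def Lpow_nonneg)
  have "has_weak_gradient \<Omega> (\<lambda>x. \<phi> n x - u x) (\<lambda>x. grad (\<phi> n) x - G x)" for n
    by (intro has_weak_gradient_diff sob0_has_weak_gradient sob0_test_function \<phi> G domain_sets)
  then have "W1p_norm p \<Omega> (\<lambda>x. \<phi> n x - u x) = (a n + b n) powr (1 / p)" for n
    unfolding a_def b_def by (intro W1p_norm_eq Lp_diff test_function_Lp \<phi> G)
  with lim have "(\<lambda>n. ((a n + b n) powr (1 / p)) powr p) \<longlonglongrightarrow> 0 powr p"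
    using p_gt_1 by (intro tendsto_powr2) auto
  then have "(\<lambda>n. a n + b n) \<longlonglongrightarrow> 0"
    using ab p_gt_1 by (simp add: powr_powr)
  then have "a \<longlonglongrightarrow> 0" "b \<longlonglongrightarrow> 0"
    using ab by (auto intro: tendsto_sandwich[OF _ _ tendsto_const, where h="\<lambda>n. a n + b n"])
  then show "\<exists>G. sob0 u G" unfolding sob0_def a_def b_def using uL G \<phi> by blast
next
  assume "\<exists>G. sob0 u G"
  then obtain G where G: "sob0 u G" ..
  obtain \<phi> where \<phi>: "\<And>n::nat. test_function \<Omega> (\<phi> n)"
     "(\<lambda>n. Lpow p \<Omega> (\<lambda>x. \<phi> n x - u x)) \<longlonglongrightarrow> 0"
     "(\<lambda>n. Lpow p \<Omega> (\<lambda>x. grad (\<phi> n) x - G x)) \<longlonglongrightarrow> 0" using G unfolding sob0_def by blast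
  have s: "sob0 (\<lambda>x. \<phi> n x - u x) (\<lambda>x. grad (\<phi> n) x - G x)" for n
    by (intro sob0_diff sob0_test_function \<phi> G)
  have "(\<lambda>n. (Lpow p \<Omega> (\<lambda>x. \<phi> n x - u x) + Lpow p \<Omega> (\<lambda>x. grad (\<phi> n) x - G x)) powr (1 / p)) \<longlonglongrightarrow> 0 powr (1 / p)"
    using p_gt_1 by (intro tendsto_powr2 tendsto_add_zero \<phi> tendsto_const) (auto intro!: always_eventually add_nonneg_nonneg Lpow_nonneg)
  then have "(\<lambda>n. W1p_norm p \<Omega> (\<lambda>x. \<phi> n x - u x)) \<longlonglongrightarrow> 0"
    using W1p_norm_eq[OF sob0_Lp(2)[OF s] sob0_has_weak_gradient[OF s]] by simp
  with \<phi>(1) G show "u \<in> W1p_0 p \<Omega>"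
    unfolding W1p_0_def W1p_def using sob0_Lp[OF G] sob0_has_weak_gradient[OF G] by blast
qed

text \<open>The chosen weak gradient can stand in for the gradient obtained from approximation, including its
  measurability.\<close>

lemma sob0_weak_gradient:
  assumes "sob0 u G"
  shows "sob0 u (weak_gradient \<Omega> u)" "AE x in M. G x = weak_gradient \<Omega> u x"
proof -
  show ae: "AE x in M. G x = weak_gradient \<Omega> u x"
    by (rule weak_gradient_AE_eq[OF sob0_has_weak_gradient[OF assms]])
  show "sob0 u (weak_gradient \<Omega> u)" by (rule sob0_AE_cong[OF assms _ ae]) simp
qed

end

section \<open>Uniform convexity and weak closedness\<close>

lemma powr_midpoint_strict:
  fixes x y p :: real
  assumes "1 < p" "0 \<le> x" "x < y"
  shows "((x + y) / 2) powr p < (x powr p + y powr p) / 2"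
proof -
  define m where "m = (x + y) / 2"
  have m: "x < m" "m < y" "0 < m" using assms by (auto simp: m_def)
  have mvt: "\<exists>z. a < z \<and> z < b \<and> b powr p - a powr p = (b - a) * (p * z powr (p - 1))"
    if ab: "0 \<le> a" "a < b" for a b :: real
  proof -
    have c: "continuous_on {a..b} (\<lambda>x. x powr p)"
      using ab assms(1) by (intro continuous_on_powr' continuous_intros) auto
    have d: "((\<lambda>x. x powr p) has_real_derivative p * z powr (p - 1)) (at z)" if "a < z" for z
      using ab that by (intro has_real_derivative_powr) auto
    obtain l z where z: "a < z" "z < b" "((\<lambda>x. x powr p) has_real_derivative l) (at z)"
      "b powr p - a powr p = (b - a) * l"
      using MVT[OF ab(2) c] d real_differentiable_def by blast
    with DERIV_unique[OF z(3) d[OF z(1)]] show ?thesis by blast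
  qed
  obtain z1 where z1: "x < z1" "z1 < m" "m powr p - x powr p = (m - x) * (p * z1 powr (p - 1))"
    using mvt[of x m] assms m by blast
  obtain z2 where z2: "m < z2" "z2 < y" "y powr p - m powr p = (y - m) * (p * z2 powr (p - 1))"
    using mvt[of m y] assms m by auto
  have "z1 powr (p - 1) < z2 powr (p - 1)"
    using z1 z2 assms by (intro powr_less_mono2) auto
  then have "(m - x) * (p * z1 powr (p - 1)) < (m - x) * (p * z2 powr (p - 1))"
    using m assms by simp
  moreover have "y - m = m - x" by (simp add: m_def field_simps)
  ultimately have "m powr p - x powr p < y powr p - m powr p" using z1 z2 by simp
  then show ?thesis by (simp add: m_def)
qed

definition convexity_defect :: "real \<Rightarrow> 'b::real_normed_vector \<Rightarrow> 'b \<Rightarrow> real" where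
  "convexity_defect p a b = (norm a powr p + norm b powr p) / 2 - norm ((1/2) *\<^sub>R (a + b)) powr p"

lemma convexity_defect_nonneg: "1 < p \<Longrightarrow> 0 \<le> convexity_defect p a b"
  using norm_powr_convex[of p "1/2" a b] by (simp add: convexity_defect_def scaleR_add_right)

text \<open>If \<open>|a| \<noteq> |b|\<close>, then strict convexity of \<open>t\<^sup>p\<close> gives the inequality; if \<open>|a| = |b|\<close>, then equality in the
  triangle inequality would force \<open>a = b\<close>.\<close>

lemma convexity_defect_pos:
  fixes a b :: "'b::real_inner"
  assumes "1 < p" "a \<noteq> b"
  shows "0 < convexity_defect p a b"
proof -
  have "norm ((1/2) *\<^sub>R (a + b)) \<le> (norm a + norm b) / 2"
    using norm_triangle_ineq[of a b] by simp
  then have le_p: "norm ((1/2) *\<^sub>R (a + b)) powr p \<le> ((norm a + norm b) / 2) powr p"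
    using assms by (intro powr_mono2) auto
  show ?thesis
  proof (cases "norm a = norm b")
    case False
    then have "((norm a + norm b) / 2) powr p < (norm a powr p + norm b powr p) / 2"
      using powr_midpoint_strict[OF assms(1), of "norm a" "norm b"]
        powr_midpoint_strict[OF assms(1), of "norm b" "norm a"]
      by (cases "norm a < norm b") (auto simp: add.commute)
    with le_p show ?thesis by (simp add: convexity_defect_def)
  next
    case True
    have "norm (a + b) \<noteq> norm a + norm b"
    proof
      assume "norm (a + b) = norm a + norm b"
      then have "norm a *\<^sub>R b = norm b *\<^sub>R a" by (simp add: norm_triangle_eq)
      with True assms(2) show False by (cases "norm b = 0") auto
    qed
    then have "norm ((1/2) *\<^sub>R (a + b)) < norm a"
      using norm_triangle_ineq[of a b] True by simp
    then have "norm ((1/2) *\<^sub>R (a + b)) powr p < norm a powr p"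
      using assms by (intro powr_less_mono2) auto
    with True show ?thesis by (simp add: convexity_defect_def)
  qed
qed

text \<open>Both sides are homogeneous of degree \<open>p\<close>, so it suffices to consider pairs with
  \<open>|a|\<^sup>p + |b|\<^sup>p = 1\<close>; among these, the ones with \<open>|a - b|\<^sup>p \<ge> \<epsilon>\<close> form a compact set on
  which the defect is positive, hence bounded away from zero.\<close>

lemma uniform_convexity:
  assumes "1 < p" "0 < e"
  obtains C where "0 \<le> C" "\<And>a b :: 'b::euclidean_space.
    norm (a - b) powr p \<le> e * (norm a powr p + norm b powr p) + C * convexity_defect p a b"
proof -
  define S where "S = {z :: 'b \<times> 'b. norm (fst z) powr p + norm (snd z) powr p = 1 \<and> e \<le> norm (fst z - snd z) powr p}"
  have cont: "continuous_on UNIV (\<lambda>z :: 'b \<times> 'b. norm (fst z) powr p + norm (snd z) powr p)"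
    "continuous_on UNIV (\<lambda>z :: 'b \<times> 'b. norm (fst z - snd z) powr p)"
    "continuous_on UNIV (\<lambda>z :: 'b \<times> 'b. convexity_defect p (fst z) (snd z))"
    unfolding convexity_defect_def
    using assms by (auto intro!: continuous_intros continuous_on_powr')
  have le1: "norm (fst z) \<le> 1 \<and> norm (snd z) \<le> 1" if "norm (fst z) powr p + norm (snd z) powr p = 1" for z :: "'b \<times> 'b"
  proof -
    have "x \<le> 1" if "x powr p \<le> 1" "0 \<le> x" for x :: real
    proof (rule ccontr)
      assume "\<not> x \<le> 1"
      then have "1 powr p < x powr p" using assms by (intro powr_less_mono2) auto
      with that show False by simp
    qed
    moreover have "norm (fst z) powr p \<le> 1" "norm (snd z) powr p \<le> 1"
      using that powr_ge_zero[of "norm (fst z)" p] powr_ge_zero[of "norm (snd z)" p] by linarith+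
    ultimately show ?thesis by simp
  qed
  have "closed S"
  proof -
    have "S = {z. norm (fst z) powr p + norm (snd z) powr p = 1} \<inter> {z. e \<le> norm (fst z - snd z) powr p}"
      by (auto simp: S_def)
    then show ?thesis
      using cont by (auto intro!: closed_Int closed_Collect_eq closed_Collect_le continuous_on_const)
  qed
  moreover have "bounded S"
  proof (rule boundedI)
    fix z assume "z \<in> S"
    then have "norm (fst z) \<le> 1" "norm (snd z) \<le> 1" using le1 by (auto simp: S_def)
    then show "norm z \<le> 2" using norm_Pair_le[of "fst z" "snd z"] by simp
  qed
  ultimately have "compact S" by (simp add: compact_eq_bounded_closed)
  have "\<exists>\<delta>>0. \<forall>z\<in>S. \<delta> \<le> convexity_defect p (fst z) (snd z)"
  proof (cases "S = {}")
    case False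
    then obtain z where z: "z \<in> S" "\<forall>y\<in>S. convexity_defect p (fst z) (snd z) \<le> convexity_defect p (fst y) (snd y)"
      using continuous_attains_inf[OF \<open>compact S\<close> False continuous_on_subset[OF cont(3)]] by auto
    have "fst z \<noteq> snd z" using z(1) assms(2) by (auto simp: S_def)
    with z convexity_defect_pos[OF assms(1)] show ?thesis by blast
  qed (auto intro: exI[of _ 1])
  then obtain \<delta> where \<delta>: "0 < \<delta>" "\<And>z. z \<in> S \<Longrightarrow> \<delta> \<le> convexity_defect p (fst z) (snd z)" by blast
  define C where "C = 2 powr p / \<delta>"
  have C: "0 \<le> C" using \<delta> by (simp add: C_def)
  have normalised: "norm (a - b) powr p \<le> e + C * convexity_defect p a b"
    if "norm a powr p + norm b powr p = 1" for a b :: 'b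
  proof (cases "(a, b) \<in> S")
    case True
    have "norm (a - b) \<le> 2" using le1[of "(a, b)"] that norm_triangle_ineq4[of a b] by simp
    then have "norm (a - b) powr p \<le> 2 powr p" using assms by (intro powr_mono2) auto
    also have "\<dots> = C * \<delta>" using \<delta> by (simp add: C_def)
    also have "\<dots> \<le> C * convexity_defect p a b" using \<delta>(2)[OF True] C by (intro mult_left_mono) auto
    finally show ?thesis using assms(2) by simp
  next
    case False
    with that have "norm (a - b) powr p < e" by (auto simp: S_def)
    with mult_nonneg_nonneg[OF C convexity_defect_nonneg[OF assms(1), of a b]] show ?thesis by linarith
  qed
  have "norm (a - b) powr p \<le> e * (norm a powr p + norm b powr p) + C * convexity_defect p a b" for a b :: 'b
  proof (cases "norm a powr p + norm b powr p = 0")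
    case True
    then have "a = 0" "b = 0"
      using add_nonneg_eq_0_iff[of "norm a powr p" "norm b powr p"] by auto
    then show ?thesis by (simp add: convexity_defect_def)
  next
    case False
    define s where "s = norm a powr p + norm b powr p"
    have s: "0 < s" using False by (simp add: s_def add_nonneg_pos less_le)
    define r where "r = s powr (- 1 / p)"
    have "r powr p = s powr (- 1 / p * p)" by (simp only: r_def powr_powr)
    then have r: "0 < r" "r powr p = 1 / s"
      using s assms by (simp_all add: r_def powr_minus_divide)
    have hom: "norm (r *\<^sub>R c) powr p = norm c powr p / s" for c :: 'b
      using r by (simp add: powr_mult)
    have hd: "convexity_defect p (r *\<^sub>R a) (r *\<^sub>R b) = convexity_defect p a b / s"
    proof -
      have "(1/2) *\<^sub>R (r *\<^sub>R a + r *\<^sub>R b) = r *\<^sub>R ((1/2) *\<^sub>R (a + b))" by (simp add: scaleR_add_right mult.commute)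
      then show ?thesis unfolding convexity_defect_def by (simp only: hom diff_divide_distrib add_divide_distrib) simp
    qed
    have "norm (r *\<^sub>R a) powr p + norm (r *\<^sub>R b) powr p = 1"
      unfolding hom using s by (simp add: s_def add_divide_distrib[symmetric])
    from normalised[OF this] have "norm (r *\<^sub>R (a - b)) powr p \<le> e + C * (convexity_defect p a b / s)"
      by (simp add: hd scaleR_diff_right)
    then have "norm (a - b) powr p / s \<le> e + C * (convexity_defect p a b / s)" by (simp only: hom)
    then show ?thesis using s unfolding s_def[symmetric] by (simp add: field_simps)
  qed
  with C that show ?thesis by blast
qed

text \<open>Pairs of a function and its gradient are combined simultaneously. The uniform convexity argument
  compares only midpoints, so the hull under midpoints serves as the convex hull.\<close>

inductive midpoint_hull :: "(('a \<Rightarrow> real) \<times> ('a \<Rightarrow> 'b::real_vector)) set \<Rightarrow> ('a \<Rightarrow> real) \<Rightarrow> ('a \<Rightarrow> 'b) \<Rightarrow> bool"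
  for S where
  base: "(u, G) \<in> S \<Longrightarrow> midpoint_hull S u G"
| mid: "midpoint_hull S u G \<Longrightarrow> midpoint_hull S v H \<Longrightarrow>
    midpoint_hull S (\<lambda>x. (1/2) *\<^sub>R (u x + v x)) (\<lambda>x. (1/2) *\<^sub>R (G x + H x))"

lemma midpoint_hull_mono: "midpoint_hull S u G \<Longrightarrow> S \<subseteq> T \<Longrightarrow> midpoint_hull T u G"
proof (induction rule: midpoint_hull.induct)
  case (mid u G v H)
  then show ?case by (intro midpoint_hull.mid)
qed (auto intro: midpoint_hull.base)

context lp_domain
begin

lemma Lpow_lsc:
  fixes v :: "nat \<Rightarrow> 'a \<Rightarrow> 'b::euclidean_space"
  assumes v: "\<And>n. v n \<in> Lp p \<Omega>" and w: "w \<in> Lp p \<Omega>" and lim: "(\<lambda>n. Lpow p \<Omega> (\<lambda>x. v n x - w x)) \<longlonglongrightarrow> 0"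
    and C: "\<And>e. 0 < e \<Longrightarrow> \<forall>\<^sub>F n in sequentially. Lpow p \<Omega> (v n) \<le> C + e"
  shows "Lpow p \<Omega> w \<le> C"
proof (rule field_le_epsilon)
  fix e :: real assume "0 < e"
  obtain r where r: "strict_mono r" "AE x in M. (\<lambda>n. v (r n) x) \<longlonglongrightarrow> w x"
    using AE_subseq_of_Lpow_tendsto[OF v w lim] by blast
  have "\<forall>\<^sub>F n in sequentially. Lpow p \<Omega> (v (r n)) \<le> C + e"
    using eventually_subseq[OF r(1) C[OF \<open>0 < e\<close>]] .
  then show "Lpow p \<Omega> w \<le> C + e"
    by (rule Lp_Fatou(2)[OF v Lp_measurable[OF w] r(2)])
qed

text \<open>Apply \<open>norm_add_powr_le\<close> with a fixed small \<open>t\<close> and then let \<open>n\<close> tend to infinity.\<close>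

lemma Lpow_upper_limit:
  fixes v :: "nat \<Rightarrow> 'a \<Rightarrow> 'b::euclidean_space"
  assumes v: "\<And>n. v n \<in> Lp p \<Omega>" and w: "w \<in> Lp p \<Omega>" and lim: "(\<lambda>n. Lpow p \<Omega> (\<lambda>x. v n x - w x)) \<longlonglongrightarrow> 0"
    and "0 < e"
  shows "\<forall>\<^sub>F n in sequentially. Lpow p \<Omega> (v n) \<le> Lpow p \<Omega> w + e"
proof -
  have "((\<lambda>t. (1 - t) powr (1 - p) * Lpow p \<Omega> w) \<longlongrightarrow> (1 - 0) powr (1 - p) * Lpow p \<Omega> w) (at_right (0::real))"
    by (intro tendsto_intros) auto
  then have "\<forall>\<^sub>F t in at_right (0::real). (1 - t) powr (1 - p) * Lpow p \<Omega> w < Lpow p \<Omega> w + e / 2"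
    by (rule order_tendstoD) (use \<open>0 < e\<close> in auto)
  moreover have "\<forall>\<^sub>F t in at_right (0::real). t < 1" "\<forall>\<^sub>F t in at_right (0::real). 0 < t"
    by (auto simp: eventually_at_right_field intro: exI[of _ 1] eventually_at_right_less)
  ultimately have "\<forall>\<^sub>F t in at_right (0::real). (1 - t) powr (1 - p) * Lpow p \<Omega> w < Lpow p \<Omega> w + e / 2 \<and> t < 1 \<and> 0 < t"
    by eventually_elim auto
  then obtain t where t: "(1 - t) powr (1 - p) * Lpow p \<Omega> w < Lpow p \<Omega> w + e / 2" "t < 1" "0 < t"
    using eventually_happens'[OF trivial_limit_at_right_real] by blast
  have "(\<lambda>n. t powr (1 - p) * Lpow p \<Omega> (\<lambda>x. v n x - w x)) \<longlonglongrightarrow> 0"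
    by (rule tendsto_mult_right_zero[OF lim])
  then have "\<forall>\<^sub>F n in sequentially. t powr (1 - p) * Lpow p \<Omega> (\<lambda>x. v n x - w x) < e / 2"
    by (rule order_tendstoD) (use \<open>0 < e\<close> in auto)
  then show ?thesis
  proof eventually_elim
    case (elim n)
    have "Lpow p \<Omega> (\<lambda>x. w x + (v n x - w x)) \<le> (1 - t) powr (1 - p) * Lpow p \<Omega> w + t powr (1 - p) * Lpow p \<Omega> (\<lambda>x. v n x - w x)"
      by (rule Lp_add_bound(2)[OF w Lp_diff[OF v w] t(3,2)])
    with elim t show ?case by simp
  qed
qed

lemma Lp_midpoint:
  assumes "v \<in> Lp p \<Omega>" "w \<in> Lp p \<Omega>"
  shows "(\<lambda>x. (1/2) *\<^sub>R (v x + w x)) \<in> Lp p \<Omega>"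
    "(LINT x|M. convexity_defect p (v x) (w x)) = (Lpow p \<Omega> v + Lpow p \<Omega> w) / 2 - Lpow p \<Omega> (\<lambda>x. (1/2) *\<^sub>R (v x + w x))"
    "integrable M (\<lambda>x. convexity_defect p (v x) (w x))"
    "Lpow p \<Omega> (\<lambda>x. (1/2) *\<^sub>R (v x + w x)) \<le> (Lpow p \<Omega> v + Lpow p \<Omega> w) / 2"
proof -
  show m: "(\<lambda>x. (1/2) *\<^sub>R (v x + w x)) \<in> Lp p \<Omega>" by (rule Lp_scaleR(1)[OF Lp_add[OF assms]])
  note i = Lp_integrable[OF assms(1)] Lp_integrable[OF assms(2)] Lp_integrable[OF m]
  show e: "(LINT x|M. convexity_defect p (v x) (w x)) = (Lpow p \<Omega> v + Lpow p \<Omega> w) / 2 - Lpow p \<Omega> (\<lambda>x. (1/2) *\<^sub>R (v x + w x))"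
    unfolding convexity_defect_def Lpow_def using i by simp
  show "integrable M (\<lambda>x. convexity_defect p (v x) (w x))"
    unfolding convexity_defect_def using i
    by (intro Bochner_Integration.integrable_diff integrable_divide Bochner_Integration.integrable_add) auto
  have "0 \<le> (LINT x|M. convexity_defect p (v x) (w x))"
    using p_gt_1 by (intro integral_nonneg_AE AE_I2 convexity_defect_nonneg)
  with e show "Lpow p \<Omega> (\<lambda>x. (1/2) *\<^sub>R (v x + w x)) \<le> (Lpow p \<Omega> v + Lpow p \<Omega> w) / 2" by simp
qed

lemma midpoint_hull_sob0:
  assumes "midpoint_hull S u G" "\<And>u G. (u, G) \<in> S \<Longrightarrow> sob0 u G"
  shows "sob0 u G"
  using assms(1)
proof induction
  case (mid u G v H)
  from sob0_scale[OF sob0_add[OF mid.IH], of "1/2"] show ?case by simp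
qed (use assms(2) in auto)

lemma midpoint_hull_Lpow_le:
  assumes "midpoint_hull S u G" "\<And>u G. (u, G) \<in> S \<Longrightarrow> u \<in> Lp p \<Omega>" "v \<in> Lp p \<Omega>"
    "\<And>u G. (u, G) \<in> S \<Longrightarrow> Lpow p \<Omega> (\<lambda>x. u x - v x) \<le> d"
  shows "u \<in> Lp p \<Omega> \<and> Lpow p \<Omega> (\<lambda>x. u x - v x) \<le> d"
  using assms(1)
proof induction
  case (mid u G w H)
  then have uw: "u \<in> Lp p \<Omega>" "w \<in> Lp p \<Omega>" by auto
  have "(\<lambda>x. (1/2) *\<^sub>R (u x + w x) - v x) = (\<lambda>x. (1/2) *\<^sub>R ((u x - v x) + (w x - v x)))"
    by (auto simp: fun_eq_iff)
  with Lp_midpoint(4)[OF Lp_diff[OF uw(1) assms(3)] Lp_diff[OF uw(2) assms(3)]] mid.IH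
  show ?case using Lp_midpoint(1)[OF uw] by simp
qed (use assms in auto)

text \<open>Near-minimisers of the gradient energy in the midpoint hulls of the tails have gradients that form
  a Cauchy sequence by uniform convexity, because midpoints stay in the hull; the functions
  themselves still converge to \<open>v\<close>. The infima over the hulls are bounded by \<open>C\<close>.\<close>

lemma sob0_weak_closure:
  assumes uG: "\<And>k::nat. sob0 (u k) (G k)" and v: "v \<in> Lp p \<Omega>"
    and lim: "(\<lambda>k. Lpow p \<Omega> (\<lambda>x. u k x - v x)) \<longlonglongrightarrow> 0"
    and C: "\<And>e. 0 < e \<Longrightarrow> \<forall>\<^sub>F k in sequentially. Lpow p \<Omega> (G k) \<le> C + e"
  shows "\<exists>H. sob0 v H \<and> Lpow p \<Omega> H \<le> C"
proof -
  define T where "T n = {(u k, G k) | k. n \<le> k}" for n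
  have T_anti: "T m \<subseteq> T n" if "n \<le> m" for m n using that by (auto simp: T_def)
  have T_sob: "sob0 w H" if "midpoint_hull (T n) w H" for n w H
    using midpoint_hull_sob0[OF that] uG by (auto simp: T_def)
  define E where "E n = {Lpow p \<Omega> H | w H. midpoint_hull (T n) w H}" for n
  have E_bdd: "bdd_below (E n)" for n
    by (rule bdd_belowI[of _ 0]) (auto simp: E_def Lpow_nonneg)
  have E_ne: "E n \<noteq> {}" for n
    unfolding E_def T_def by (auto intro!: exI midpoint_hull.base)
  \<comment> \<open>The least energy in the hull of the \<open>n\<close>-th tail, increasing in \<open>n\<close>.\<close>
  define m where "m n = Inf (E n)" for n
  have m_le: "m n \<le> Lpow p \<Omega> H" if "midpoint_hull (T n) w H" for n w H
    unfolding m_def using that by (intro cInf_lower E_bdd) (auto simp: E_def)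
  have m_C: "m n \<le> C" for n
  proof (rule field_le_epsilon)
    fix e :: real assume "0 < e"
    from eventually_conj[OF C[OF this] eventually_ge_at_top[of n]]
    obtain k where "Lpow p \<Omega> (G k) \<le> C + e" "n \<le> k" by (auto simp: eventually_sequentially)
    with m_le[OF midpoint_hull.base, of "u k" "G k" n] show "m n \<le> C + e" by (force simp: T_def)
  qed
  have "incseq m"
  proof (rule incseq_SucI)
    fix n
    have "E (Suc n) \<subseteq> E n"
      unfolding E_def using midpoint_hull_mono[OF _ T_anti[of n "Suc n"]] by fastforce
    then show "m n \<le> m (Suc n)" unfolding m_def by (intro cInf_superset_mono E_ne E_bdd)
  qed
  then obtain L where L: "m \<longlonglongrightarrow> L" "\<And>n. m n \<le> L"
    using incseq_convergent[of m C] m_C by blast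

  define \<eta> where "\<eta> n = inverse (real (Suc n))" for n
  have \<eta>: "0 < \<eta> n" "\<eta> n \<le> 1" "k \<ge> n \<Longrightarrow> \<eta> k \<le> \<eta> n" for n k
    by (auto simp: \<eta>_def divide_simps)
  have \<eta>0: "\<eta> \<longlonglongrightarrow> 0" unfolding \<eta>_def by (rule LIMSEQ_inverse_real_of_nat)
  have "\<exists>w H. midpoint_hull (T n) w H \<and> Lpow p \<Omega> H < m n + \<eta> n" for n
    using cInf_lessD[OF E_ne[of n], of "m n + \<eta> n"] \<eta>(1)[of n] unfolding m_def[symmetric]
    by (auto simp: E_def)
  then obtain w H where wH: "\<And>n. midpoint_hull (T n) (w n) (H n)" "\<And>n. Lpow p \<Omega> (H n) < m n + \<eta> n" by metis
  note s = T_sob[OF wH(1)]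
  have defect: "(LINT x|M. convexity_defect p (H j x) (H k x)) \<le> L - m n + \<eta> n" if "n \<le> j" "n \<le> k" for j k n
  proof -
    have "midpoint_hull (T n) (\<lambda>x. (1/2) *\<^sub>R (w j x + w k x)) (\<lambda>x. (1/2) *\<^sub>R (H j x + H k x))"
      using that by (intro midpoint_hull.mid midpoint_hull_mono[OF wH(1)] T_anti)
    from m_le[OF this] have "m n \<le> Lpow p \<Omega> (\<lambda>x. (1/2) *\<^sub>R (H j x + H k x))" .
    moreover have "Lpow p \<Omega> (H j) \<le> L + \<eta> n" "Lpow p \<Omega> (H k) \<le> L + \<eta> n"
      using wH(2)[of j] wH(2)[of k] L(2)[of j] L(2)[of k] \<eta>(3)[OF that(1)] \<eta>(3)[OF that(2)]
      by linarith+
    ultimately show ?thesis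
      unfolding Lp_midpoint(2)[OF sob0_Lp(2)[OF s] sob0_Lp(2)[OF s], of j k] by argo
  qed
  have "\<exists>H'. H' \<in> Lp p \<Omega> \<and> (\<lambda>n. Lpow p \<Omega> (\<lambda>x. H n x - H' x)) \<longlonglongrightarrow> 0"
  proof (rule Lp_complete[OF sob0_Lp(2)[OF s]])
    fix e :: real assume e: "0 < e"
    have C0: "0 \<le> C" using m_C[of 0] cInf_greatest[OF E_ne, of 0 0] unfolding m_def E_def
      by (force simp: Lpow_nonneg)
    \<comment> \<open>Each \<open>H n\<close> has energy at most \<open>C + 1\<close>, so the first term of the convexity bound is at most \<open>e / 2\<close>.\<close>
    define d where "d = e / (4 * (C + 1))"
    have d: "0 < d" "d * (2 * (C + 1)) = e / 2" using e C0 by (auto simp: d_def field_simps)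
    obtain K where K: "0 \<le> K" "\<And>a b :: 'a. norm (a - b) powr p \<le> d * (norm a powr p + norm b powr p) + K * convexity_defect p a b"
      using uniform_convexity[OF p_gt_1 d(1)] by blast
    have "(\<lambda>n. K * (L - m n + \<eta> n)) \<longlonglongrightarrow> K * (L - L + 0)"
      by (intro tendsto_intros L \<eta>0)
    then have "\<forall>\<^sub>F n in sequentially. K * (L - m n + \<eta> n) < e / 2"
      by (rule order_tendstoD) (use e in auto)
    then obtain n where n: "K * (L - m n + \<eta> n) < e / 2" by (auto simp: eventually_sequentially)
    have "Lpow p \<Omega> (\<lambda>x. H j x - H k x) < e" if "n \<le> j" "n \<le> k" for j k
    proof -
      note i = Lp_integrable[OF sob0_Lp(2)[OF s[of j]]] Lp_integrable[OF sob0_Lp(2)[OF s[of k]]]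
        Lp_midpoint(3)[OF sob0_Lp(2)[OF s] sob0_Lp(2)[OF s], of j k]
      have "Lpow p \<Omega> (\<lambda>x. H j x - H k x)
          \<le> (LINT x|M. d * (norm (H j x) powr p + norm (H k x) powr p) + K * convexity_defect p (H j x) (H k x))"
        using i by (intro Lp_dominated(2) Lp_measurable[OF Lp_diff[OF sob0_Lp(2)[OF s] sob0_Lp(2)[OF s]]] AE_I2 K(2)) auto
      also have "\<dots> = d * (Lpow p \<Omega> (H j) + Lpow p \<Omega> (H k)) + K * (LINT x|M. convexity_defect p (H j x) (H k x))"
        unfolding Lpow_def using i by simp
      also have "\<dots> \<le> d * (2 * (C + 1)) + K * (L - m n + \<eta> n)"
      proof (intro add_mono mult_left_mono K(1) defect that less_imp_le[OF d(1)])
        show "Lpow p \<Omega> (H j) + Lpow p \<Omega> (H k) \<le> 2 * (C + 1)"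
          using wH(2)[of j] wH(2)[of k] m_C[of j] m_C[of k] \<eta>(2)[of j] \<eta>(2)[of k] by argo
      qed
      also have "\<dots> < e" using n d by linarith
      finally show ?thesis .
    qed
    then show "\<exists>n0. \<forall>m\<ge>n0. \<forall>n\<ge>n0. Lpow p \<Omega> (\<lambda>x. H m x - H n x) < e" by blast
  qed blast
  then obtain H' where H': "H' \<in> Lp p \<Omega>" "(\<lambda>n. Lpow p \<Omega> (\<lambda>x. H n x - H' x)) \<longlonglongrightarrow> 0" by blast
  have wlim: "(\<lambda>n. Lpow p \<Omega> (\<lambda>x. w n x - v x)) \<longlonglongrightarrow> 0"
  proof (rule LIMSEQ_I)
    fix e :: real assume e: "0 < e"
    have "\<forall>\<^sub>F k in sequentially. Lpow p \<Omega> (\<lambda>x. u k x - v x) < e / 2"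
      using order_tendstoD(2)[OF lim, of "e/2"] e by simp
    then obtain n0 where n0: "\<And>k. n0 \<le> k \<Longrightarrow> Lpow p \<Omega> (\<lambda>x. u k x - v x) < e / 2"
      by (auto simp: eventually_sequentially)
    have "norm (Lpow p \<Omega> (\<lambda>x. w n x - v x) - 0) < e" if "n0 \<le> n" for n
    proof -
      have "Lpow p \<Omega> (\<lambda>x. w n x - v x) \<le> e / 2"
        using midpoint_hull_Lpow_le[OF wH(1)[of n] _ v, of "e/2"] sob0_Lp(1)[OF uG] n0 that
        by (force simp: T_def intro: less_imp_le)
      with e Lpow_nonneg[of p \<Omega> "\<lambda>x. w n x - v x"] show ?thesis by simp
    qed
    then show "\<exists>n0. \<forall>n\<ge>n0. norm (Lpow p \<Omega> (\<lambda>x. w n x - v x) - 0) < e" by blast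
  qed
  have "sob0 v H'" by (rule sob0_closed[OF s v H'(1) wlim H'(2)])
  moreover have "Lpow p \<Omega> H' \<le> C"
  proof (rule Lpow_lsc[OF sob0_Lp(2)[OF s] H'])
    fix e :: real assume "0 < e"
    from order_tendstoD(2)[OF \<eta>0 this] show "\<forall>\<^sub>F n in sequentially. Lpow p \<Omega> (H n) \<le> C + e"
    proof eventually_elim
      case (elim n)
      with wH(2)[of n] m_C[of n] show ?case by linarith
    qed
  qed
  ultimately show ?thesis by blast
qed

end

section \<open>Truncation\<close>

text \<open>The functions \<open>P(s) (s\<^sup>2 + c)\<^sup>q\<close>, with \<open>P\<close> a polynomial and \<open>q\<close> real, form a family closed under
  differentiation.\<close>

lemma smooth_sqrt_add_const:
  assumes "0 < c"
  shows "smooth (\<lambda>s::real. sqrt (s\<^sup>2 + c))"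
proof (rule smooth_of_derivative_closed[where X = "{\<lambda>s. poly P s * (s\<^sup>2 + c) powr q | P q. True}"])
  have "sqrt (s\<^sup>2 + c) = poly 1 s * (s\<^sup>2 + c) powr (1/2)" for s
    using assms by (simp add: powr_half_sqrt add_nonneg_nonneg)
  then show "(\<lambda>s. sqrt (s\<^sup>2 + c)) \<in> {\<lambda>s. poly P s * (s\<^sup>2 + c) powr q | P q. True}" by blast
next
  fix g assume "g \<in> {\<lambda>s. poly P s * (s\<^sup>2 + c) powr q | P q. True}"
  then obtain P q where g: "g = (\<lambda>s. poly P s * (s\<^sup>2 + c) powr q)" by blast
  define Q where "Q = pderiv P * [:c, 0, 1:] + smult (2 * q) (P * [:0, 1:])"
  have "(g has_real_derivative poly Q s * (s\<^sup>2 + c) powr (q - 1)) (at s)" for s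
  proof -
    have pos: "0 < s\<^sup>2 + c" using assms by (simp add: add_nonneg_pos)
    have "((\<lambda>s. s\<^sup>2 + c) has_real_derivative 2 * s) (at s)"
      by (auto intro!: derivative_eq_intros)
    from DERIV_fun_powr[OF this pos, of q]
    have "((\<lambda>s. (s\<^sup>2 + c) powr q) has_real_derivative q * (s\<^sup>2 + c) powr (q - 1) * (2 * s)) (at s)"
      by simp
    from DERIV_mult[OF poly_DERIV[of P s] this]
    have d: "(g has_real_derivative poly (pderiv P) s * (s\<^sup>2 + c) powr q + q * (s\<^sup>2 + c) powr (q - 1) * (2 * s) * poly P s) (at s)"
      by (simp add: g)
    have "(s\<^sup>2 + c) powr q = (s\<^sup>2 + c) powr (q - 1) * (s\<^sup>2 + c)"
      using pos powr_add[of "s\<^sup>2 + c" "q - 1" 1] by simp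
    with d show ?thesis by (simp add: Q_def algebra_simps power2_eq_square)
  qed
  then show "\<exists>g'\<in>{\<lambda>s. poly P s * (s\<^sup>2 + c) powr q | P q. True}. \<forall>s. (g has_real_derivative g' s) (at s)"
    by (intro bexI[of _ "\<lambda>s. poly Q s * (s\<^sup>2 + c) powr (q - 1)"]) auto
qed

text \<open>A smooth approximation of \<open>max(s, 0)\<close>; the shift by \<open>e\<close> makes it vanish at 0, so that composition
  preserves compact supports.\<close>

definition smooth_pos_part :: "real \<Rightarrow> real \<Rightarrow> real" where
  "smooth_pos_part e s = (s + sqrt (s\<^sup>2 + e\<^sup>2) - e) / 2"

lemma smooth_smooth_pos_part: "0 < e \<Longrightarrow> smooth (smooth_pos_part e)"
proof -
  assume e: "0 < e"
  have "smooth (\<lambda>s::real. s)" using Ck_inner[of _ "1::real"] by simp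
  moreover have "smooth (\<lambda>s. sqrt (s\<^sup>2 + e\<^sup>2))" using smooth_sqrt_add_const[of "e\<^sup>2"] e by simp
  ultimately have "smooth (\<lambda>s. (1/2) * ((s + sqrt (s\<^sup>2 + e\<^sup>2)) - e))"
    by (intro allI Ck_mult Ck_diff Ck_add Ck_const) auto
  then show ?thesis by (simp add: smooth_pos_part_def[abs_def])
qed

lemma smooth_pos_part_deriv:
  assumes "0 < e"
  shows "\<exists>d. (smooth_pos_part e has_real_derivative d) (at s) \<and> \<bar>d\<bar> \<le> 1"
proof -
  have pos: "0 < s\<^sup>2 + e\<^sup>2" using assms by (simp add: add_nonneg_pos)
  have "((\<lambda>s. s\<^sup>2 + e\<^sup>2) has_real_derivative 2 * s) (at s)"
    by (auto intro!: derivative_eq_intros)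
  from DERIV_chain2[where f=sqrt and g="\<lambda>s. s\<^sup>2 + e\<^sup>2", OF DERIV_real_sqrt[OF pos] this]
  have "((\<lambda>s. sqrt (s\<^sup>2 + e\<^sup>2)) has_real_derivative s / sqrt (s\<^sup>2 + e\<^sup>2)) (at s)"
    by (simp add: field_simps)
  from DERIV_cdivide[OF DERIV_diff[OF DERIV_add[OF DERIV_ident this] DERIV_const], of e 2]
  have "(smooth_pos_part e has_real_derivative (1 + s / sqrt (s\<^sup>2 + e\<^sup>2)) / 2) (at s)"
    unfolding smooth_pos_part_def[abs_def] by simp
  moreover have "\<bar>s / sqrt (s\<^sup>2 + e\<^sup>2)\<bar> \<le> 1"
  proof -
    have "\<bar>s\<bar> \<le> sqrt (s\<^sup>2 + e\<^sup>2)" by (rule real_le_rsqrt) simp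
    then show ?thesis using pos by (simp add: divide_simps)
  qed
  then have "\<bar>(1 + s / sqrt (s\<^sup>2 + e\<^sup>2)) / 2\<bar> \<le> 1" unfolding abs_le_iff by argo
  ultimately show ?thesis by blast
qed

lemma smooth_pos_part_approx: "0 < e \<Longrightarrow> \<bar>smooth_pos_part e s - max 0 s\<bar> \<le> e / 2"
proof -
  assume e: "0 < e"
  have "\<bar>s\<bar> \<le> sqrt (s\<^sup>2 + e\<^sup>2)" by (rule real_le_rsqrt) simp
  moreover have "sqrt (s\<^sup>2 + e\<^sup>2) \<le> \<bar>s\<bar> + e" using e by (intro real_le_lsqrt) (auto simp: power2_sum)
  moreover have "smooth_pos_part e s * 2 = s + sqrt (s\<^sup>2 + e\<^sup>2) - e" by (simp add: smooth_pos_part_def)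
  moreover have "max 0 s = (s + \<bar>s\<bar>) / 2" by simp
  ultimately show ?thesis unfolding abs_le_iff[of "_ - _"] by linarith
qed

lemma smooth_pos_part_0: "0 < e \<Longrightarrow> smooth_pos_part e 0 = 0"
  by (simp add: smooth_pos_part_def)

lemma Lipschitz_of_deriv_bounded:
  fixes \<Phi> :: "real \<Rightarrow> real"
  assumes "\<And>s. (\<Phi> has_real_derivative g s) (at s)" "\<And>s. \<bar>g s\<bar> \<le> K"
  shows "\<bar>\<Phi> s - \<Phi> t\<bar> \<le> K * \<bar>s - t\<bar>"
proof -
  have *: "\<bar>\<Phi> b - \<Phi> a\<bar> \<le> K * (b - a)" if ab: "a < b" for a b
  proof -
    obtain z where "\<Phi> b - \<Phi> a = (b - a) * g z" using MVT2[OF ab assms(1)] by blast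
    then show ?thesis using assms(2)[of z] ab by (simp add: abs_mult mult.commute)
  qed
  consider "s < t" | "s = t" | "t < s" by linarith
  then show ?thesis by cases (use *[of s t] *[of t s] in \<open>auto simp: abs_minus_commute\<close>)
qed

lemma contraction_of_deriv_bound:
  fixes g :: "real \<Rightarrow> real"
  assumes "\<And>s. \<exists>d. (g has_real_derivative d) (at s) \<and> \<bar>d\<bar> \<le> 1"
  shows "\<bar>g s - g t\<bar> \<le> \<bar>s - t\<bar>"
proof -
  obtain d where "\<And>s. (g has_real_derivative d s) (at s)" "\<And>s. \<bar>d s\<bar> \<le> 1" using assms by metis
  from Lipschitz_of_deriv_bounded[of g d 1, OF this] show ?thesis by simp
qed

lemma grad_compose:
  fixes g :: "real \<Rightarrow> real"
  assumes "test_function \<Omega> \<phi>" "(g has_real_derivative d) (at (\<phi> x))"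
  shows "grad (\<lambda>x. g (\<phi> x)) x = d *\<^sub>R grad \<phi> x"
proof -
  have "((\<lambda>x. g (\<phi> x)) has_derivative (\<lambda>h. d * frechet_derivative \<phi> (at x) h)) (at x)"
    using has_derivative_compose[OF test_function_has_derivative[OF assms(1)] assms(2)[unfolded has_field_derivative_def]] .
  from frechet_derivative_at[OF this, symmetric]
  show ?thesis by (simp add: grad_def scaleR_sum_right)
qed

context lp_domain
begin

text \<open>The smooth contractions of test functions approximating \<open>u\<close> are again test functions; they converge
  to \<open>T \<circ> u\<close>, and by the chain rule their gradients are dominated by those of the original test
  functions. So the weak closure lemma applies.\<close>

lemma sob0_contraction:
  fixes T :: "real \<Rightarrow> real" and S :: "nat \<Rightarrow> real \<Rightarrow> real"
  assumes "sob0 u G"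
    and S: "\<And>n. smooth (S n)" "\<And>n. S n 0 = 0"
      "\<And>n s. \<exists>d. (S n has_real_derivative d) (at s) \<and> \<bar>d\<bar> \<le> 1"
    and ST: "\<And>n s. \<bar>S n s - T s\<bar> \<le> inverse (real (Suc n))"
    and T: "T \<in> borel_measurable borel"
  shows "\<exists>H. sob0 (\<lambda>x. T (u x)) H \<and> Lpow p \<Omega> H \<le> Lpow p \<Omega> G"
proof -
  obtain \<phi> where \<phi>: "\<And>n::nat. test_function \<Omega> (\<phi> n)"
     "(\<lambda>n. Lpow p \<Omega> (\<lambda>x. \<phi> n x - u x)) \<longlonglongrightarrow> 0"
     "(\<lambda>n. Lpow p \<Omega> (\<lambda>x. grad (\<phi> n) x - G x)) \<longlonglongrightarrow> 0" using assms(1) unfolding sob0_def by blast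
  note L = sob0_Lp[OF assms(1)] test_function_Lp[OF \<phi>(1)]
  note [measurable] = T Lp_measurable[OF L(1)]
  define \<psi> where "\<psi> n x = S n (\<phi> n x)" for n x
  have \<psi>: "test_function \<Omega> (\<psi> n)" for n
    unfolding \<psi>_def by (rule test_function_compose[OF \<phi>(1) S(1,2)])
  define \<eta> where "\<eta> n = inverse (real (Suc n))" for n
  have \<eta>0: "\<eta> \<longlonglongrightarrow> 0" unfolding \<eta>_def by (rule LIMSEQ_inverse_real_of_nat)
  have S0: "\<bar>S n s\<bar> \<le> \<bar>s\<bar>" for n s using contraction_of_deriv_bound[OF S(3), of n s 0] S(2) by simp
  have Tb: "\<bar>T s\<bar> \<le> \<bar>s\<bar> + 1" for s
  proof -
    have "\<bar>T s\<bar> \<le> \<bar>S 0 s\<bar> + 1" using ST[of 0 s] by simp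
    with S0[of 0 s] show ?thesis by linarith
  qed
  have TuL: "(\<lambda>x. T (u x)) \<in> Lp p \<Omega>"
  proof (rule Lp_dominated(1))
    have one: "(\<lambda>x. 1::real) \<in> Lp p \<Omega>" by (rule Lp_bounded[where C=1]) auto
    have "(\<lambda>x. \<bar>u x\<bar>) \<in> Lp p \<Omega>" using L(1) by (auto simp: Lp_def)
    from Lp_integrable[OF Lp_add[OF this one]]
    show "integrable M (\<lambda>x. (\<bar>u x\<bar> + 1) powr p)" by simp
    show "AE x in M. norm (T (u x)) powr p \<le> (\<bar>u x\<bar> + 1) powr p"
      using Tb p_gt_1 by (intro AE_I2 powr_mono2) auto
  qed measurable
  have "(\<lambda>n. Lpow p \<Omega> (\<lambda>x. \<psi> n x - T (u x))) \<longlonglongrightarrow> 0"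
  proof (rule Lpow_tendsto_0I)
    fix n
    let ?c = "(1/2::real) powr (1 - p)"
    have d: "(\<lambda>x. \<phi> n x - u x) \<in> Lp p \<Omega>" by (intro Lp_diff L)
    have "Lpow p \<Omega> (\<lambda>x. \<psi> n x - T (u x)) \<le> (LINT x|M. ?c * (norm (\<phi> n x - u x) powr p + \<eta> n powr p))"
    proof (rule Lp_dominated(2))
      show "integrable M (\<lambda>x. ?c * (norm (\<phi> n x - u x) powr p + \<eta> n powr p))"
        using Lp_integrable[OF d] by simp
      show "(\<lambda>x. \<psi> n x - T (u x)) \<in> borel_measurable M"
        by (intro Lp_measurable[where p=p] Lp_diff TuL test_function_Lp \<psi>)
      show "AE x in M. norm (\<psi> n x - T (u x)) powr p \<le> ?c * (norm (\<phi> n x - u x) powr p + \<eta> n powr p)"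
      proof (rule AE_I2)
        fix x
        have "\<bar>S n (\<phi> n x) - S n (u x)\<bar> \<le> \<bar>\<phi> n x - u x\<bar>" by (rule contraction_of_deriv_bound[OF S(3)])
        then have "\<bar>S n (\<phi> n x) - T (u x)\<bar> \<le> \<bar>\<phi> n x - u x\<bar> + \<eta> n"
          using ST[of n "u x"] unfolding \<eta>_def by linarith
        then have "norm (\<psi> n x - T (u x)) powr p \<le> norm (norm (\<phi> n x - u x) + \<eta> n) powr p"
          using p_gt_1 by (intro powr_mono2) (auto simp: \<psi>_def)
        also have "\<dots> \<le> (1 - 1/2) powr (1 - p) * norm (norm (\<phi> n x - u x)) powr p + (1/2) powr (1 - p) * norm (\<eta> n) powr p"
          using p_gt_1 by (intro norm_add_powr_le) auto
        also have "\<dots> = ?c * (norm (\<phi> n x - u x) powr p + \<eta> n powr p)"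
          by (simp add: \<eta>_def distrib_left)
        finally show "norm (\<psi> n x - T (u x)) powr p \<le> \<dots>" .
      qed
    qed
    also have "\<dots> = ?c * (Lpow p \<Omega> (\<lambda>x. \<phi> n x - u x) + \<eta> n powr p * measure M \<Omega>)"
      unfolding Lpow_def using Lp_integrable[OF d] by (simp add: mult.commute)
    finally show "Lpow p \<Omega> (\<lambda>x. \<psi> n x - T (u x)) \<le> \<dots>" .
  next
    have "(\<lambda>n. \<eta> n powr p) \<longlonglongrightarrow> 0 powr p"
      using p_gt_1 by (intro tendsto_powr2 \<eta>0 tendsto_const) (auto simp: \<eta>_def)
    then have "(\<lambda>n. \<eta> n powr p) \<longlonglongrightarrow> 0" by simp
    then show "(\<lambda>n. (1/2) powr (1 - p) * (Lpow p \<Omega> (\<lambda>x. \<phi> n x - u x) + \<eta> n powr p * measure M \<Omega>)) \<longlonglongrightarrow> 0"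
      by (intro tendsto_mult_right_zero tendsto_add_zero tendsto_mult_left_zero \<phi>)
  qed
  moreover have "\<forall>\<^sub>F n in sequentially. Lpow p \<Omega> (grad (\<psi> n)) \<le> Lpow p \<Omega> G + e" if "0 < e" for e
    using Lpow_upper_limit[OF L(4) L(2) \<phi>(3) that]
  proof eventually_elim
    case (elim n)
    have "Lpow p \<Omega> (grad (\<psi> n)) \<le> (LINT x|M. norm (grad (\<phi> n) x) powr p)"
    proof (rule Lp_dominated(2)[OF Lp_measurable[OF test_function_Lp(2)[OF \<psi>]] Lp_integrable[OF L(4)] AE_I2])
      fix x
      obtain d where d: "(S n has_real_derivative d) (at (\<phi> n x))" "\<bar>d\<bar> \<le> 1" using S(3) by blast
      have "grad (\<psi> n) x = d *\<^sub>R grad (\<phi> n) x"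
        unfolding \<psi>_def[abs_def] by (rule grad_compose[OF \<phi>(1) d(1)])
      then have "norm (grad (\<psi> n) x) \<le> norm (grad (\<phi> n) x)"
        using d(2) by (simp add: mult_left_le_one_le)
      then show "norm (grad (\<psi> n) x) powr p \<le> norm (grad (\<phi> n) x) powr p"
        using p_gt_1 by (intro powr_mono2) auto
    qed
    with elim show ?case by (simp add: Lpow_def)
  qed
  ultimately show ?thesis
    by (rule sob0_weak_closure[OF sob0_test_function[OF \<psi>] TuL])
qed

lemma sob0_pos_part:
  assumes "sob0 u G"
  shows "\<exists>H. sob0 (\<lambda>x. max 0 (u x)) H \<and> Lpow p \<Omega> H \<le> Lpow p \<Omega> G"
proof (rule sob0_contraction[OF assms, where S="\<lambda>n. smooth_pos_part (inverse (real (Suc n)))"])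
  show "\<bar>smooth_pos_part (inverse (real (Suc n))) s - max 0 s\<bar> \<le> inverse (real (Suc n))" for n s
    using order_trans[OF smooth_pos_part_approx[of "inverse (real (Suc n))" s],
        of "inverse (real (Suc n))"] by (simp add: field_simps)
  show "smooth (smooth_pos_part (inverse (real (Suc n))))" for n
    by (rule smooth_smooth_pos_part) simp
  show "smooth_pos_part (inverse (real (Suc n))) 0 = 0" for n by (rule smooth_pos_part_0) simp
  show "\<exists>d. (smooth_pos_part (inverse (real (Suc n))) has_real_derivative d) (at s) \<and> \<bar>d\<bar> \<le> 1" for n s
    by (rule smooth_pos_part_deriv) simp
qed auto

text \<open>For \<open>a \<ge> 0\<close> one has \<open>min(s, a) = max(a, 0) - max(a - s, 0)\<close>, which transfers the smooth approximation
  of the positive part.\<close>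

lemma sob0_min:
  assumes "sob0 u G" "0 \<le> a"
  shows "\<exists>H. sob0 (\<lambda>x. min (u x) a) H \<and> Lpow p \<Omega> H \<le> Lpow p \<Omega> G"
proof (rule sob0_contraction[OF assms(1), where
      S="\<lambda>n s. smooth_pos_part (inverse (real (Suc n))) a - smooth_pos_part (inverse (real (Suc n))) (a - s)"])
  fix n
  define e where "e = inverse (real (Suc n))"
  have e: "0 < e" by (simp add: e_def)
  have "smooth (\<lambda>s::real. a - s)" using Ck_diff[OF Ck_const[of _ a] Ck_inner[of _ "1::real"]] by simp
  then show "smooth (\<lambda>s. smooth_pos_part (inverse (real (Suc n))) a - smooth_pos_part (inverse (real (Suc n))) (a - s))"
    using smooth_smooth_pos_part[OF e] Ck_compose[of _ "smooth_pos_part e" "\<lambda>s. a - s"]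
    unfolding e_def by (intro allI Ck_diff[OF Ck_const]) simp
  fix s
  obtain d where d: "(smooth_pos_part e has_real_derivative d) (at (a - s))" "\<bar>d\<bar> \<le> 1"
    using smooth_pos_part_deriv[OF e] by blast
  have "((\<lambda>s. smooth_pos_part e (a - s)) has_real_derivative d * (- 1)) (at s)"
    by (rule DERIV_chain2[where g="\<lambda>s. a - s", OF d(1)]) (auto intro!: derivative_eq_intros)
  then have "((\<lambda>s. smooth_pos_part e a - smooth_pos_part e (a - s)) has_real_derivative d) (at s)"
    by (auto intro!: derivative_eq_intros)
  with d(2) show "\<exists>d. ((\<lambda>s. smooth_pos_part (inverse (real (Suc n))) a - smooth_pos_part (inverse (real (Suc n))) (a - s))
      has_real_derivative d) (at s) \<and> \<bar>d\<bar> \<le> 1" unfolding e_def by blast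
  have "\<bar>smooth_pos_part e a - smooth_pos_part e (a - s) - min s a\<bar> \<le> e"
  proof -
    have "min s a = max 0 a - max 0 (a - s)" using assms(2) by auto
    with smooth_pos_part_approx[OF e, of a] smooth_pos_part_approx[OF e, of "a - s"] show ?thesis by linarith
  qed
  then show "\<bar>smooth_pos_part (inverse (real (Suc n))) a - smooth_pos_part (inverse (real (Suc n))) (a - s) - min s a\<bar>
      \<le> inverse (real (Suc n))" by (simp add: e_def)
qed auto

lemma sob0_clip:
  assumes "sob0 u G" "0 \<le> a"
  shows "\<exists>H. sob0 (\<lambda>x. max 0 (min (u x) a)) H \<and> Lpow p \<Omega> H \<le> Lpow p \<Omega> G"
proof -
  obtain H where "sob0 (\<lambda>x. min (u x) a) H" "Lpow p \<Omega> H \<le> Lpow p \<Omega> G" using sob0_min[OF assms] by blast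
  then show ?thesis using sob0_pos_part by (meson order_trans)
qed

end

section \<open>Compactness\<close>

lemma nn_integral_lborel_translation:
  fixes g :: "'a::euclidean_space \<Rightarrow> ennreal"
  assumes [measurable]: "g \<in> borel_measurable borel"
  shows "(\<integral>\<^sup>+x. g (c + x) \<partial>lborel) = (\<integral>\<^sup>+x. g x \<partial>lborel)"
proof -
  have "(\<integral>\<^sup>+x. g x \<partial>lborel) = (\<integral>\<^sup>+x. g x \<partial>distr lborel borel ((+) c))"
    by (simp add: lborel_distr_plus)
  also have "\<dots> = (\<integral>\<^sup>+x. g (c + x) \<partial>lborel)"
    by (rule nn_integral_distr) auto
  finally show ?thesis by simp
qed

text \<open>Integrate the derivative along the segment from \<open>x\<close> to \<open>x + h\<close> and exchange the integrals; each
  translate of the gradient has the same integral.\<close>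

lemma test_function_translation_estimate:
  fixes \<phi> :: "'a::euclidean_space \<Rightarrow> real"
  assumes \<phi>: "test_function \<Omega> \<phi>"
  shows "(\<integral>\<^sup>+x. \<bar>\<phi> (x + h) - \<phi> x\<bar> \<partial>lborel) \<le> ennreal (norm h) * (\<integral>\<^sup>+x. norm (grad \<phi> x) \<partial>lborel)"
proof -
  note [measurable] = test_function_borel[OF \<phi>] grad_borel[OF \<phi>]
  have "ennreal \<bar>\<phi> (x + h) - \<phi> x\<bar> \<le> (\<integral>\<^sup>+t. indicator {0..1} t * ennreal (norm h * norm (grad \<phi> (x + t *\<^sub>R h))) \<partial>lborel)" for x
  proof -
    let ?f = "\<lambda>t. grad \<phi> (x + t *\<^sub>R h) \<bullet> h"
    have c: "continuous_on {0..1::real} ?f"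
      by (intro continuous_intros continuous_on_compose2[OF grad_continuous[OF \<phi>]]) auto
    have "(LINT t|lborel. indicator {0..1::real} t *\<^sub>R ?f t) = \<phi> (x + 1 *\<^sub>R h) - \<phi> (x + 0 *\<^sub>R h)"
      by (rule integral_FTC_Icc[OF _ _ c])
         (auto intro!: has_field_derivative_at_within test_function_along_line[OF \<phi>]
            simp: has_real_derivative_iff_has_vector_derivative[symmetric])
    moreover have "integrable lborel (\<lambda>t. indicator {0..1::real} t *\<^sub>R ?f t)"
      by (rule borel_integrable_compact[OF _ c]) simp
    ultimately have "ennreal \<bar>\<phi> (x + h) - \<phi> x\<bar> \<le> (\<integral>\<^sup>+t. norm (indicator {0..1::real} t *\<^sub>R ?f t) \<partial>lborel)"
      using integral_norm_bound_ennreal[of lborel "\<lambda>t. indicator {0..1::real} t *\<^sub>R ?f t"] by simp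
    also have "\<dots> \<le> (\<integral>\<^sup>+t. indicator {0..1} t * ennreal (norm h * norm (grad \<phi> (x + t *\<^sub>R h))) \<partial>lborel)"
      using Cauchy_Schwarz_ineq2[of "grad \<phi> (x + t *\<^sub>R h)" h for t]
      by (intro nn_integral_mono) (auto simp: indicator_def mult.commute intro!: ennreal_leI)
    finally show ?thesis .
  qed
  then have "(\<integral>\<^sup>+x. \<bar>\<phi> (x + h) - \<phi> x\<bar> \<partial>lborel)
      \<le> (\<integral>\<^sup>+x. (\<integral>\<^sup>+t. indicator {0..1::real} t * ennreal (norm h * norm (grad \<phi> (x + t *\<^sub>R h))) \<partial>lborel) \<partial>lborel)"
    by (rule nn_integral_mono)
  also have "\<dots> = (\<integral>\<^sup>+t. (\<integral>\<^sup>+x. indicator {0..1::real} t * ennreal (norm h * norm (grad \<phi> (x + t *\<^sub>R h))) \<partial>lborel) \<partial>lborel)"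
    by (rule lborel_pair.Fubini'[symmetric]) measurable
  also have "\<dots> = (\<integral>\<^sup>+t. indicator {0..1::real} t * (ennreal (norm h) * (\<integral>\<^sup>+x. norm (grad \<phi> x) \<partial>lborel)) \<partial>lborel)"
  proof (rule nn_integral_cong)
    fix t :: real
    have "(\<integral>\<^sup>+x. indicator {0..1::real} t * ennreal (norm h * norm (grad \<phi> (x + t *\<^sub>R h))) \<partial>lborel)
        = indicator {0..1} t * (ennreal (norm h) * (\<integral>\<^sup>+x. norm (grad \<phi> (t *\<^sub>R h + x)) \<partial>lborel))"
      by (simp add: nn_integral_cmult ennreal_mult add.commute)
    also have "(\<integral>\<^sup>+x. norm (grad \<phi> (t *\<^sub>R h + x)) \<partial>lborel) = (\<integral>\<^sup>+x. norm (grad \<phi> x) \<partial>lborel)"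
      by (rule nn_integral_lborel_translation[of "\<lambda>x. ennreal (norm (grad \<phi> x))"]) measurable
    finally show "(\<integral>\<^sup>+x. indicator {0..1::real} t * ennreal (norm h * norm (grad \<phi> (x + t *\<^sub>R h))) \<partial>lborel)
        = indicator {0..1} t * (ennreal (norm h) * (\<integral>\<^sup>+x. norm (grad \<phi> x) \<partial>lborel))" .
  qed
  also have "\<dots> = ennreal (norm h) * (\<integral>\<^sup>+x. norm (grad \<phi> x) \<partial>lborel)"
    by (simp add: nn_integral_multc)
  finally show ?thesis .
qed

text \<open>The half-open grid cube with side \<open>1 / s\<close> that contains \<open>x\<close>.\<close>

definition cell :: "real \<Rightarrow> 'a::euclidean_space \<Rightarrow> 'a set" where
  "cell s x = {y. \<forall>b\<in>Basis. \<lfloor>s * (y \<bullet> b)\<rfloor> = \<lfloor>s * (x \<bullet> b)\<rfloor>}"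

lemma cell_eq: "y \<in> cell s x \<Longrightarrow> cell s y = cell s x"
  by (auto simp: cell_def)

lemma cell_measurable [measurable]: "cell s x \<in> sets borel"
proof -
  have "cell s x = {y \<in> space borel. \<forall>b\<in>Basis. \<lfloor>s * (y \<bullet> b)\<rfloor> = \<lfloor>s * (x \<bullet> b)\<rfloor>}"
    by (auto simp: cell_def)
  also have "\<dots> \<in> sets borel" by measurable
  finally show ?thesis .
qed

lemma cell_diff_bound:
  assumes "0 < s" "y \<in> cell s x" "b \<in> Basis"
  shows "\<bar>(y - x) \<bullet> b\<bar> \<le> 1 / s"
proof -
  have "\<lfloor>s * (y \<bullet> b)\<rfloor> = \<lfloor>s * (x \<bullet> b)\<rfloor>" using assms by (auto simp: cell_def)
  then have "\<bar>s * (y \<bullet> b) - s * (x \<bullet> b)\<bar> < 1" by linarith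
  then have "s * \<bar>(y - x) \<bullet> b\<bar> < 1"
    using assms by (simp add: inner_diff_left right_diff_distrib[symmetric] abs_mult)
  with assms show ?thesis by (simp add: field_simps)
qed

lemma cell_between_boxes:
  fixes x :: "'a::euclidean_space"
  assumes "0 < s"
  defines "a \<equiv> \<Sum>b\<in>Basis. (\<lfloor>s * (x \<bullet> b)\<rfloor> / s) *\<^sub>R b"
  shows "box a (a + (1 / s) *\<^sub>R One) \<subseteq> cell s x" "cell s x \<subseteq> cbox a (a + (1 / s) *\<^sub>R One)"
proof -
  have a: "a \<bullet> b = \<lfloor>s * (x \<bullet> b)\<rfloor> / s" if "b \<in> Basis" for b using that by (simp add: a_def)
  have c: "(a + (1 / s) *\<^sub>R One) \<bullet> b = (\<lfloor>s * (x \<bullet> b)\<rfloor> + 1) / s" if "b \<in> Basis" for b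
    using that a by (simp add: inner_add_left add_divide_distrib)
  show "box a (a + (1 / s) *\<^sub>R One) \<subseteq> cell s x"
  proof
    fix y assume y: "y \<in> box a (a + (1 / s) *\<^sub>R One)"
    show "y \<in> cell s x" unfolding cell_def
    proof (intro CollectI ballI)
      fix b :: 'a assume b: "b \<in> Basis"
      have "\<lfloor>s * (x \<bullet> b)\<rfloor> / s < y \<bullet> b" "y \<bullet> b < (\<lfloor>s * (x \<bullet> b)\<rfloor> + 1) / s"
        using y b a[OF b] c[OF b] by (auto simp: mem_box)
      then have "\<lfloor>s * (x \<bullet> b)\<rfloor> < s * (y \<bullet> b)" "s * (y \<bullet> b) < \<lfloor>s * (x \<bullet> b)\<rfloor> + 1"
        using assms(1) by (simp_all add: field_simps)
      then show "\<lfloor>s * (y \<bullet> b)\<rfloor> = \<lfloor>s * (x \<bullet> b)\<rfloor>" by linarith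
    qed
  qed
  show "cell s x \<subseteq> cbox a (a + (1 / s) *\<^sub>R One)"
  proof
    fix y assume y: "y \<in> cell s x"
    have "a \<bullet> b \<le> y \<bullet> b \<and> y \<bullet> b \<le> (a + (1 / s) *\<^sub>R One) \<bullet> b" if b: "b \<in> Basis" for b
    proof -
      have "\<lfloor>s * (y \<bullet> b)\<rfloor> = \<lfloor>s * (x \<bullet> b)\<rfloor>" using y b by (auto simp: cell_def)
      then have "\<lfloor>s * (x \<bullet> b)\<rfloor> \<le> s * (y \<bullet> b)" "s * (y \<bullet> b) \<le> \<lfloor>s * (x \<bullet> b)\<rfloor> + 1" by linarith+
      then show ?thesis using assms(1) unfolding c[OF b] a[OF b] by (simp add: field_simps)
    qed
    then show "y \<in> cbox a (a + (1 / s) *\<^sub>R One)" by (simp add: mem_box)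
  qed
qed

lemma emeasure_cell:
  fixes x :: "'a::euclidean_space"
  assumes "0 < s"
  shows "emeasure lborel (cell s x) = ennreal ((1 / s) ^ DIM('a))"
proof (rule antisym)
  define a where "a = (\<Sum>b\<in>Basis. (\<lfloor>s * (x \<bullet> b)\<rfloor> / s) *\<^sub>R b)"
  note sub = cell_between_boxes[OF assms, of x, folded a_def]

  have le: "a \<bullet> b \<le> (a + (1 / s) *\<^sub>R One) \<bullet> b" if "b \<in> Basis" for b
    using that assms by (simp add: inner_add_left)
  have "emeasure lborel (cell s x) \<le> emeasure lborel (cbox a (a + (1 / s) *\<^sub>R One))"
    by (rule emeasure_mono[OF sub(2)]) simp
  also have "\<dots> = ennreal ((1 / s) ^ DIM('a))"
    using emeasure_lborel_cbox[of a "a + (1 / s) *\<^sub>R One", OF le] by simp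
  finally show "emeasure lborel (cell s x) \<le> ennreal ((1 / s) ^ DIM('a))" .
  have "ennreal ((1 / s) ^ DIM('a)) = emeasure lborel (box a (a + (1 / s) *\<^sub>R One))"
    using emeasure_lborel_box[of a "a + (1 / s) *\<^sub>R One", OF le] by simp
  also have "\<dots> \<le> emeasure lborel (cell s x)" by (rule emeasure_mono[OF sub(1)]) simp
  finally show "ennreal ((1 / s) ^ DIM('a)) \<le> emeasure lborel (cell s x)" .
qed

definition cell_avg :: "real \<Rightarrow> ('a::euclidean_space \<Rightarrow> real) \<Rightarrow> 'a \<Rightarrow> real" where
  "cell_avg s v x = s ^ DIM('a) * (LINT y|lborel. indicator (cell s x) y * v y)"

lemma cell_avg_borel:
  fixes v :: "'a::euclidean_space \<Rightarrow> real"
  assumes [measurable]: "v \<in> borel_measurable borel"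
  shows "cell_avg s v \<in> borel_measurable borel"
proof -
  have "(\<lambda>x. LINT y|lborel. (if \<forall>b\<in>Basis. \<lfloor>s * (y \<bullet> b)\<rfloor> = \<lfloor>s * (x \<bullet> b)\<rfloor> then v y else 0)) \<in> borel_measurable (borel :: 'a measure)"
    by measurable
  moreover have "(\<lambda>y. indicator (cell s x) y * v y) = (\<lambda>y. if \<forall>b\<in>Basis. \<lfloor>s * (y \<bullet> b)\<rfloor> = \<lfloor>s * (x \<bullet> b)\<rfloor> then v y else 0)" for x
    by (auto simp: fun_eq_iff indicator_def cell_def)
  ultimately show ?thesis unfolding cell_avg_def[abs_def] by simp
qed

text \<open>The constant is the product of \<open>s\<^sup>d\<close> (averaging), the volume \<open>(2 / s)\<^sup>d\<close> of the box containing
  all differences of points of a cell, and the bound \<open>d / s\<close> for the length of such a difference.\<close>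

lemma cell_avg_error:
  fixes \<phi> :: "'a::euclidean_space \<Rightarrow> real"
  assumes \<phi>: "test_function \<Omega> \<phi>" and s: "0 < s"
  shows "(\<integral>\<^sup>+x. \<bar>\<phi> x - cell_avg s \<phi> x\<bar> \<partial>lborel)
    \<le> ennreal (2 ^ DIM('a) * real DIM('a) / s) * (\<integral>\<^sup>+x. norm (grad \<phi> x) \<partial>lborel)"
proof -
  note [measurable] = test_function_borel[OF \<phi>] grad_borel[OF \<phi>]
  let ?d = "DIM('a)"
  define A where "A = (\<integral>\<^sup>+x. norm (grad \<phi> x) \<partial>lborel)"
  define B where "B = cbox (- (1 / s) *\<^sub>R One) ((1 / s) *\<^sub>R One :: 'a)"
  have [measurable]: "B \<in> sets borel" by (simp add: B_def)
  have point: "ennreal \<bar>\<phi> x - cell_avg s \<phi> x\<bar> \<le> ennreal (s ^ ?d) * (\<integral>\<^sup>+h. indicator B h * ennreal \<bar>\<phi> (x + h) - \<phi> x\<bar> \<partial>lborel)" for x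
  proof -
    have ic: "integrable lborel (\<lambda>y. indicator (cell s x) y * \<phi> x)"
      using emeasure_cell[OF s, of x] by (intro integrable_mult_left integrable_real_indicator) auto
    have iv: "integrable lborel (\<lambda>y. indicator (cell s x) y * \<phi> y)"
      using integrable_mult_indicator[OF _ test_function_integrable[OF \<phi>], of "cell s x"] by simp
    have "(LINT y|lborel. indicator (cell s x) y * \<phi> x) = (1 / s) ^ ?d * \<phi> x"
      using emeasure_cell[OF s, of x] s by (simp add: measure_def)
    then have "(LINT y|lborel. indicator (cell s x) y * \<phi> x - indicator (cell s x) y * \<phi> y)
        = (1 / s) ^ ?d * \<phi> x - (LINT y|lborel. indicator (cell s x) y * \<phi> y)"
      unfolding Bochner_Integration.integral_diff[OF ic iv] by simp
    then have "\<phi> x - cell_avg s \<phi> x = s ^ ?d * (LINT y|lborel. indicator (cell s x) y * \<phi> x - indicator (cell s x) y * \<phi> y)"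
      unfolding cell_avg_def using s by (simp add: right_diff_distrib power_divide)
    then have "ennreal \<bar>\<phi> x - cell_avg s \<phi> x\<bar>
        = ennreal (s ^ ?d) * ennreal (norm (LINT y|lborel. indicator (cell s x) y * \<phi> x - indicator (cell s x) y * \<phi> y))"
      using s by (simp add: abs_mult ennreal_mult)
    also have "\<dots> \<le> ennreal (s ^ ?d) * (\<integral>\<^sup>+y. norm (indicator (cell s x) y * \<phi> x - indicator (cell s x) y * \<phi> y) \<partial>lborel)"
      by (intro mult_left_mono integral_norm_bound_ennreal Bochner_Integration.integrable_diff ic iv) simp
    also have "(\<integral>\<^sup>+y. norm (indicator (cell s x) y * \<phi> x - indicator (cell s x) y * \<phi> y) \<partial>lborel)
        \<le> (\<integral>\<^sup>+y. indicator B (y - x) * ennreal \<bar>\<phi> y - \<phi> x\<bar> \<partial>lborel)"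
    proof (rule nn_integral_mono)
      fix y
      show "ennreal (norm (indicator (cell s x) y * \<phi> x - indicator (cell s x) y * \<phi> y)) \<le> indicator B (y - x) * ennreal \<bar>\<phi> y - \<phi> x\<bar>"
      proof (cases "y \<in> cell s x")
        case True
        have "y - x \<in> B"
          unfolding B_def using cell_diff_bound[OF s True] by (auto simp: mem_box abs_le_iff algebra_simps)
        with True show ?thesis by (simp add: abs_minus_commute)
      qed simp
    qed
    also have "(\<integral>\<^sup>+y. indicator B (y - x) * ennreal \<bar>\<phi> y - \<phi> x\<bar> \<partial>lborel)
        = (\<integral>\<^sup>+h. indicator B h * ennreal \<bar>\<phi> (x + h) - \<phi> x\<bar> \<partial>lborel)"
      using nn_integral_lborel_translation[of "\<lambda>y. indicator B (y - x) * ennreal \<bar>\<phi> y - \<phi> x\<bar>" x] by simp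
    finally show ?thesis by (simp add: mult_left_mono)
  qed
  have "(\<integral>\<^sup>+x. \<bar>\<phi> x - cell_avg s \<phi> x\<bar> \<partial>lborel)
      \<le> (\<integral>\<^sup>+x. ennreal (s ^ ?d) * (\<integral>\<^sup>+h. indicator B h * ennreal \<bar>\<phi> (x + h) - \<phi> x\<bar> \<partial>lborel) \<partial>lborel)"
    by (intro nn_integral_mono point)
  also have "\<dots> = ennreal (s ^ ?d) * (\<integral>\<^sup>+x. (\<integral>\<^sup>+h. indicator B h * ennreal \<bar>\<phi> (x + h) - \<phi> x\<bar> \<partial>lborel) \<partial>lborel)"
    by (rule nn_integral_cmult) measurable
  also have "(\<integral>\<^sup>+x. (\<integral>\<^sup>+h. indicator B h * ennreal \<bar>\<phi> (x + h) - \<phi> x\<bar> \<partial>lborel) \<partial>lborel)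
      = (\<integral>\<^sup>+h. (\<integral>\<^sup>+x. indicator B h * ennreal \<bar>\<phi> (x + h) - \<phi> x\<bar> \<partial>lborel) \<partial>lborel)"
    by (rule lborel_pair.Fubini'[symmetric]) measurable
  also have "\<dots> \<le> (\<integral>\<^sup>+h. indicator B h * (ennreal (real ?d / s) * A) \<partial>lborel)"
  proof (rule nn_integral_mono)
    fix h :: 'a
    have "(\<integral>\<^sup>+x. indicator B h * ennreal \<bar>\<phi> (x + h) - \<phi> x\<bar> \<partial>lborel) = indicator B h * (\<integral>\<^sup>+x. \<bar>\<phi> (x + h) - \<phi> x\<bar> \<partial>lborel)"
      by (rule nn_integral_cmult) measurable
    also have "\<dots> \<le> indicator B h * (ennreal (norm h) * A)"
      unfolding A_def by (intro mult_left_mono test_function_translation_estimate[OF \<phi>]) simp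
    also have "\<dots> \<le> indicator B h * (ennreal (real ?d / s) * A)"
    proof (cases "h \<in> B")
      case True
      have "norm h \<le> (\<Sum>b\<in>Basis. \<bar>h \<bullet> b\<bar>)" by (rule norm_le_l1)
      also have "\<dots> \<le> (\<Sum>b\<in>(Basis :: 'a set). 1 / s)"
        using True by (intro sum_mono) (auto simp: B_def mem_box abs_le_iff)
      also have "\<dots> = real ?d / s" by simp
      finally show ?thesis by (intro mult_left_mono mult_right_mono ennreal_leI) auto
    qed simp
    finally show "(\<integral>\<^sup>+x. indicator B h * ennreal \<bar>\<phi> (x + h) - \<phi> x\<bar> \<partial>lborel) \<le> indicator B h * (ennreal (real ?d / s) * A)" .
  qed
  also have "\<dots> = emeasure lborel B * (ennreal (real ?d / s) * A)"
    by (simp add: nn_integral_multc)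
  also have "emeasure lborel B = ennreal ((2 / s) ^ ?d)"
    unfolding B_def using s by (subst emeasure_lborel_cbox) (auto simp: inner_diff_left inner_add_left)
  finally have "(\<integral>\<^sup>+x. \<bar>\<phi> x - cell_avg s \<phi> x\<bar> \<partial>lborel) \<le> ennreal (s ^ ?d) * (ennreal ((2 / s) ^ ?d) * (ennreal (real ?d / s) * A))"
    by (simp add: mult_left_mono)
  also have "\<dots> = ennreal (s ^ ?d * (2 / s) ^ ?d * (real ?d / s)) * A"
  proof -
    have m3: "ennreal (x * y * z) = ennreal x * ennreal y * ennreal z" if "0 \<le> x" "0 \<le> y" "0 \<le> z" for x y z
      using that by (simp add: ennreal_mult)
    have "ennreal (s ^ ?d * (2 / s) ^ ?d * (real ?d / s)) = ennreal (s ^ ?d) * ennreal ((2 / s) ^ ?d) * ennreal (real ?d / s)"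
      by (rule m3) (use s in auto)
    then show ?thesis by (simp only: mult.assoc)
  qed
  also have "s ^ ?d * (2 / s) ^ ?d * (real ?d / s) = 2 ^ ?d * real ?d / s"
  proof -
    have "s ^ ?d * (2 / s) ^ ?d = (s * (2 / s)) ^ ?d" by (rule power_mult_distrib[symmetric])
    also have "s * (2 / s) = 2" using s by simp
    finally show ?thesis by simp
  qed
  finally show ?thesis by (simp add: A_def)
qed

text \<open>Every cell has interior points, so a countable dense set meets all cells of all sizes.\<close>

lemma cell_countable_representatives:
  obtains D :: "'a::euclidean_space set" where "countable D" "\<And>s x. 0 < s \<Longrightarrow> \<exists>d\<in>D. cell s d = cell s x"
proof -
  obtain D :: "'a set" where D: "countable D" "\<And>X. open X \<Longrightarrow> X \<noteq> {} \<Longrightarrow> \<exists>d\<in>D. d \<in> X"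
    using countable_dense_setE[where ?'a='a] by blast
  have "\<exists>d\<in>D. cell s d = cell s x" if s: "0 < s" for s and x :: 'a
  proof -
    define a where "a = (\<Sum>b\<in>Basis. (\<lfloor>s * (x \<bullet> b)\<rfloor> / s) *\<^sub>R b)"
    have "box a (a + (1 / s) *\<^sub>R One) \<noteq> {}" using s by (simp add: box_ne_empty inner_add_left)
    then obtain d where "d \<in> D" "d \<in> box a (a + (1 / s) *\<^sub>R One)" using D(2)[OF open_box] by blast
    with cell_between_boxes(1)[OF s, of x] cell_eq show ?thesis unfolding a_def by blast
  qed
  with D(1) that show ?thesis by blast
qed

context lp_domain
begin

lemma integral_le_of_nn_integral_lborel:
  fixes v :: "'a \<Rightarrow> real"
  assumes v: "v \<in> borel_measurable borel" "integrable M v" "\<And>x. 0 \<le> v x"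
    and le: "(\<integral>\<^sup>+x. v x \<partial>lborel) \<le> ennreal E" "0 \<le> E"
  shows "(LINT x|M. v x) \<le> E"
proof -
  have "ennreal (LINT x|M. v x) = (\<integral>\<^sup>+x. v x \<partial>M)"
    using v by (intro nn_integral_eq_integral[symmetric]) auto
  also have "\<dots> = (\<integral>\<^sup>+x. ennreal (v x) * indicator \<Omega> x \<partial>lebesgue)"
    by (simp add: nn_integral_restrict_space)
  also have "\<dots> \<le> (\<integral>\<^sup>+x. ennreal (v x) \<partial>lebesgue)"
    by (intro nn_integral_mono) (auto simp: indicator_def)
  also have "\<dots> = (\<integral>\<^sup>+x. ennreal (v x) \<partial>lborel)"
    using v by (simp add: nn_integral_completion)
  also note le(1)
  finally show ?thesis using le(2) by simp
qed

text \<open>A diagonal sequence makes the averages over all cells of all sizes converge, since there are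
  only countably many cells; functions with bounded gradients are uniformly close to their cell
  averages in \<open>L\<^sup>1\<close>.\<close>

lemma test_functions_L1_compact:
  fixes \<phi> :: "nat \<Rightarrow> 'a \<Rightarrow> real"
  assumes \<phi>: "\<And>k. test_function \<Omega> (\<phi> k)"
    and A: "\<And>k. (\<integral>\<^sup>+x. norm (grad (\<phi> k) x) \<partial>lborel) \<le> ennreal A" "0 \<le> A"
    and B: "\<And>k. (LINT x|lborel. \<bar>\<phi> k x\<bar>) \<le> B"
  shows "\<exists>r :: nat \<Rightarrow> nat. strict_mono r \<and>
    (\<forall>e>0. \<exists>N. \<forall>i\<ge>N. \<forall>j\<ge>N. (LINT x|M. norm (\<phi> (r i) x - \<phi> (r j) x)) < e)"
proof -
  obtain D :: "'a set" where D: "countable D" "\<And>s x. 0 < s \<Longrightarrow> \<exists>d\<in>D. cell s d = cell s x"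
    using cell_countable_representatives by blast
  have int_bound: "\<bar>LINT y|lborel. indicator (cell s x) y * \<phi> k y\<bar> \<le> B" for s x k
  proof -
    have i: "integrable lborel (\<lambda>y. indicator (cell s x) y * \<phi> k y)"
      using integrable_mult_indicator[OF _ test_function_integrable[OF \<phi>], of "cell s x"] by simp
    have "\<bar>LINT y|lborel. indicator (cell s x) y * \<phi> k y\<bar> \<le> (LINT y|lborel. \<bar>indicator (cell s x) y * \<phi> k y\<bar>)"
      by (rule integral_abs_bound)
    also have "\<dots> \<le> (LINT y|lborel. \<bar>\<phi> k y\<bar>)"
      by (intro integral_mono integrable_abs i test_function_integrable[OF \<phi>]) (auto simp: indicator_def)
    finally show ?thesis using B[of k] by simp
  qed

  have "countable ((UNIV :: nat set) \<times> D)" using D(1) by auto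
  moreover define I where "I k z = (LINT y|lborel. indicator (cell (real (Suc (fst z))) (snd z)) y * \<phi> k y)" for k and z :: "nat \<times> 'a"
  moreover have "norm (I k z) \<le> B" for k z unfolding I_def using int_bound by simp
  ultimately obtain r :: "nat \<Rightarrow> nat" where r: "strict_mono r"
    "\<And>z. z \<in> UNIV \<times> D \<Longrightarrow> \<exists>l. (\<lambda>i. I (r i) z) \<longlonglongrightarrow> l"
    using function_convergent_subsequence[of "UNIV \<times> D" I B] by blast
  have conv: "\<exists>l. (\<lambda>i. cell_avg (real (Suc n)) (\<phi> (r i)) x) \<longlonglongrightarrow> l" for n x
  proof -
    obtain d where d: "d \<in> D" "cell (real (Suc n)) d = cell (real (Suc n)) x" using D(2)[of "real (Suc n)" x] by auto
    obtain l where "(\<lambda>i. LINT y|lborel. indicator (cell (real (Suc n)) d) y * \<phi> (r i) y) \<longlonglongrightarrow> l"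
      using r(2)[of "(n, d)"] d(1) by (auto simp: I_def)
    from tendsto_mult_left[OF this, of "real (Suc n) ^ DIM('a)"]
    show ?thesis unfolding cell_avg_def d(2) by (rule exI)
  qed
  have "\<exists>N. \<forall>i\<ge>N. \<forall>j\<ge>N. (LINT x|M. norm (\<phi> (r i) x - \<phi> (r j) x)) < e" if e: "0 < e" for e
  proof -
    define c where "c = 2 ^ DIM('a) * real DIM('a) * A"
    have "(\<lambda>n. c * inverse (real (Suc n))) \<longlonglongrightarrow> 0"
      by (intro tendsto_mult_right_zero LIMSEQ_inverse_real_of_nat)
    then have "\<forall>\<^sub>F n in sequentially. c * inverse (real (Suc n)) < e / 4"
      by (rule order_tendstoD) (use e in auto)
    then obtain n where n: "c * inverse (real (Suc n)) < e / 4" by (auto simp: eventually_sequentially)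
    define s where "s = real (Suc n)"
    have s: "0 < s" by (simp add: s_def)
    define g where "g i = cell_avg s (\<phi> (r i))" for i
    define gl where "gl x = lim (\<lambda>i. g i x)" for x
    have gm: "g i \<in> borel_measurable borel" for i
      unfolding g_def by (intro cell_avg_borel test_function_borel[OF \<phi>])
    then have [measurable]: "g i \<in> borel_measurable M" for i by (rule borel_measurable_lebesgue_onI)
    have lim: "(\<lambda>i. g i x) \<longlonglongrightarrow> gl x" for x
      using conv[of n x] unfolding gl_def g_def s_def by (auto simp: limI)
    have [measurable]: "gl \<in> borel_measurable M"
      by (rule borel_measurable_LIMSEQ_real[OF lim]) measurable
    have gb: "\<bar>g i x\<bar> \<le> s ^ DIM('a) * B" for i x
      unfolding g_def cell_avg_def using s int_bound by (simp add: abs_mult mult_left_mono)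
    have gi: "integrable M (g i)" for i
      by (rule integrable_const_bound[where B="s ^ DIM('a) * B"]) (use gb in auto)
    have glb: "\<bar>gl x\<bar> \<le> s ^ DIM('a) * B" for x
      by (rule LIMSEQ_le_const2[OF tendsto_rabs[OF lim]]) (use gb in auto)
    have gli: "integrable M gl"
      by (rule integrable_const_bound[where B="s ^ DIM('a) * B"]) (use glb in auto)
    have "(\<lambda>i. LINT x|M. \<bar>g i x - gl x\<bar>) \<longlonglongrightarrow> (LINT x|M. 0)"
    proof (rule integral_dominated_convergence[where w="\<lambda>x. 2 * (s ^ DIM('a) * B)"])
      show "AE x in M. (\<lambda>i. \<bar>g i x - gl x\<bar>) \<longlonglongrightarrow> 0"
        using lim by (intro AE_I2 tendsto_rabs_zero) (simp add: LIM_zero_iff)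
      show "AE x in M. norm \<bar>g i x - gl x\<bar> \<le> 2 * (s ^ DIM('a) * B)" for i
      proof (rule AE_I2)
        fix x
        have "\<bar>g i x - gl x\<bar> \<le> \<bar>g i x\<bar> + \<bar>gl x\<bar>" by (rule abs_triangle_ineq4)
        with gb[of i x] glb[of x] show "norm \<bar>g i x - gl x\<bar> \<le> 2 * (s ^ DIM('a) * B)"
          unfolding real_norm_def abs_abs by linarith
      qed
    qed auto
    then have "\<forall>\<^sub>F i in sequentially. (LINT x|M. \<bar>g i x - gl x\<bar>) < e / 4"
      by (intro order_tendstoD) (use e in auto)
    then obtain N where N: "\<And>i. N \<le> i \<Longrightarrow> (LINT x|M. \<bar>g i x - gl x\<bar>) < e / 4"
      by (auto simp: eventually_sequentially)
    have \<phi>i: "integrable M (\<phi> k)" for k by (rule Lp_imp_integrable(1)[OF test_function_Lp(1)[OF \<phi>]])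
    have close: "(LINT x|M. \<bar>\<phi> (r i) x - g i x\<bar>) \<le> e / 4" for i
    proof (rule integral_le_of_nn_integral_lborel)
      show "(\<lambda>x. \<bar>\<phi> (r i) x - g i x\<bar>) \<in> borel_measurable borel"
        using gm test_function_borel[OF \<phi>] by (intro borel_measurable_abs borel_measurable_diff)
      show "integrable M (\<lambda>x. \<bar>\<phi> (r i) x - g i x\<bar>)"
        by (intro integrable_abs Bochner_Integration.integrable_diff \<phi>i gi)
      have "(\<integral>\<^sup>+x. \<bar>\<phi> (r i) x - g i x\<bar> \<partial>lborel) \<le> ennreal (2 ^ DIM('a) * real DIM('a) / s) * (\<integral>\<^sup>+x. norm (grad (\<phi> (r i)) x) \<partial>lborel)"
        unfolding g_def by (rule cell_avg_error[OF \<phi> s])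
      also have "\<dots> \<le> ennreal (2 ^ DIM('a) * real DIM('a) / s) * ennreal A"
        by (intro mult_left_mono A(1)) simp
      also have "\<dots> = ennreal (c * inverse (real (Suc n)))"
        using A(2) s by (simp add: c_def s_def ennreal_mult[symmetric] divide_inverse mult.assoc mult.commute)
      also have "\<dots> \<le> ennreal (e / 4)" using n by (intro ennreal_leI) simp
      finally show "(\<integral>\<^sup>+x. \<bar>\<phi> (r i) x - g i x\<bar> \<partial>lborel) \<le> ennreal (e / 4)" .
    qed (use e in auto)
    have "(LINT x|M. norm (\<phi> (r i) x - \<phi> (r j) x)) < e" if ij: "N \<le> i" "N \<le> j" for i j
    proof -
      have i1: "integrable M (\<lambda>x. \<bar>\<phi> (r k) x - g k x\<bar>)" "integrable M (\<lambda>x. \<bar>g k x - gl x\<bar>)" for k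
        by (intro integrable_abs Bochner_Integration.integrable_diff \<phi>i gi gli)+
      have "(LINT x|M. norm (\<phi> (r i) x - \<phi> (r j) x)) \<le>
        (LINT x|M. (\<bar>\<phi> (r i) x - g i x\<bar> + \<bar>\<phi> (r j) x - g j x\<bar>) + (\<bar>g i x - gl x\<bar> + \<bar>g j x - gl x\<bar>))"
        by (intro integral_mono integrable_norm Bochner_Integration.integrable_diff Bochner_Integration.integrable_add \<phi>i i1) auto
      also have "\<dots> = ((LINT x|M. \<bar>\<phi> (r i) x - g i x\<bar>) + (LINT x|M. \<bar>\<phi> (r j) x - g j x\<bar>))
          + ((LINT x|M. \<bar>g i x - gl x\<bar>) + (LINT x|M. \<bar>g j x - gl x\<bar>))"
        by (simp add: i1)
      also have "\<dots> < e" using close[of i] close[of j] N[OF ij(1)] N[OF ij(2)] by linarith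
      finally show ?thesis .
    qed
    then show ?thesis by blast
  qed
  with r(1) show ?thesis by blast
qed

text \<open>Rellich's theorem. Replace \<open>u\<^sub>k\<close> by a test function at distance at most \<open>1 / (k + 1)\<close>, use compactness
  in \<open>L\<^sup>1\<close>, and pass to further subsequences to return to \<open>u\<^sub>k\<close> almost everywhere.\<close>

lemma sob0_AE_compact:
  assumes uG: "\<And>k::nat. sob0 (u k) (G k)" and B: "\<And>k. Lpow p \<Omega> (u k) \<le> B" and A: "\<And>k. Lpow p \<Omega> (G k) \<le> A"
  shows "\<exists>r w. strict_mono (r :: nat \<Rightarrow> nat) \<and> w \<in> borel_measurable M \<and> (AE x in M. (\<lambda>i. u (r i) x) \<longlonglongrightarrow> w x)"
proof -
  have "\<exists>\<phi>. test_function \<Omega> \<phi> \<and> Lpow p \<Omega> (\<lambda>x. \<phi> x - u k x) \<le> inverse (real (Suc k)) \<and>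
      Lpow p \<Omega> (\<lambda>x. grad \<phi> x - G k x) \<le> inverse (real (Suc k))" for k
    by (rule sob0_approx[OF uG]) simp
  then obtain \<phi> where \<phi>: "\<And>k. test_function \<Omega> (\<phi> k)"
    "\<And>k. Lpow p \<Omega> (\<lambda>x. \<phi> k x - u k x) \<le> inverse (real (Suc k))"
    "\<And>k. Lpow p \<Omega> (\<lambda>x. grad (\<phi> k) x - G k x) \<le> inverse (real (Suc k))" by metis
  define c where "c = (1/2::real) powr (1 - p)"
  have c: "0 \<le> c" by (simp add: c_def)
  have inv1: "inverse (real (Suc k)) \<le> 1" for k by (simp add: divide_simps)
  have bound: "(LINT x|lborel. norm (\<phi> k x)) \<le> measure M \<Omega> + c * (B + 1)"
    "(LINT x|lborel. norm (grad (\<phi> k) x)) \<le> measure M \<Omega> + c * (A + 1)" for k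
  proof -
    note L = sob0_Lp[OF uG, of k] test_function_Lp[OF \<phi>(1), of k]
    have "Lpow p \<Omega> (\<lambda>x. u k x + (\<phi> k x - u k x)) \<le> (1 - 1/2) powr (1 - p) * Lpow p \<Omega> (u k) + (1/2) powr (1 - p) * Lpow p \<Omega> (\<lambda>x. \<phi> k x - u k x)"
      by (intro Lp_add_bound(2) Lp_diff L) auto
    then have "Lpow p \<Omega> (\<phi> k) \<le> c * (Lpow p \<Omega> (u k) + Lpow p \<Omega> (\<lambda>x. \<phi> k x - u k x))"
      by (simp add: c_def distrib_left)
    also have "\<dots> \<le> c * (B + 1)" using B[of k] order_trans[OF \<phi>(2) inv1, of k] by (intro mult_left_mono c) linarith
    finally have "(LINT x|M. norm (\<phi> k x)) \<le> measure M \<Omega> + c * (B + 1)"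
      using Lp_imp_integrable(2)[OF L(3), of 1] by simp
    moreover have "(LINT x|M. norm (\<phi> k x)) = (LINT x|lborel. norm (\<phi> k x))"
      using test_function_borel[OF \<phi>(1)] test_function_zero_outside[OF \<phi>(1)]
      by (intro integral_lebesgue_on_eq_lborel) auto
    ultimately show "(LINT x|lborel. norm (\<phi> k x)) \<le> measure M \<Omega> + c * (B + 1)" by simp
    have "Lpow p \<Omega> (\<lambda>x. G k x + (grad (\<phi> k) x - G k x)) \<le> (1 - 1/2) powr (1 - p) * Lpow p \<Omega> (G k) + (1/2) powr (1 - p) * Lpow p \<Omega> (\<lambda>x. grad (\<phi> k) x - G k x)"
      by (intro Lp_add_bound(2) Lp_diff L) auto
    then have "Lpow p \<Omega> (grad (\<phi> k)) \<le> c * (Lpow p \<Omega> (G k) + Lpow p \<Omega> (\<lambda>x. grad (\<phi> k) x - G k x))"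
      by (simp add: c_def distrib_left)
    also have "\<dots> \<le> c * (A + 1)" using A[of k] order_trans[OF \<phi>(3) inv1, of k] by (intro mult_left_mono c) linarith
    finally have "(LINT x|M. norm (grad (\<phi> k) x)) \<le> measure M \<Omega> + c * (A + 1)"
      using Lp_imp_integrable(2)[OF L(4), of 1] by simp
    moreover have "(LINT x|M. norm (grad (\<phi> k) x)) = (LINT x|lborel. norm (grad (\<phi> k) x))"
      using grad_borel[OF \<phi>(1)] grad_support[OF \<phi>(1), of k]
      by (intro integral_lebesgue_on_eq_lborel) (auto simp: subset_iff)
    ultimately show "(LINT x|lborel. norm (grad (\<phi> k) x)) \<le> measure M \<Omega> + c * (A + 1)" by simp
  qed
  have A1: "0 \<le> measure M \<Omega> + c * (A + 1)" using bound(2)[of 0] by (rule order_trans[rotated]) simp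
  have gradnn: "(\<integral>\<^sup>+x. norm (grad (\<phi> k) x) \<partial>lborel) \<le> ennreal (measure M \<Omega> + c * (A + 1))" for k
  proof -
    obtain K where K: "compact K" "\<And>x. x \<notin> K \<Longrightarrow> grad (\<phi> k) x = 0" using grad_support[OF \<phi>(1)[of k]] by blast
    have "integrable lborel (\<lambda>x. norm (grad (\<phi> k) x))"
      by (intro integrable_norm continuous_compact_support(1)[OF grad_continuous[OF \<phi>(1)] K])
    then have "(\<integral>\<^sup>+x. norm (grad (\<phi> k) x) \<partial>lborel) = ennreal (LINT x|lborel. norm (grad (\<phi> k) x))"
      by (intro nn_integral_eq_integral) auto
    with bound(2)[of k] show ?thesis by (simp add: ennreal_leI)
  qed
  have abs_bound: "(LINT x|lborel. \<bar>\<phi> k x\<bar>) \<le> measure M \<Omega> + c * (B + 1)" for k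
    using bound(1)[of k] by simp
  obtain r :: "nat \<Rightarrow> nat" where r: "strict_mono r"
    "\<And>e. 0 < e \<Longrightarrow> \<exists>N. \<forall>i\<ge>N. \<forall>j\<ge>N. (LINT x|M. norm (\<phi> (r i) x - \<phi> (r j) x)) < e"
    using test_functions_L1_compact[of \<phi>, OF \<phi>(1) gradnn A1 abs_bound] by blast
  obtain r2 where r2: "strict_mono r2" "AE x in M. Cauchy (\<lambda>i. \<phi> (r (r2 i)) x)"
    using cauchy_L1_AE_cauchy_subseq[of M "\<lambda>i. \<phi> (r i)"] r(2) Lp_imp_integrable(1)[OF test_function_Lp(1)[OF \<phi>(1)]] by blast
  define w where "w x = lim (\<lambda>i. \<phi> (r (r2 i)) x)" for x
  have [measurable]: "\<phi> k \<in> borel_measurable M" for k by (rule Lp_measurable[OF test_function_Lp(1)[OF \<phi>(1)]])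
  have wm: "w \<in> borel_measurable M" unfolding w_def by measurable
  have wlim: "AE x in M. (\<lambda>i. \<phi> (r (r2 i)) x) \<longlonglongrightarrow> w x"
    using r2(2) by eventually_elim (simp add: w_def Cauchy_convergent convergent_LIMSEQ_iff[symmetric])
  have d: "(\<lambda>x. \<phi> k x - u k x) \<in> Lp p \<Omega>" for k by (intro Lp_diff test_function_Lp[OF \<phi>(1)] sob0_Lp[OF uG])
  have z: "(\<lambda>x. 0::real) \<in> Lp p \<Omega>" by (rule sob0_Lp(1)[OF sob0_zero])
  have "(\<lambda>k. Lpow p \<Omega> (\<lambda>x. \<phi> k x - u k x)) \<longlonglongrightarrow> 0"
    by (rule Lpow_tendsto_0I[OF \<phi>(2) LIMSEQ_inverse_real_of_nat])
  from LIMSEQ_subseq_LIMSEQ[OF this strict_mono_o[OF r(1) r2(1)]]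
  have "(\<lambda>i. Lpow p \<Omega> (\<lambda>x. (\<phi> (r (r2 i)) x - u (r (r2 i)) x) - 0)) \<longlonglongrightarrow> 0" by (simp add: o_def)
  then obtain r3 where r3: "strict_mono r3" "AE x in M. (\<lambda>i. \<phi> (r (r2 (r3 i))) x - u (r (r2 (r3 i))) x) \<longlonglongrightarrow> 0"
    using AE_subseq_of_Lpow_tendsto[of "\<lambda>i x. \<phi> (r (r2 i)) x - u (r (r2 i)) x" "\<lambda>x. 0", OF d z] by blast
  have "AE x in M. (\<lambda>i. u (r (r2 (r3 i))) x) \<longlonglongrightarrow> w x"
    using wlim r3(2)
  proof eventually_elim
    case (elim x)
    have "(\<lambda>i. \<phi> (r (r2 (r3 i))) x) \<longlonglongrightarrow> w x"
      using LIMSEQ_subseq_LIMSEQ[OF elim(1) r3(1)] by (simp add: o_def)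
    from tendsto_diff[OF this elim(2)] show ?case by simp
  qed
  moreover have "strict_mono (\<lambda>i. r (r2 (r3 i)))"
    using r(1) r2(1) r3(1) by (auto simp: strict_mono_def)
  ultimately show ?thesis using wm by blast
qed

end

section \<open>Minimisers and their Euler--Lagrange equation\<close>

text \<open>The quotients are bounded uniformly in \<open>t\<close>, as differentiation under the integral demands. By convexity
  of \<open>t \<mapsto> |a + t b|\<^sup>p\<close>, the slope between 0 and \<open>t\<close> lies between the slopes for \<open>-1\<close> and \<open>1\<close>.\<close>

lemma norm_powr_quotient_bound:
  fixes a b :: "'a::real_normed_vector"
  assumes "1 < p" "0 < t" "t \<le> 1"
  shows "\<bar>(norm (a + t *\<^sub>R b) powr p - norm a powr p) / t\<bar> \<le> norm (a + b) powr p + norm (a - b) powr p + norm a powr p"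
proof -
  have "norm ((1 - t) *\<^sub>R a + t *\<^sub>R (a + b)) powr p \<le> (1 - t) * norm a powr p + t * norm (a + b) powr p"
    using assms by (intro norm_powr_convex) auto
  then have "norm (a + t *\<^sub>R b) powr p - norm a powr p \<le> t * (norm (a + b) powr p - norm a powr p)"
    by (simp add: algebra_simps)
  then have up: "(norm (a + t *\<^sub>R b) powr p - norm a powr p) / t \<le> norm (a + b) powr p - norm a powr p"
    using assms by (simp add: field_simps)
  \<comment> \<open>The weights \<open>1 - s\<close> and \<open>s\<close> write \<open>a\<close> as a convex combination of \<open>a + t b\<close> and \<open>a - b\<close>.\<close>
  define s where "s = t / (1 + t)"
  have s: "0 \<le> s" "s \<le> 1" "1 - s = 1 / (1 + t)" using assms by (auto simp: s_def field_simps)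
  have "(1 - s) *\<^sub>R (a + t *\<^sub>R b) + s *\<^sub>R (a - b) = a"
  proof -
    have "(1 - s) *\<^sub>R (a + t *\<^sub>R b) + s *\<^sub>R (a - b) = a + ((1 - s) * t - s) *\<^sub>R b"
      by (simp add: algebra_simps)
    also have "(1 - s) * t - s = 0" unfolding s(3) by (simp add: s_def)
    finally show ?thesis by simp
  qed
  then have "norm a powr p \<le> (1 - s) * norm (a + t *\<^sub>R b) powr p + s * norm (a - b) powr p"
    using norm_powr_convex[of p s "a + t *\<^sub>R b" "a - b"] assms s by simp
  also have "\<dots> = (norm (a + t *\<^sub>R b) powr p + t * norm (a - b) powr p) / (1 + t)"
    unfolding s(3) by (simp add: s_def add_divide_distrib)
  finally have "(1 + t) * norm a powr p \<le> norm (a + t *\<^sub>R b) powr p + t * norm (a - b) powr p"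
    using assms by (simp add: pos_le_divide_eq mult.commute)
  then have lo: "norm a powr p - norm (a - b) powr p \<le> (norm (a + t *\<^sub>R b) powr p - norm a powr p) / t"
    using assms by (simp add: field_simps)
  from up lo have "(norm (a + t *\<^sub>R b) powr p - norm a powr p) / t \<le> norm (a + b) powr p"
    "- (norm (a - b) powr p) \<le> (norm (a + t *\<^sub>R b) powr p - norm a powr p) / t"
    by (smt (verit) powr_ge_zero)+
  then show ?thesis
    unfolding abs_le_iff by (smt (verit) powr_ge_zero)
qed

text \<open>Off the origin, differentiate \<open>(x \<bullet> x)\<^sup>p\<^sup>/\<^sup>2\<close>; at the origin the quotient is \<open>t\<^sup>p\<^sup>-\<^sup>1 |b|\<^sup>p \<rightarrow> 0\<close> since \<open>p > 1\<close>.\<close>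

lemma norm_powr_quotient_tendsto:
  fixes a b :: "'a::real_inner" and t :: "nat \<Rightarrow> real"
  assumes "1 < p" "\<And>n. 0 < t n" "t \<longlonglongrightarrow> 0"
  shows "(\<lambda>n. (norm (a + t n *\<^sub>R b) powr p - norm a powr p) / t n) \<longlonglongrightarrow> p * ((norm a powr (p - 2) *\<^sub>R a) \<bullet> b)"
proof (cases "a = 0")
  case True
  have "(\<lambda>n. t n powr (p - 1) * norm b powr p) \<longlonglongrightarrow> 0 powr (p - 1) * norm b powr p"
    using assms by (intro tendsto_mult tendsto_powr2 tendsto_const) (auto intro!: always_eventually less_imp_le)
  moreover have "(norm (a + t n *\<^sub>R b) powr p - norm a powr p) / t n = t n powr (p - 1) * norm b powr p" for n
    using True assms(2)[of n] by (simp add: powr_mult powr_diff)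
  ultimately show ?thesis using True by simp
next
  case False
  have norm_eq: "norm x powr p = (x \<bullet> x) powr (p / 2)" for x :: 'a
  proof -
    have "x \<bullet> x = norm x powr 2" by (simp add: dot_square_norm)
    then show ?thesis by (simp only: powr_powr) simp
  qed
  have pos: "0 < a \<bullet> a" using False by simp
  have "((\<lambda>s. (a + s *\<^sub>R b) \<bullet> (a + s *\<^sub>R b)) has_real_derivative 2 * (a \<bullet> b)) (at 0)"
    by (auto intro!: derivative_eq_intros simp: inner_add_left inner_add_right inner_commute has_field_derivative_def fun_eq_iff)
  from DERIV_fun_powr[OF this, of "p / 2"] pos
  have "((\<lambda>s. ((a + s *\<^sub>R b) \<bullet> (a + s *\<^sub>R b)) powr (p / 2)) has_real_derivative
      p / 2 * (a \<bullet> a) powr (p / 2 - 1) * (2 * (a \<bullet> b))) (at 0)" by simp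
  moreover have "p / 2 * (a \<bullet> a) powr (p / 2 - 1) * (2 * (a \<bullet> b)) = p * ((norm a powr (p - 2) *\<^sub>R a) \<bullet> b)"
  proof -
    have "a \<bullet> a = norm a powr 2" by (simp add: dot_square_norm)
    then have "(a \<bullet> a) powr (p / 2 - 1) = norm a powr (2 * (p / 2 - 1))" by (simp only: powr_powr)
    also have "2 * (p / 2 - 1) = p - 2" by simp
    finally show ?thesis by simp
  qed
  ultimately have "((\<lambda>s. norm (a + s *\<^sub>R b) powr p) has_real_derivative p * ((norm a powr (p - 2) *\<^sub>R a) \<bullet> b)) (at 0)"
    unfolding norm_eq[of "a + _"] by metis
  then have "((\<lambda>h. (norm (a + (0 + h) *\<^sub>R b) powr p - norm (a + 0 *\<^sub>R b) powr p) / h) \<longlongrightarrow> p * ((norm a powr (p - 2) *\<^sub>R a) \<bullet> b)) (at 0)"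
    unfolding DERIV_def .
  moreover have "filterlim t (at 0) sequentially"
    unfolding filterlim_at using assms by (auto intro!: always_eventually simp: less_imp_neq[symmetric])
  ultimately have "(\<lambda>n. (norm (a + (0 + t n) *\<^sub>R b) powr p - norm (a + 0 *\<^sub>R b) powr p) / t n) \<longlonglongrightarrow> p * ((norm a powr (p - 2) *\<^sub>R a) \<bullet> b)"
    by (rule filterlim_compose)
  then show ?thesis by simp
qed

text \<open>The functional to be minimised has the potential \<open>\<Phi>\<close>. The decisive assumption is that \<open>\<Phi>\<close> does not
  decrease when its argument is clipped to \<open>[0, a]\<close>.\<close>

locale truncated_potential = lp_domain \<Omega> p for \<Omega> :: "'a::euclidean_space set" and p +
  fixes \<Phi> g :: "real \<Rightarrow> real" and K a lam :: real
  assumes potential_deriv: "\<And>s. (\<Phi> has_real_derivative g s) (at s)"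
    and g_cont: "continuous_on UNIV g"
    and g_bound: "\<And>s. \<bar>g s\<bar> \<le> K"
    and a_nonneg: "0 \<le> a"
    and potential_clip: "\<And>s. \<Phi> s \<le> \<Phi> (max 0 (min s a))"
    and lam_nonneg: "0 \<le> lam"
begin

lemma potential_Lipschitz: "\<bar>\<Phi> s - \<Phi> t\<bar> \<le> K * \<bar>s - t\<bar>"
  by (rule Lipschitz_of_deriv_bounded[OF potential_deriv g_bound])

lemma potential_borel [measurable]: "\<Phi> \<in> borel_measurable borel"
  using potential_deriv by (intro borel_measurable_continuous_onI) (auto intro!: continuous_at_imp_continuous_on DERIV_isCont)

lemma g_borel [measurable]: "g \<in> borel_measurable borel"
  by (rule borel_measurable_continuous_onI[OF g_cont])

lemma potential_integrable:
  assumes "u \<in> Lp p \<Omega>"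
  shows "integrable M (\<lambda>x. \<Phi> (u x))"
proof (rule Bochner_Integration.integrable_bound)
  note [measurable] = Lp_measurable[OF assms]
  show "integrable M (\<lambda>x. \<bar>\<Phi> 0\<bar> + K * \<bar>u x\<bar>)"
    using Lp_imp_integrable(1)[OF assms] by simp
  show "(\<lambda>x. \<Phi> (u x)) \<in> borel_measurable M" by measurable
  show "AE x in M. norm (\<Phi> (u x)) \<le> norm (\<bar>\<Phi> 0\<bar> + K * \<bar>u x\<bar>)"
  proof (rule AE_I2)
    fix x
    have "\<bar>\<Phi> (u x)\<bar> \<le> \<bar>\<Phi> 0\<bar> + \<bar>\<Phi> (u x) - \<Phi> 0\<bar>" by linarith
    with potential_Lipschitz[of "u x" 0] show "norm (\<Phi> (u x)) \<le> norm (\<bar>\<Phi> 0\<bar> + K * \<bar>u x\<bar>)"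
      by (simp add: abs_le_iff) linarith
  qed
qed

definition energy :: "('a \<Rightarrow> real) \<Rightarrow> ('a \<Rightarrow> 'a) \<Rightarrow> real" where
  "energy u G = Lpow p \<Omega> G / p - lam * (LINT x|M. \<Phi> (u x))"

lemma energy_clip:
  assumes "sob0 v H"
  shows "\<exists>H'. sob0 (\<lambda>x. max 0 (min (v x) a)) H' \<and> energy (\<lambda>x. max 0 (min (v x) a)) H' \<le> energy v H"
proof -
  obtain H' where H': "sob0 (\<lambda>x. max 0 (min (v x) a)) H'" "Lpow p \<Omega> H' \<le> Lpow p \<Omega> H"
    using sob0_clip[OF assms a_nonneg] by blast
  have "(LINT x|M. \<Phi> (v x)) \<le> (LINT x|M. \<Phi> (max 0 (min (v x) a)))"
    by (intro integral_mono potential_integrable sob0_Lp(1)[OF assms] sob0_Lp(1)[OF H'(1)] potential_clip)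
  then have "lam * (LINT x|M. \<Phi> (v x)) \<le> lam * (LINT x|M. \<Phi> (max 0 (min (v x) a)))"
    using lam_nonneg by (rule mult_left_mono)
  moreover have "Lpow p \<Omega> H' / p \<le> Lpow p \<Omega> H / p"
    using H'(2) p_gt_1 by (simp add: divide_right_mono)
  ultimately show ?thesis using H'(1) unfolding energy_def by (intro exI[of _ H']) linarith
qed

text \<open>Take a minimising sequence among the functions with values in \<open>[0, a]\<close>. Compactness and dominated
  convergence settle the potential, the weak closure lemma settles the gradients, and
  \<open>energy_clip\<close> extends minimality from these functions to the whole space.\<close>

lemma minimiser_exists:
  obtains u G where "sob0 u G" "\<And>x. 0 \<le> u x" "\<And>x. u x \<le> a" "\<And>v H. sob0 v H \<Longrightarrow> energy u G \<le> energy v H"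
proof -
  define E where "E = {energy u G | u G. sob0 u G \<and> (\<forall>x. 0 \<le> u x \<and> u x \<le> a)}"
  have E_ne: "E \<noteq> {}" unfolding E_def using sob0_zero a_nonneg by blast
  define B where "B = (\<bar>\<Phi> 0\<bar> + K * a) * measure M \<Omega>"
  have K0: "0 \<le> K" using g_bound[of 0] by linarith
  have \<Phi>_bound: "\<bar>\<Phi> s\<bar> \<le> \<bar>\<Phi> 0\<bar> + K * a" if "0 \<le> s" "s \<le> a" for s
  proof -
    have "\<bar>\<Phi> s - \<Phi> 0\<bar> \<le> K * a"
      using potential_Lipschitz[of s 0] mult_left_mono[OF that(2) K0] that(1) by simp
    then show ?thesis by linarith
  qed
  have potB: "(LINT x|M. \<Phi> (u x)) \<le> B" if "u \<in> Lp p \<Omega>" "\<And>x. 0 \<le> u x \<and> u x \<le> a" for u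
  proof -
    have "(LINT x|M. \<Phi> (u x)) \<le> (LINT x|M. \<bar>\<Phi> 0\<bar> + K * a)"
      using \<Phi>_bound that(2) by (intro integral_mono potential_integrable that(1)) (auto simp: abs_le_iff)
    then show ?thesis by (simp add: B_def mult.commute)
  qed
  have E_bdd: "bdd_below E"
  proof (rule bdd_belowI)
    fix y assume "y \<in> E"
    then obtain u G where u: "y = energy u G" "sob0 u G" "\<And>x. 0 \<le> u x \<and> u x \<le> a" by (auto simp: E_def)
    have "lam * (LINT x|M. \<Phi> (u x)) \<le> lam * B"
      using lam_nonneg potB[OF sob0_Lp(1)[OF u(2)] u(3)] by (intro mult_left_mono)
    moreover have "0 \<le> Lpow p \<Omega> G / p" using p_gt_1 Lpow_nonneg[of p \<Omega> G] by simp
    ultimately show "- (lam * B) \<le> y" unfolding u(1) energy_def by linarith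
  qed
  define m where "m = Inf E"
  have "\<exists>u G. sob0 u G \<and> (\<forall>x. 0 \<le> u x \<and> u x \<le> a) \<and> energy u G < m + inverse (real (Suc k))" for k
    using cInf_lessD[OF E_ne, of "m + inverse (real (Suc k))"] unfolding m_def E_def by auto
  then obtain u G where u: "\<And>k. sob0 (u k) (G k)" "\<And>k x. 0 \<le> u k x \<and> u k x \<le> a"
    "\<And>k. energy (u k) (G k) < m + inverse (real (Suc k))" by metis
  have LG: "Lpow p \<Omega> (G k) = p * (energy (u k) (G k) + lam * (LINT x|M. \<Phi> (u k x)))" for k
    using p_gt_1 by (simp add: energy_def)
  have GA: "Lpow p \<Omega> (G k) \<le> p * (m + 1 + lam * B)" for k
  proof -
    have "inverse (real (Suc k)) \<le> 1" by (simp add: divide_simps)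
    then have "energy (u k) (G k) \<le> m + 1" using u(3)[of k] by linarith
    moreover have "lam * (LINT x|M. \<Phi> (u k x)) \<le> lam * B"
      by (intro mult_left_mono potB sob0_Lp(1)[OF u(1)] u(2) lam_nonneg)
    ultimately show ?thesis unfolding LG using p_gt_1 by (intro mult_left_mono) auto
  qed
  have uB: "Lpow p \<Omega> (u k) \<le> a powr p * measure M \<Omega>" for k
  proof -
    have "Lpow p \<Omega> (u k) \<le> (LINT x|M. a powr p)"
      using u(2)[of k] p_gt_1 by (intro Lp_dominated(2)[OF Lp_measurable[OF sob0_Lp(1)[OF u(1)]]] AE_I2) (auto intro!: powr_mono2)
    then show ?thesis by (simp add: mult.commute)
  qed
  have "\<exists>r w. strict_mono (r :: nat \<Rightarrow> nat) \<and> w \<in> borel_measurable M \<and> (AE x in M. (\<lambda>i. u (r i) x) \<longlonglongrightarrow> w x)"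
    by (rule sob0_AE_compact[OF u(1) uB GA])
  then obtain r w0 where r: "strict_mono (r :: nat \<Rightarrow> nat)" "w0 \<in> borel_measurable M" "AE x in M. (\<lambda>i. u (r i) x) \<longlonglongrightarrow> w0 x"
    by (elim exE conjE)
  \<comment> \<open>The limit \<open>w0\<close> has values in \<open>[0, a]\<close> almost everywhere; clipping makes this hold everywhere.\<close>
  define w where "w x = max 0 (min (w0 x) a)" for x
  have w_bounds: "0 \<le> w x" "w x \<le> a" for x using a_nonneg by (auto simp: w_def)
  note [measurable] = r(2)
  have wm[measurable]: "w \<in> borel_measurable M" unfolding w_def by measurable
  have wL: "w \<in> Lp p \<Omega>" by (rule Lp_bounded[where C=a]) (use w_bounds in auto)
  have um[measurable]: "u k \<in> borel_measurable M" for k by (rule Lp_measurable[OF sob0_Lp(1)[OF u(1)]])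
  have lim: "AE x in M. (\<lambda>i. u (r i) x) \<longlonglongrightarrow> w x"
    using r(3)
  proof eventually_elim
    case (elim x)
    have "(\<lambda>i. max 0 (min (u (r i) x) a)) \<longlonglongrightarrow> w x"
      unfolding w_def by (intro tendsto_max tendsto_min tendsto_const elim)
    moreover have "max 0 (min (u (r i) x) a) = u (r i) x" for i using u(2)[of "r i" x] by auto
    ultimately show ?case by simp
  qed
  have uw: "(\<lambda>i. Lpow p \<Omega> (\<lambda>x. u (r i) x - w x)) \<longlonglongrightarrow> 0"
  proof -
    have "(\<lambda>i. LINT x|M. norm (u (r i) x - w x) powr p) \<longlonglongrightarrow> (LINT x|M. 0)"
    proof (rule integral_dominated_convergence[where w="\<lambda>x. a powr p"])
      show "AE x in M. (\<lambda>i. norm (u (r i) x - w x) powr p) \<longlonglongrightarrow> 0"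
        using lim
      proof eventually_elim
        case (elim x)
        then have "(\<lambda>i. norm (u (r i) x - w x)) \<longlonglongrightarrow> 0"
          by (intro tendsto_norm_zero) (simp add: LIM_zero_iff)
        then have "(\<lambda>i. norm (u (r i) x - w x) powr p) \<longlonglongrightarrow> 0 powr p"
          using p_gt_1 by (intro tendsto_powr2 tendsto_const) auto
        then show ?case by simp
      qed
      show "AE x in M. norm (norm (u (r i) x - w x) powr p) \<le> a powr p" for i
      proof (rule AE_I2)
        fix x
        have "\<bar>u (r i) x - w x\<bar> \<le> a" using u(2)[of "r i" x] w_bounds[of x] by (auto simp: abs_le_iff)
        then show "norm (norm (u (r i) x - w x) powr p) \<le> a powr p" using p_gt_1 by (simp add: powr_mono2)
      qed
    qed auto
    then show ?thesis by (simp add: Lpow_def)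
  qed
  have pot: "(\<lambda>i. LINT x|M. \<Phi> (u (r i) x)) \<longlonglongrightarrow> (LINT x|M. \<Phi> (w x))"
  proof (rule integral_dominated_convergence[where w="\<lambda>x. \<bar>\<Phi> 0\<bar> + K * a"])
    show "AE x in M. (\<lambda>i. \<Phi> (u (r i) x)) \<longlonglongrightarrow> \<Phi> (w x)"
      using lim
    proof eventually_elim
      case (elim x)
      show ?case by (rule isCont_tendsto_compose[OF DERIV_isCont[OF potential_deriv] elim])
    qed
    show "AE x in M. norm (\<Phi> (u (r i) x)) \<le> \<bar>\<Phi> 0\<bar> + K * a" for i
      using \<Phi>_bound u(2) by (intro AE_I2) simp
  qed auto
  \<comment> \<open>The gradient energy that would make the total energy of \<open>w\<close> equal to the infimum \<open>m\<close>.\<close>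
  define C where "C = p * (m + lam * (LINT x|M. \<Phi> (w x)))"
  have "\<forall>\<^sub>F i in sequentially. Lpow p \<Omega> (G (r i)) \<le> C + e" if e: "0 < e" for e
  proof -
    have "(\<lambda>i. inverse (real (Suc (r i)))) \<longlonglongrightarrow> 0"
      using LIMSEQ_subseq_LIMSEQ[OF LIMSEQ_inverse_real_of_nat r(1)] by (simp add: o_def)
    then have "(\<lambda>i. p * (m + inverse (real (Suc (r i))) + lam * (LINT x|M. \<Phi> (u (r i) x)))) \<longlonglongrightarrow> p * (m + 0 + lam * (LINT x|M. \<Phi> (w x)))"
      by (intro tendsto_intros pot)
    then have "\<forall>\<^sub>F i in sequentially. p * (m + inverse (real (Suc (r i))) + lam * (LINT x|M. \<Phi> (u (r i) x))) < C + e"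
      by (rule order_tendstoD) (use e in \<open>auto simp: C_def\<close>)
    then show ?thesis
    proof eventually_elim
      case (elim i)
      have "Lpow p \<Omega> (G (r i)) \<le> p * (m + inverse (real (Suc (r i))) + lam * (LINT x|M. \<Phi> (u (r i) x)))"
        unfolding LG using u(3)[of "r i"] p_gt_1 by (intro mult_left_mono) auto
      with elim show ?case by linarith
    qed
  qed
  from sob0_weak_closure[OF u(1) wL uw this]
  obtain H where H: "sob0 w H" "Lpow p \<Omega> H \<le> C" by blast
  have "energy w H \<le> m"
  proof -
    have "Lpow p \<Omega> H / p \<le> m + lam * (LINT x|M. \<Phi> (w x))"
      using H(2) p_gt_1 by (simp add: C_def divide_le_eq mult.commute)
    then show ?thesis by (simp add: energy_def)
  qed
  moreover have "m \<le> energy v H'" if v: "sob0 v H'" for v H'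
  proof -
    obtain H'' where H'': "sob0 (\<lambda>x. max 0 (min (v x) a)) H''" "energy (\<lambda>x. max 0 (min (v x) a)) H'' \<le> energy v H'"
      using energy_clip[OF v] by blast
    have "energy (\<lambda>x. max 0 (min (v x) a)) H'' \<in> E"
      unfolding E_def using H''(1) a_nonneg by fastforce
    then have "m \<le> energy (\<lambda>x. max 0 (min (v x) a)) H''" unfolding m_def by (rule cInf_lower[OF _ E_bdd])
    with H''(2) show ?thesis by linarith
  qed
  ultimately show ?thesis using that[OF H(1) w_bounds] by force
qed

text \<open>Minimality makes the difference quotients of the energy nonnegative; both parts of
  the energy converge under dominated difference quotients.\<close>

lemma first_variation_nonneg:
  assumes u: "sob0 u G" and min: "\<And>v H. sob0 v H \<Longrightarrow> energy u G \<le> energy v H" and \<phi>: "sob0 \<phi> H"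
  shows "0 \<le> (LINT x|M. (norm (G x) powr (p - 2) *\<^sub>R G x) \<bullet> H x) - lam * (LINT x|M. g (u x) * \<phi> x)"
proof -
  define t where "t n = inverse (real (Suc n))" for n
  have t: "0 < t n" "t n \<le> 1" for n by (auto simp: t_def divide_simps)
  have t0: "t \<longlonglongrightarrow> 0" unfolding t_def by (rule LIMSEQ_inverse_real_of_nat)
  note L = sob0_Lp[OF u] sob0_Lp[OF \<phi>]
  note [measurable] = Lp_measurable[OF L(1)] Lp_measurable[OF L(2)] Lp_measurable[OF L(3)] Lp_measurable[OF L(4)]
  have s: "sob0 (\<lambda>x. u x + t n * \<phi> x) (\<lambda>x. G x + t n *\<^sub>R H x)" for n
    by (intro sob0_add sob0_scale u \<phi>)
  have lim1: "(\<lambda>n. LINT x|M. (norm (G x + t n *\<^sub>R H x) powr p - norm (G x) powr p) / t n)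
      \<longlonglongrightarrow> (LINT x|M. p * ((norm (G x) powr (p - 2) *\<^sub>R G x) \<bullet> H x))"
  proof (rule integral_dominated_convergence[where
        w="\<lambda>x. norm (G x + H x) powr p + norm (G x - H x) powr p + norm (G x) powr p"])
    show "integrable M (\<lambda>x. norm (G x + H x) powr p + norm (G x - H x) powr p + norm (G x) powr p)"
      by (intro Bochner_Integration.integrable_add Lp_integrable Lp_add Lp_diff L)
    show "AE x in M. (\<lambda>n. (norm (G x + t n *\<^sub>R H x) powr p - norm (G x) powr p) / t n)
        \<longlonglongrightarrow> p * ((norm (G x) powr (p - 2) *\<^sub>R G x) \<bullet> H x)"
      by (intro AE_I2 norm_powr_quotient_tendsto p_gt_1 t t0)
    show "AE x in M. norm ((norm (G x + t n *\<^sub>R H x) powr p - norm (G x) powr p) / t n)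
        \<le> norm (G x + H x) powr p + norm (G x - H x) powr p + norm (G x) powr p" for n
      unfolding real_norm_def by (intro AE_I2 norm_powr_quotient_bound p_gt_1 t)
  qed measurable
  have lim2: "(\<lambda>n. LINT x|M. (\<Phi> (u x + t n * \<phi> x) - \<Phi> (u x)) / t n) \<longlonglongrightarrow> (LINT x|M. g (u x) * \<phi> x)"
  proof (rule integral_dominated_convergence[where w="\<lambda>x. K * \<bar>\<phi> x\<bar>"])
    show "integrable M (\<lambda>x. K * \<bar>\<phi> x\<bar>)" using Lp_imp_integrable(1)[OF L(3)] by simp
    show "AE x in M. (\<lambda>n. (\<Phi> (u x + t n * \<phi> x) - \<Phi> (u x)) / t n) \<longlonglongrightarrow> g (u x) * \<phi> x"
    proof (rule AE_I2)
      fix x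
      have "((\<lambda>s. u x + s * \<phi> x) has_real_derivative \<phi> x) (at 0)" by (auto intro!: derivative_eq_intros)
      moreover have "(\<Phi> has_real_derivative g (u x)) (at (u x + 0 * \<phi> x))" using potential_deriv[of "u x"] by simp
      ultimately have "((\<lambda>s. \<Phi> (u x + s * \<phi> x)) has_real_derivative g (u x) * \<phi> x) (at 0)"
        by (intro DERIV_chain2[where f=\<Phi> and g="\<lambda>s. u x + s * \<phi> x"])
      then have "((\<lambda>h. (\<Phi> (u x + (0 + h) * \<phi> x) - \<Phi> (u x + 0 * \<phi> x)) / h) \<longlongrightarrow> g (u x) * \<phi> x) (at 0)"
        unfolding DERIV_def .
      moreover have "filterlim t (at 0) sequentially"
        unfolding filterlim_at using t t0 by (auto intro!: always_eventually simp: less_imp_neq[symmetric])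
      ultimately have "(\<lambda>n. (\<Phi> (u x + (0 + t n) * \<phi> x) - \<Phi> (u x + 0 * \<phi> x)) / t n) \<longlonglongrightarrow> g (u x) * \<phi> x"
        by (rule filterlim_compose)
      then show "(\<lambda>n. (\<Phi> (u x + t n * \<phi> x) - \<Phi> (u x)) / t n) \<longlonglongrightarrow> g (u x) * \<phi> x" by simp
    qed
    show "AE x in M. norm ((\<Phi> (u x + t n * \<phi> x) - \<Phi> (u x)) / t n) \<le> K * \<bar>\<phi> x\<bar>" for n
    proof (rule AE_I2)
      fix x
      have "\<bar>\<Phi> (u x + t n * \<phi> x) - \<Phi> (u x)\<bar> \<le> K * (t n * \<bar>\<phi> x\<bar>)"
        using potential_Lipschitz[of "u x + t n * \<phi> x" "u x"] t(1)[of n] by (simp add: abs_mult)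
      then show "norm ((\<Phi> (u x + t n * \<phi> x) - \<Phi> (u x)) / t n) \<le> K * \<bar>\<phi> x\<bar>"
        using t(1)[of n] by (simp add: abs_divide field_simps)
    qed
  qed measurable
  have "0 \<le> (LINT x|M. (norm (G x + t n *\<^sub>R H x) powr p - norm (G x) powr p) / t n) / p
      - lam * (LINT x|M. (\<Phi> (u x + t n * \<phi> x) - \<Phi> (u x)) / t n)" for n
  proof -
    note Ls = sob0_Lp[OF s[of n]]
    have 1: "(LINT x|M. (norm (G x + t n *\<^sub>R H x) powr p - norm (G x) powr p) / t n)
        = (Lpow p \<Omega> (\<lambda>x. G x + t n *\<^sub>R H x) - Lpow p \<Omega> G) / t n"
      unfolding Lpow_def using Lp_integrable[OF Ls(2)] Lp_integrable[OF L(2)] by simp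
    have 2: "(LINT x|M. (\<Phi> (u x + t n * \<phi> x) - \<Phi> (u x)) / t n)
        = ((LINT x|M. \<Phi> (u x + t n * \<phi> x)) - (LINT x|M. \<Phi> (u x))) / t n"
      using potential_integrable[OF Ls(1)] potential_integrable[OF L(1)] by simp
    have "0 \<le> (energy (\<lambda>x. u x + t n * \<phi> x) (\<lambda>x. G x + t n *\<^sub>R H x) - energy u G) / t n"
      using min[OF s[of n]] t(1)[of n] by simp
    also have "\<dots> = (LINT x|M. (norm (G x + t n *\<^sub>R H x) powr p - norm (G x) powr p) / t n) / p
      - lam * (LINT x|M. (\<Phi> (u x + t n * \<phi> x) - \<Phi> (u x)) / t n)"
      unfolding 1 2 energy_def using p_gt_1 t(1)[of n] by (simp add: field_simps)
    finally show ?thesis .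
  qed
  moreover have "(\<lambda>n. (LINT x|M. (norm (G x + t n *\<^sub>R H x) powr p - norm (G x) powr p) / t n) / p
      - lam * (LINT x|M. (\<Phi> (u x + t n * \<phi> x) - \<Phi> (u x)) / t n))
      \<longlonglongrightarrow> (LINT x|M. p * ((norm (G x) powr (p - 2) *\<^sub>R G x) \<bullet> H x)) / p - lam * (LINT x|M. g (u x) * \<phi> x)"
    using p_gt_1 by (intro tendsto_intros lim1 lim2) auto
  ultimately have "0 \<le> (LINT x|M. p * ((norm (G x) powr (p - 2) *\<^sub>R G x) \<bullet> H x)) / p - lam * (LINT x|M. g (u x) * \<phi> x)"
    by (intro LIMSEQ_le_const) auto
  then show ?thesis using p_gt_1 by simp
qed

text \<open>The first variation is linear in the direction, so applying its sign to \<open>\<phi>\<close> and to \<open>- \<phi>\<close> gives equality.\<close>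

lemma Euler_Lagrange:
  assumes "sob0 u G" "\<And>v H. sob0 v H \<Longrightarrow> energy u G \<le> energy v H" "sob0 \<phi> H"
  shows "(LINT x|M. (norm (G x) powr (p - 2) *\<^sub>R G x) \<bullet> H x) = lam * (LINT x|M. g (u x) * \<phi> x)"
proof -
  have "sob0 (\<lambda>x. - \<phi> x) (\<lambda>x. - H x)" using sob0_scale[OF assms(3), of "-1"] by simp
  from first_variation_nonneg[OF assms(1,2) this] first_variation_nonneg[OF assms]
  show ?thesis by simp
qed

end

section \<open>Solutions of the truncated problems\<close>

lemma antiderivative_exists:
  fixes g :: "real \<Rightarrow> real"
  assumes g: "continuous_on UNIV g"
  shows "\<exists>\<Phi>. (\<forall>s. (\<Phi> has_real_derivative g s) (at s)) \<and> (\<forall>s\<ge>0. \<Phi> s = integral {0..s} g)"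
proof -
  define \<Phi> where "\<Phi> s = integral {0..s} g - integral {s..0} g" for s
  have int: "g integrable_on {a..b}" for a b
    by (rule integrable_continuous_real[OF continuous_on_subset[OF g]]) simp
  have pos: "\<Phi> s = integral {0..s} g" if "0 \<le> s" for s
    using that by (cases "s = 0") (auto simp: \<Phi>_def)
  have neg: "\<Phi> s = - integral {s..0} g" if "s \<le> 0" for s
    using that by (cases "s = 0") (auto simp: \<Phi>_def)
  have "(\<Phi> has_real_derivative g s) (at s)" for s
  proof -
    define R where "R = \<bar>s\<bar> + 1"
    have R: "0 < R" "- R < s" "s < R" by (auto simp: R_def)
    have eq: "integral {- R..u} g - integral {- R..0} g = \<Phi> u" if "- R < u" for u
    proof (cases "0 \<le> u")
      case True
      with pos Henstock_Kurzweil_Integration.integral_combine[OF _ True int, of "- R"] R show ?thesis by force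
    next
      case False
      with neg[of u] Henstock_Kurzweil_Integration.integral_combine[OF _ _ int, of "- R" u 0] that show ?thesis by force
    qed
    have "((\<lambda>u. integral {- R..u} g) has_vector_derivative g s) (at s within {- R..R})"
      by (rule integral_has_vector_derivative[OF continuous_on_subset[OF g]]) (use R in auto)
    then have "((\<lambda>u. integral {- R..u} g) has_real_derivative g s) (at s)"
      using R by (simp add: at_within_Icc_at has_real_derivative_iff_has_vector_derivative)
    then have "((\<lambda>u. integral {- R..u} g - integral {- R..0} g) has_real_derivative g s) (at s)"
      by (auto intro!: derivative_eq_intros)
    then show ?thesis
      by (rule has_field_derivative_transform_within_open[of _ _ _ "{- R<..}"]) (use R eq in auto)
  qed
  with pos show ?thesis by blast
qed

lemma primitive_borel:
  fixes f :: "real \<Rightarrow> real"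
  assumes "continuous_on UNIV f"
  shows "continuous_on UNIV (\<lambda>s. integral {0..s} f)" "(\<lambda>s. integral {0..s} f) \<in> borel_measurable borel"
proof -
  obtain \<Phi> where \<Phi>: "\<And>s. (\<Phi> has_real_derivative f s) (at s)" "\<And>s. 0 \<le> s \<Longrightarrow> \<Phi> s = integral {0..s} f"
    using antiderivative_exists[OF assms] by blast
  have "integral {0..s} f = \<Phi> (max 0 s)" for s
    using \<Phi>(2)[of "max 0 s"] \<Phi>(2)[of 0] by (cases "0 \<le> s") auto
  moreover have "continuous_on UNIV \<Phi>"
    using \<Phi>(1) by (auto intro!: continuous_at_imp_continuous_on DERIV_isCont)
  then have "continuous_on UNIV (\<lambda>s. \<Phi> (max 0 s))"
    by (rule continuous_on_compose2) (auto intro!: continuous_intros)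
  ultimately show c: "continuous_on UNIV (\<lambda>s. integral {0..s} f)" by simp
  then show "(\<lambda>s. integral {0..s} f) \<in> borel_measurable borel" by (rule borel_measurable_continuous_onI)
qed

context lp_domain
begin

lemma primitive_bounded_integrable:
  fixes f :: "real \<Rightarrow> real"
  assumes f: "continuous_on UNIV f" and v: "v \<in> borel_measurable M" "\<And>x. 0 \<le> v x \<and> v x \<le> s"
  shows "integrable M (\<lambda>x. integral {0..v x} f)"
proof -
  have "compact ((\<lambda>s. integral {0..s} f) ` {0..s})"
    by (intro compact_continuous_image continuous_on_subset[OF primitive_borel(1)[OF f]]) auto
  then obtain C where C: "\<And>t. 0 \<le> t \<Longrightarrow> t \<le> s \<Longrightarrow> \<bar>integral {0..t} f\<bar> \<le> C"
    using compact_imp_bounded by (fastforce simp: bounded_iff)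
  have "(\<lambda>x. integral {0..v x} f) \<in> borel_measurable M"
    by (rule measurable_compose[OF v(1) primitive_borel(2)[OF f]])
  then show ?thesis
    by (intro integrable_const_bound[where B=C] AE_I2) (use C v(2) in auto)
qed

text \<open>The truncated nonlinearity is \<open>g(s) = f(max(0, min(s, a)))\<close>. Its antiderivative increases up to 0
  because \<open>f(0) \<ge> 0\<close> and is constant beyond \<open>a\<close> because \<open>f(a) = 0\<close>, so the minimiser with values in \<open>[0, a]\<close>
  exists; there \<open>g\<close> and \<open>f\<close> agree. The minimality is recorded for comparison with plateau functions.\<close>

lemma truncated_solution:
  fixes f :: "real \<Rightarrow> real"
  assumes f: "continuous_on UNIV f" and f0: "0 \<le> f 0" and a: "0 < a" "f a = 0" and lam: "0 \<le> lam"
  shows "\<exists>u G. bounded_solution p \<Omega> lam f u \<and> sob0 u G \<and> (\<forall>x. 0 \<le> u x \<and> u x \<le> a) \<and>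
    (\<forall>v H. sob0 v H \<longrightarrow> (\<forall>x. 0 \<le> v x \<and> v x \<le> a) \<longrightarrow>
       Lpow p \<Omega> G / p - lam * (LINT x|M. integral {0..u x} f) \<le> Lpow p \<Omega> H / p - lam * (LINT x|M. integral {0..v x} f))"
proof -
  define g where "g s = f (max 0 (min s a))" for s
  have g: "continuous_on UNIV g"
    unfolding g_def by (intro continuous_on_compose2[OF f] continuous_intros) auto
  obtain \<Phi> where \<Phi>: "\<And>s. (\<Phi> has_real_derivative g s) (at s)" "\<And>s. 0 \<le> s \<Longrightarrow> \<Phi> s = integral {0..s} g"
    using antiderivative_exists[OF g] by blast
  have \<Phi>F: "\<Phi> s = integral {0..s} f" if "0 \<le> s" "s \<le> a" for s
    using \<Phi>(2)[OF that(1)] that by (auto simp: g_def intro!: integral_cong)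
  have "compact (f ` {0..a})"
    by (intro compact_continuous_image continuous_on_subset[OF f]) auto
  then obtain K where K: "\<And>s. 0 \<le> s \<Longrightarrow> s \<le> a \<Longrightarrow> \<bar>f s\<bar> \<le> K"
    using compact_imp_bounded by (fastforce simp: bounded_iff)
  have clip: "\<Phi> s \<le> \<Phi> (max 0 (min s a))" for s
  proof -
    consider "s < 0" | "0 \<le> s" "s \<le> a" | "a < s" by linarith
    then show ?thesis
    proof cases
      case 1
      obtain z where z: "s < z" "z < 0" "\<Phi> 0 - \<Phi> s = (0 - s) * g z" using MVT2[OF 1 \<Phi>(1)] by blast
      then have "0 \<le> \<Phi> 0 - \<Phi> s" using f0 a 1 by (simp add: g_def mult_nonpos_nonneg)
      with 1 a show ?thesis by simp
    next
      case 3
      obtain z where z: "a < z" "z < s" "\<Phi> s - \<Phi> a = (s - a) * g z" using MVT2[OF 3 \<Phi>(1)] by blast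
      then have "\<Phi> s = \<Phi> a" using a by (simp add: g_def)
      with 3 a show ?thesis by simp
    qed (use a in auto)
  qed
  interpret truncated_potential \<Omega> p \<Phi> g K a lam
    by unfold_locales (use \<Phi>(1) g K a clip lam in \<open>auto simp: g_def\<close>)
  obtain u G where u: "sob0 u G" "\<And>x. 0 \<le> u x" "\<And>x. u x \<le> a" "\<And>v H. sob0 v H \<Longrightarrow> energy u G \<le> energy v H"
    using minimiser_exists by blast
  define Gu where "Gu = weak_gradient \<Omega> u"
  have Gu: "sob0 u Gu" using sob0_weak_gradient(1)[OF u(1)] by (simp add: Gu_def)
  have "Lpow p \<Omega> Gu = Lpow p \<Omega> G"
    using Lp_AE_cong(2)[OF sob0_Lp(2)[OF u(1)] sob0_weak_gradient(2)[OF u(1)]] by (simp add: Gu_def)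
  then have min: "energy u Gu \<le> energy v H" if "sob0 v H" for v H
    using u(4)[OF that] by (simp add: energy_def)
  have uLinf: "u \<in> Linf \<Omega>"
  proof -
    have [measurable]: "u \<in> borel_measurable M" by (rule Lp_measurable[OF sob0_Lp(1)[OF u(1)]])
    have "Linf_norm \<Omega> u \<le> ereal a" unfolding Linf_norm_def
      using u(2,3) by (intro esssup_I AE_I2) auto
    then show ?thesis by (auto simp: Linf_def)
  qed
  have "bounded_solution p \<Omega> lam f u"
    unfolding bounded_solution_def
  proof (intro conjI ballI IntI uLinf)
    show "u \<in> W1p_0 p \<Omega>" using u(1) W1p_0_iff_sob0 by blast
    fix \<phi> assume "\<phi> \<in> W1p_0 p \<Omega> \<inter> Linf \<Omega>"
    then obtain H where "sob0 \<phi> H" using W1p_0_iff_sob0 by blast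
    from Euler_Lagrange[OF Gu min sob0_weak_gradient(1)[OF this]]
    have "(LINT x|M. (norm (Gu x) powr (p - 2) *\<^sub>R Gu x) \<bullet> weak_gradient \<Omega> \<phi> x) = lam * (LINT x|M. g (u x) * \<phi> x)" .
    moreover have "g (u x) = f (u x)" for x using u(2,3)[of x] by (simp add: g_def)
    ultimately show "(LINT x|lebesgue_on \<Omega>. (norm (weak_gradient \<Omega> u x) powr (p - 2) *\<^sub>R weak_gradient \<Omega> u x) \<bullet> weak_gradient \<Omega> \<phi> x)
        = lam * (LINT x|lebesgue_on \<Omega>. f (u x) * \<phi> x)" by (simp add: Gu_def)
  qed
  moreover have "Lpow p \<Omega> G / p - lam * (LINT x|M. integral {0..u x} f) \<le> Lpow p \<Omega> H / p - lam * (LINT x|M. integral {0..v x} f)"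
    if v: "sob0 v H" "\<forall>x. 0 \<le> v x \<and> v x \<le> a" for v H
  proof -
    have "\<Phi> (u x) = integral {0..u x} f" "\<Phi> (v x) = integral {0..v x} f" for x
      using \<Phi>F u(2,3) v(2) by auto
    with u(4)[OF v(1)] show ?thesis by (simp add: energy_def)
  qed
  ultimately show ?thesis using u by blast
qed

section \<open>Plateau functions and their energy\<close>

definition plateau :: "('a \<Rightarrow> real) \<Rightarrow> ('a \<Rightarrow> 'a) \<Rightarrow> 'a set \<Rightarrow> 'a set \<Rightarrow> bool" where
  "plateau w H B K \<longleftrightarrow> sob0 w H \<and> (\<forall>x. 0 \<le> w x \<and> w x \<le> 1) \<and> B \<in> sets M \<and> K \<in> sets M \<and> K \<subseteq> B \<and>
     (\<forall>x\<in>K. w x = 1) \<and> (\<forall>x. x \<notin> B \<longrightarrow> w x = 0)"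

text \<open>Twice a box bump, cut off at 1, equals 1 where the bump is at least \<open>1 / 2\<close>. The bumps tend to the
  indicator of the box, so that set exhausts the box up to small measure.\<close>

lemma plateau_exists:
  assumes "\<Omega> \<noteq> {}" "0 < \<delta>"
  shows "\<exists>w H B K. plateau w H B K \<and> 0 < measure M B \<and> measure M (B - K) \<le> \<delta> * measure M B"
proof -
  obtain x0 where "x0 \<in> \<Omega>" using assms(1) by blast
  then obtain a c where ac: "cbox a c \<subseteq> \<Omega>" "x0 \<in> box a c" "\<forall>i\<in>Basis. a \<bullet> i < c \<bullet> i"
    using open_contains_cbox[OF open_domain] by metis
  define B where "B = box a c"
  define K where "K n = {x \<in> B. 1/2 \<le> box_bump n a c x}" for n
  have B\<Omega>: "B \<subseteq> \<Omega>" using ac(1) box_subset_cbox by (auto simp: B_def)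
  have setsM: "A \<in> sets M" if "A \<in> sets borel" "A \<subseteq> \<Omega>" for A
    using that by (auto simp: sets_restrict_space_iff)
  have [measurable]: "box_bump n a c \<in> borel_measurable borel" for n
    using test_function_borel[OF test_function_box_bump[OF order_refl]] .
  have Bs[measurable]: "B \<in> sets M" by (rule setsM) (use B\<Omega> in \<open>auto simp: B_def\<close>)
  have Ks[measurable]: "K n \<in> sets M" for n
  proof (rule setsM)
    have "K n = B \<inter> {x \<in> space borel. 1/2 \<le> box_bump n a c x}" by (auto simp: K_def)
    also have "\<dots> \<in> sets borel" by (simp add: B_def)
    finally show "K n \<in> sets borel" .
  qed (use B\<Omega> in \<open>auto simp: K_def\<close>)
  have "measure M B = measure lebesgue B"
    using B\<Omega> by (intro measure_restrict_space) auto
  also have "\<dots> = (\<Prod>b\<in>Basis. (c - a) \<bullet> b)"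
    using ac(3) by (simp add: B_def measure_lborel_box_eq less_imp_le)
  also have "\<dots> > 0" using ac(3) by (intro prod_pos) (simp add: inner_diff_left)
  finally have Bpos: "0 < measure M B" .
  have "(\<lambda>n. LINT x|M. indicator (B - K n) x) \<longlonglongrightarrow> (LINT x|M. (0::real))"
  proof (rule integral_dominated_convergence[where w="\<lambda>x. 1"])
    show "AE x in M. (\<lambda>n. indicator (B - K n) x :: real) \<longlonglongrightarrow> 0"
    proof (rule AE_I2)
      fix x
      show "(\<lambda>n. indicator (B - K n) x :: real) \<longlonglongrightarrow> 0"
      proof (cases "x \<in> B")
        case True
        then have "(\<lambda>n. box_bump n a c x) \<longlonglongrightarrow> 1" using box_bump_tendsto[of a c x] by (simp add: B_def)
        then have "\<forall>\<^sub>F n in sequentially. 1/2 < box_bump n a c x" by (rule order_tendstoD) simp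
        then have "\<forall>\<^sub>F n in sequentially. indicator (B - K n) x = (0::real)"
          by eventually_elim (use True in \<open>auto simp: K_def\<close>)
        then show ?thesis by (rule tendsto_eventually)
      qed simp
    qed
  qed (auto simp: indicator_def)
  then have "(\<lambda>n. measure M (B - K n)) \<longlonglongrightarrow> 0"
    using Int_absorb2[of "B - K _" \<Omega>] B\<Omega> by (simp add: Diff_subset subset_trans[of _ B \<Omega>])
  then have "\<forall>\<^sub>F n in sequentially. measure M (B - K n) < \<delta> * measure M B"
    by (rule order_tendstoD) (use Bpos assms(2) in simp)
  then obtain n where n: "measure M (B - K n) < \<delta> * measure M B" by (auto simp: eventually_sequentially)
  have "sob0 (\<lambda>x. 2 * box_bump n a c x) (\<lambda>x. 2 *\<^sub>R grad (box_bump n a c) x)"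
    by (intro sob0_scale sob0_test_function test_function_box_bump ac)
  from sob0_clip[OF this, of 1]
  obtain H where H: "sob0 (\<lambda>x. max 0 (min (2 * box_bump n a c x) 1)) H" by auto
  have "plateau (\<lambda>x. max 0 (min (2 * box_bump n a c x) 1)) H B (K n)"
    unfolding plateau_def
  proof (intro conjI H Bs Ks)
    show "\<forall>x\<in>K n. max 0 (min (2 * box_bump n a c x) 1) = 1" by (auto simp: K_def)
    show "\<forall>x. x \<notin> B \<longrightarrow> max 0 (min (2 * box_bump n a c x) 1) = 0"
      by (simp add: B_def box_bump_eq_0_iff[THEN iffD2])
  qed (auto simp: K_def)
  with Bpos n show ?thesis by (intro exI conjI) (assumption, assumption, rule less_imp_le)
qed

text \<open>Integrate the pointwise bounds \<open>F(s w) = F(s) \<ge> c s\<^sup>p\<close> on \<open>K\<close>, \<open>F(s w) \<ge> - C s\<^sup>p - D\<close> on \<open>B - K\<close>, and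
  \<open>F(s w) = F(0) = 0\<close> off \<open>B\<close>.\<close>

lemma plateau_energy:
  fixes f :: "real \<Rightarrow> real"
  assumes pl: "plateau w H B K" and f: "continuous_on UNIV f" and s: "0 < s" and lam: "0 \<le> lam"
    and C: "0 \<le> C" "\<And>t. 0 \<le> t \<Longrightarrow> t \<le> s \<Longrightarrow> - (C * t powr p + D) \<le> integral {0..t} f"
    and c: "c * s powr p \<le> integral {0..s} f"
  shows "sob0 (\<lambda>x. s * w x) (\<lambda>x. s *\<^sub>R H x)"
    "Lpow p \<Omega> (\<lambda>x. s *\<^sub>R H x) / p - lam * (LINT x|M. integral {0..s * w x} f)
      \<le> s powr p * (Lpow p \<Omega> H / p - lam * (c * measure M K - C * measure M (B - K))) + lam * D * measure M (B - K)"
proof -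
  have w: "sob0 w H" "\<And>x. 0 \<le> w x" "\<And>x. w x \<le> 1" "K \<subseteq> B" "\<And>x. x \<in> K \<Longrightarrow> w x = 1" "\<And>x. x \<notin> B \<Longrightarrow> w x = 0"
    and [measurable]: "B \<in> sets M" "K \<in> sets M"
    using pl by (auto simp: plateau_def)
  show sw: "sob0 (\<lambda>x. s * w x) (\<lambda>x. s *\<^sub>R H x)" by (rule sob0_scale[OF w(1)])
  have bounds: "0 \<le> s * w x \<and> s * w x \<le> s" for x using w(2,3)[of x] s by (simp add: mult_left_le)
  have B\<Omega>: "B \<subseteq> \<Omega>" "K \<subseteq> \<Omega>" using sets.sets_into_space[of B M] w(4) by auto
  have i: "integrable M (\<lambda>x. y * indicator A x :: real)" if "A \<in> sets M" for y A
    using that by (intro integrable_mult_right integrable_real_indicator) (auto simp: emeasure_eq_measure)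
  note i = i[of K "c * s powr p", OF \<open>K \<in> sets M\<close>] i[of "B - K" "C * s powr p + D", OF sets.Diff[OF \<open>B \<in> sets M\<close> \<open>K \<in> sets M\<close>]]
  have "c * s powr p * measure M K - (C * s powr p + D) * measure M (B - K)
      = (LINT x|M. c * s powr p * indicator K x - (C * s powr p + D) * indicator (B - K) x)"
  proof -
    have "K \<inter> \<Omega> = K" "(B - K) \<inter> \<Omega> = B - K" using B\<Omega> by auto
    then show ?thesis by (subst Bochner_Integration.integral_diff[OF i]) simp
  qed
  also have "\<dots> \<le> (LINT x|M. integral {0..s * w x} f)"
  proof (rule integral_mono)
    show "integrable M (\<lambda>x. c * s powr p * indicator K x - (C * s powr p + D) * indicator (B - K) x)"
      by (rule Bochner_Integration.integrable_diff[OF i])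
    show "integrable M (\<lambda>x. integral {0..s * w x} f)"
      by (rule primitive_bounded_integrable[OF f Lp_measurable[OF sob0_Lp(1)[OF sw]] bounds])
    fix x
    consider "x \<in> K" | "x \<in> B - K" | "x \<notin> B" by blast
    then show "c * s powr p * indicator K x - (C * s powr p + D) * indicator (B - K) x \<le> integral {0..s * w x} f"
    proof cases
      case 1
      then show ?thesis using c w(5) by simp
    next
      case 2
      have "(s * w x) powr p \<le> s powr p" using bounds[of x] p_gt_1 by (intro powr_mono2) auto
      then have "C * (s * w x) powr p \<le> C * s powr p" by (rule mult_left_mono[OF _ C(1)])
      with C(2)[of "s * w x"] bounds[of x] 2 show ?thesis by simp
    next
      case 3
      then have "x \<notin> K" using w(4) by auto
      with 3 show ?thesis using w(6) by simp
    qed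
  qed
  finally have "lam * (c * s powr p * measure M K - (C * s powr p + D) * measure M (B - K)) \<le> lam * (LINT x|M. integral {0..s * w x} f)"
    by (rule mult_left_mono[OF _ lam])
  moreover have "Lpow p \<Omega> (\<lambda>x. s *\<^sub>R H x) = s powr p * Lpow p \<Omega> H"
    using Lp_scaleR(2)[OF sob0_Lp(2)[OF w(1)], of s] s by simp
  ultimately show "Lpow p \<Omega> (\<lambda>x. s *\<^sub>R H x) / p - lam * (LINT x|M. integral {0..s * w x} f)
      \<le> s powr p * (Lpow p \<Omega> H / p - lam * (c * measure M K - C * measure M (B - K))) + lam * D * measure M (B - K)"
    by (simp add: algebra_simps)
qed

section \<open>Solutions of small and of large norm\<close>

lemma Linf_norm_le:
  assumes "u \<in> borel_measurable M" "\<And>x. \<bar>u x\<bar> \<le> c"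
  shows "Linf_norm \<Omega> u \<le> ereal c"
  unfolding Linf_norm_def using assms by (intro esssup_I AE_I2) auto

lemma AE_le_of_Linf_norm_le:
  assumes "Linf_norm \<Omega> u \<le> ereal c"
  shows "AE x in M. \<bar>u x\<bar> \<le> c"
  using esssup_AE[of "\<lambda>x. ereal \<bar>u x\<bar>" M]
proof eventually_elim
  case (elim x)
  then have "ereal \<bar>u x\<bar> \<le> ereal c" using assms unfolding Linf_norm_def by (rule order_trans)
  then show ?case by simp
qed

text \<open>For each \<open>n\<close> there is \<open>s < \<alpha>\<^sub>n\<close> for which the plateau function \<open>s w\<close> has negative energy, so the
  minimiser below \<open>\<alpha>\<^sub>n\<close> is not zero.\<close>

lemma small_solutions:
  fixes f :: "real \<Rightarrow> real"
  assumes f: "continuous_on UNIV f" "0 \<le> f 0" and lam: "0 \<le> lam"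
    and pl: "plateau w H B K" and gap: "Lpow p \<Omega> H / p < lam * (c * measure M K - C * measure M (B - K))"
    and C: "0 \<le> C" "\<forall>\<^sub>F t in at_right 0. - (C * t powr p) \<le> integral {0..t} f"
    and c: "\<exists>\<^sub>F t in at_right 0. c * t powr p \<le> integral {0..t} f"
    and \<alpha>: "\<And>n::nat. 0 < \<alpha> n" "\<And>n. f (\<alpha> n) = 0" "\<alpha> \<longlonglongrightarrow> 0"
  shows "\<exists>u :: nat \<Rightarrow> 'a \<Rightarrow> real. (\<forall>n. bounded_solution p \<Omega> lam f (u n) \<and> (AE x in M. 0 \<le> u n x) \<and>
      \<not> (AE x in M. u n x = 0)) \<and> (\<lambda>n. Linf_norm \<Omega> (u n)) \<longlonglongrightarrow> 0"
proof -
  obtain t1 where t1: "0 < t1" "\<And>t. 0 < t \<Longrightarrow> t < t1 \<Longrightarrow> - (C * t powr p) \<le> integral {0..t} f"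
    using C(2) by (auto simp: eventually_at_right_field)
  have "\<exists>u. bounded_solution p \<Omega> lam f u \<and> (\<forall>x. 0 \<le> u x \<and> u x \<le> \<alpha> n) \<and> u \<in> borel_measurable M \<and> \<not> (AE x in M. u x = 0)" for n
  proof -
    obtain u G where u: "bounded_solution p \<Omega> lam f u" "sob0 u G" "\<And>x. 0 \<le> u x \<and> u x \<le> \<alpha> n"
      "\<And>v H. sob0 v H \<Longrightarrow> (\<forall>x. 0 \<le> v x \<and> v x \<le> \<alpha> n) \<Longrightarrow>
        Lpow p \<Omega> G / p - lam * (LINT x|M. integral {0..u x} f) \<le> Lpow p \<Omega> H / p - lam * (LINT x|M. integral {0..v x} f)"
      using truncated_solution[OF f \<alpha>(1)[of n] \<alpha>(2)[of n] lam] by blast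
    have "\<forall>\<^sub>F t in at_right 0. 0 < t \<and> t < min t1 (\<alpha> n)"
      using t1(1) \<alpha>(1)[of n] by (auto simp: eventually_at_right_field intro!: exI[of _ "min t1 (\<alpha> n)"])
    from frequently_eventually_conj[OF c this]
    obtain s where s: "c * s powr p \<le> integral {0..s} f" "0 < s" "s < t1" "s < \<alpha> n"
      using frequently_ex by fastforce
    have low: "- (C * t powr p + 0) \<le> integral {0..t} f" if "0 \<le> t" "t \<le> s" for t
      using t1(2)[of t] that s(3) by (cases "t = 0") auto
    note e = plateau_energy[OF pl f(1) s(2) lam C(1) low s(1)]
    have "s powr p * (Lpow p \<Omega> H / p - lam * (c * measure M K - C * measure M (B - K))) < 0"
      using gap s(2) by (intro mult_pos_neg) auto
    moreover have "\<forall>x. 0 \<le> s * w x \<and> s * w x \<le> \<alpha> n"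
    proof
      fix x
      have "0 \<le> w x" "w x \<le> 1" using pl by (auto simp: plateau_def)
      then have "0 \<le> s * w x" "s * w x \<le> s" using s(2) by (auto simp: mult_left_le)
      with s(4) show "0 \<le> s * w x \<and> s * w x \<le> \<alpha> n" by linarith
    qed
    ultimately have neg: "Lpow p \<Omega> G / p - lam * (LINT x|M. integral {0..u x} f) < 0"
      using u(4)[OF e(1)] e(2) by fastforce
    have "\<not> (AE x in M. u x = 0)"
    proof
      assume "AE x in M. u x = 0"
      then have "AE x in M. integral {0..u x} f = 0" by eventually_elim simp
      then have "(LINT x|M. integral {0..u x} f) = 0" by (rule integral_eq_zero_AE)
      moreover have "0 \<le> Lpow p \<Omega> G / p" using p_gt_1 Lpow_nonneg[of p \<Omega> G] by simp
      ultimately show False using neg by simp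
    qed
    with u Lp_measurable[OF sob0_Lp(1)[OF u(2)]] show ?thesis by blast
  qed
  then obtain u where u: "\<And>n. bounded_solution p \<Omega> lam f (u n)" "\<And>n x. 0 \<le> u n x \<and> u n x \<le> \<alpha> n"
    "\<And>n. u n \<in> borel_measurable M" "\<And>n. \<not> (AE x in M. u n x = 0)" by metis
  have "Linf_norm \<Omega> (u n) \<le> ereal (\<alpha> n)" for n
    by (rule Linf_norm_le[OF u(3)]) (use u(2) in auto)
  moreover have "0 \<le> Linf_norm \<Omega> (u n)" for n
  proof (rule ccontr)
    assume "\<not> 0 \<le> Linf_norm \<Omega> (u n)"
    then have "Linf_norm \<Omega> (u n) \<le> ereal 0" by (simp add: zero_ereal_def)
    from AE_le_of_Linf_norm_le[OF this] have "AE x in M. u n x = 0" by eventually_elim simp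
    with u(4) show False by blast
  qed
  moreover have "(\<lambda>n. ereal (\<alpha> n)) \<longlonglongrightarrow> 0" using \<alpha>(3) by (simp add: zero_ereal_def)
  ultimately have "(\<lambda>n. Linf_norm \<Omega> (u n)) \<longlonglongrightarrow> 0"
    using tendsto_sandwich[of "\<lambda>n. 0" "\<lambda>n. Linf_norm \<Omega> (u n)" sequentially "\<lambda>n. ereal (\<alpha> n)" 0] by simp
  with u(1,4) u(2) show ?thesis by (intro exI[of _ u] conjI allI AE_I2) blast+
qed

text \<open>A fixed plateau function \<open>s w\<close> is admissible for all \<open>\<alpha>\<^sub>n \<ge> s\<close>, and its energy tends to \<open>-\<infinity>\<close> along a
  sequence \<open>s \<rightarrow> \<infinity>\<close>. So the minimal energies tend to \<open>-\<infinity>\<close>, whereas functions with values in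
  \<open>[0, R]\<close> have energies bounded below. Finitely many members, which could vanish, are dropped.\<close>

lemma large_solutions:
  fixes f :: "real \<Rightarrow> real"
  assumes f: "continuous_on UNIV f" "0 \<le> f 0" and lam: "0 \<le> lam"
    and pl: "plateau w H B K" and gap: "Lpow p \<Omega> H / p < lam * (c * measure M K - C * measure M (B - K))"
    and C: "0 \<le> C" "\<forall>\<^sub>F t in at_top. - (C * t powr p) \<le> integral {0..t} f"
    and c: "\<exists>\<^sub>F t in at_top. c * t powr p \<le> integral {0..t} f"
    and \<alpha>: "\<And>n::nat. 0 < \<alpha> n" "\<And>n. f (\<alpha> n) = 0" "filterlim \<alpha> at_top sequentially"
  shows "\<exists>u :: nat \<Rightarrow> 'a \<Rightarrow> real. (\<forall>n. bounded_solution p \<Omega> lam f (u n) \<and> (AE x in M. 0 \<le> u n x) \<and>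
      \<not> (AE x in M. u n x = 0)) \<and> (\<lambda>n. Linf_norm \<Omega> (u n)) \<longlonglongrightarrow> \<infinity>"
proof -
  have bdd: "\<exists>D\<ge>0. \<forall>t. 0 \<le> t \<and> t \<le> R \<longrightarrow> \<bar>integral {0..t} f\<bar> \<le> D" for R
  proof -
    have "compact ((\<lambda>s. integral {0..s} f) ` {0..R})"
      by (intro compact_continuous_image continuous_on_subset[OF primitive_borel(1)[OF f(1)]]) auto
    then obtain D where "\<forall>x\<in>(\<lambda>s. integral {0..s} f) ` {0..R}. norm x \<le> D"
      using compact_imp_bounded bounded_iff by blast
    then show ?thesis by (intro exI[of _ "max D 0"]) (auto simp: le_max_iff_disj)
  qed
  obtain t1 where t1: "\<And>t. t1 \<le> t \<Longrightarrow> - (C * t powr p) \<le> integral {0..t} f"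
    using C(2) by (auto simp: eventually_at_top_linorder)
  obtain D where D: "0 \<le> D" "\<And>t. 0 \<le> t \<Longrightarrow> t \<le> t1 \<Longrightarrow> \<bar>integral {0..t} f\<bar> \<le> D" using bdd[of t1] by blast
  have low: "- (C * t powr p + D) \<le> integral {0..t} f" if "0 \<le> t" for t
  proof (cases "t1 \<le> t")
    case True
    with t1 D(1) show ?thesis by fastforce
  next
    case False
    have "0 \<le> C * t powr p" using C(1) by simp
    moreover have "- D \<le> integral {0..t} f" using D(2)[of t] that False by (simp add: abs_le_iff)
    ultimately show ?thesis by linarith
  qed
  have "\<exists>u G. bounded_solution p \<Omega> lam f u \<and> sob0 u G \<and> (\<forall>x. 0 \<le> u x \<and> u x \<le> \<alpha> n) \<and>
    (\<forall>v H. sob0 v H \<longrightarrow> (\<forall>x. 0 \<le> v x \<and> v x \<le> \<alpha> n) \<longrightarrow>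
       Lpow p \<Omega> G / p - lam * (LINT x|M. integral {0..u x} f) \<le> Lpow p \<Omega> H / p - lam * (LINT x|M. integral {0..v x} f))" for n
    by (rule truncated_solution[OF f \<alpha>(1)[of n] \<alpha>(2)[of n] lam])
  then obtain u G where u: "\<And>n. bounded_solution p \<Omega> lam f (u n)" "\<And>n. sob0 (u n) (G n)" "\<And>n x. 0 \<le> u n x \<and> u n x \<le> \<alpha> n"
    and min: "\<And>n v H. sob0 v H \<Longrightarrow> (\<forall>x. 0 \<le> v x \<and> v x \<le> \<alpha> n) \<Longrightarrow>
       Lpow p \<Omega> (G n) / p - lam * (LINT x|M. integral {0..u n x} f) \<le> Lpow p \<Omega> H / p - lam * (LINT x|M. integral {0..v x} f)"
    by metis
  have large: "\<forall>\<^sub>F n in sequentially. \<not> (AE x in M. \<bar>u n x\<bar> \<le> R)" for R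
  proof -
    obtain E where E: "0 \<le> E" "\<And>t. 0 \<le> t \<Longrightarrow> t \<le> R \<Longrightarrow> \<bar>integral {0..t} f\<bar> \<le> E" using bdd[of R] by blast
    define \<kappa> where "\<kappa> = lam * (c * measure M K - C * measure M (B - K)) - Lpow p \<Omega> H / p"
    have \<kappa>: "0 < \<kappa>" using gap by (simp add: \<kappa>_def)
    have "\<forall>\<^sub>F s::real in at_top. s \<le> s powr p"
      using eventually_ge_at_top[of 1]
    proof eventually_elim
      case (elim s)
      with powr_mono[of 1 p s] p_gt_1 show ?case by simp
    qed
    then have "filterlim (\<lambda>s::real. s powr p) at_top at_top"
      by (rule filterlim_at_top_mono[OF filterlim_ident])
    then have "filterlim (\<lambda>s::real. \<kappa> * s powr p) at_top at_top"
      by (rule filterlim_tendsto_pos_mult_at_top[OF tendsto_const \<kappa>])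
    then have "\<forall>\<^sub>F s in at_top. lam * D * measure M (B - K) + lam * (E * measure M \<Omega>) < \<kappa> * s powr p"
      by (simp add: filterlim_at_top_dense)
    from eventually_conj[OF this eventually_gt_at_top[of 0]]
    have "\<forall>\<^sub>F s in at_top. lam * D * measure M (B - K) + lam * (E * measure M \<Omega>) < \<kappa> * s powr p \<and> 0 < s" .
    from frequently_eventually_conj[OF c this]
    obtain s where s: "c * s powr p \<le> integral {0..s} f" "0 < s"
      "lam * D * measure M (B - K) + lam * (E * measure M \<Omega>) < \<kappa> * s powr p"
      using frequently_ex by fastforce
    note e = plateau_energy[OF pl f(1) s(2) lam C(1) low s(1)]
    have "\<forall>\<^sub>F n in sequentially. s \<le> \<alpha> n" using \<alpha>(3) by (simp add: filterlim_at_top)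
    then show ?thesis
    proof eventually_elim
      case (elim n)
      have "\<forall>x. 0 \<le> s * w x \<and> s * w x \<le> \<alpha> n"
      proof
        fix x
        have "0 \<le> w x" "w x \<le> 1" using pl by (auto simp: plateau_def)
        then have "0 \<le> s * w x" "s * w x \<le> s" using s(2) by (auto simp: mult_left_le)
        with elim show "0 \<le> s * w x \<and> s * w x \<le> \<alpha> n" by linarith
      qed
      from min[OF e(1) this] e(2)
      have "Lpow p \<Omega> (G n) / p - lam * (LINT x|M. integral {0..u n x} f)
          \<le> s powr p * (- \<kappa>) + lam * D * measure M (B - K)"
        by (simp add: \<kappa>_def)
      also have "\<dots> < - (lam * (E * measure M \<Omega>))" using s(3) by (simp add: mult.commute)
      finally have neg: "Lpow p \<Omega> (G n) / p - lam * (LINT x|M. integral {0..u n x} f) < - (lam * (E * measure M \<Omega>))" .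
      show "\<not> (AE x in M. \<bar>u n x\<bar> \<le> R)"
      proof
        assume ae: "AE x in M. \<bar>u n x\<bar> \<le> R"
        have "(LINT x|M. integral {0..u n x} f) \<le> (LINT x|M. E)"
        proof (rule integral_mono_AE)
          show "integrable M (\<lambda>x. integral {0..u n x} f)"
            by (rule primitive_bounded_integrable[OF f(1) Lp_measurable[OF sob0_Lp(1)[OF u(2)]] u(3)])
          show "AE x in M. integral {0..u n x} f \<le> E"
            using ae
          proof eventually_elim
            case (elim x)
            with E(2)[of "u n x"] u(3)[of n x] show ?case by (simp add: abs_le_iff)
          qed
        qed simp
        then have "lam * (LINT x|M. integral {0..u n x} f) \<le> lam * (E * measure M \<Omega>)"
          using lam by (intro mult_left_mono) (auto simp: mult.commute)
        moreover have "0 \<le> Lpow p \<Omega> (G n) / p" using p_gt_1 Lpow_nonneg[of p \<Omega> "G n"] by simp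
        ultimately show False using neg by linarith
      qed
    qed
  qed
  have "\<forall>\<^sub>F n in sequentially. ereal R < Linf_norm \<Omega> (u n)" for R
    using large[of R]
  proof eventually_elim
    case (elim n)
    then show ?case using AE_le_of_Linf_norm_le[of "u n" R] by (meson not_less)
  qed
  then have lim: "(\<lambda>n. Linf_norm \<Omega> (u n)) \<longlonglongrightarrow> \<infinity>" by (simp add: tendsto_PInfty)
  obtain n0 where n0: "\<And>n. n0 \<le> n \<Longrightarrow> \<not> (AE x in M. \<bar>u n x\<bar> \<le> 0)"
    using large[of 0] by (auto simp: eventually_sequentially)
  have "(\<lambda>n. Linf_norm \<Omega> (u (n + n0))) \<longlonglongrightarrow> \<infinity>" using lim by (rule LIMSEQ_ignore_initial_segment)
  moreover have "\<not> (AE x in M. u (n + n0) x = 0)" for n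
    using n0[of "n + n0"] by simp
  ultimately show ?thesis using u(1) u(3) by (intro exI[of _ "\<lambda>n. u (n + n0)"] conjI allI AE_I2) blast+
qed

end

lemma (in lp_domain) plateau_measure:
  assumes "plateau w H B K"
  shows "measure M K = measure M B - measure M (B - K)"
  using assms finite_measure_Diff[of B K] by (simp add: plateau_def)

theorem theorem1p1:
  fixes \<Omega> :: "(real ^ 'N) set" and p :: real and l Lplus :: ereal
    and f F :: "real \<Rightarrow> real" and \<alpha> :: "nat \<Rightarrow> real"
  assumes "open \<Omega>" and "connected \<Omega>" and "\<Omega> \<noteq> {}" and "bounded \<Omega>"
    and "1 < p"
    and "l \<in> {0, \<infinity>}"
    and "continuous_on UNIV f" and "f 0 \<ge> 0"
    and F: "\<And>s. s \<ge> 0 \<Longrightarrow> F s = integral {0..s} f"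
    and "\<And>n. \<alpha> n > 0" and "(\<lambda>n. ereal (\<alpha> n)) \<longlonglongrightarrow> l" and "\<And>n. f (\<alpha> n) = 0"
    and "- \<infinity> < Liminf (toward l) (\<lambda>s. ereal (F s / s powr p))"
    and "Limsup (toward l) (\<lambda>s. ereal (F s / s powr p)) = Lplus"
    and "0 < Lplus"
  shows "\<exists>lam_bar::real. lam_bar \<ge> 0 \<and> (Lplus = \<infinity> \<longrightarrow> lam_bar = 0) \<and>
    (\<forall>lam > lam_bar. \<exists>u :: nat \<Rightarrow> real ^ 'N \<Rightarrow> real.
       (\<forall>n. bounded_solution p \<Omega> lam f (u n) \<and>
            (AE x in lebesgue_on \<Omega>. u n x \<ge> 0) \<and>
            \<not> (AE x in lebesgue_on \<Omega>. u n x = 0)) \<and>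
       (\<lambda>n. Linf_norm \<Omega> (u n)) \<longlonglongrightarrow> l)"
proof -
  interpret lp_domain \<Omega> p
    by unfold_locales fact+
  let ?Q = "\<lambda>s. ereal (F s / s powr p)"
  have pos: "\<forall>\<^sub>F s in toward l. 0 < s"
    by (simp add: toward_def eventually_at_right_less eventually_gt_at_top)
  obtain y where y: "ereal y < Liminf (toward l) ?Q"
    using \<open>- \<infinity> < Liminf (toward l) ?Q\<close> ereal_dense2 by blast
  define C where "C = max 0 (- y)"
  have C: "0 \<le> C" by (simp add: C_def)
  have lower: "\<forall>\<^sub>F s in toward l. - (C * s powr p) \<le> integral {0..s} f"
    using less_LiminfD[OF y] pos
  proof eventually_elim
    case (elim s)
    then have "y * s powr p \<le> F s" by (simp add: pos_less_divide_eq less_imp_le)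
    moreover have "- C * s powr p \<le> y * s powr p"
      by (intro mult_right_mono) (auto simp: C_def)
    ultimately show ?case using F[of s] elim by simp
  qed
  have upper: "\<exists>\<^sub>F s in toward l. c * s powr p \<le> integral {0..s} f" if c: "ereal c < Lplus" for c
  proof -
    have "\<exists>\<^sub>F s in toward l. c < F s / s powr p"
    proof (rule ccontr)
      assume "\<not> ?thesis"
      then have "\<forall>\<^sub>F s in toward l. ?Q s \<le> ereal c" by (simp add: not_frequently not_less)
      then have "Limsup (toward l) ?Q \<le> ereal c" by (rule Limsup_bounded)
      with c \<open>Limsup (toward l) ?Q = Lplus\<close> show False by simp
    qed
    from frequently_eventually_conj[OF this pos] show ?thesis
    proof (rule frequently_elim1)
      fix s assume "0 < s \<and> c < F s / s powr p"
      then have "c < F s / s powr p" "0 < s" by auto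
      then show "c * s powr p \<le> integral {0..s} f" using F[of s] by (simp add: pos_less_divide_eq)
    qed
  qed
  let ?solvable = "\<lambda>lam. \<exists>u :: nat \<Rightarrow> real ^ 'N \<Rightarrow> real.
       (\<forall>n. bounded_solution p \<Omega> lam f (u n) \<and>
            (AE x in lebesgue_on \<Omega>. u n x \<ge> 0) \<and>
            \<not> (AE x in lebesgue_on \<Omega>. u n x = 0)) \<and>
       (\<lambda>n. Linf_norm \<Omega> (u n)) \<longlonglongrightarrow> l"
  have solve: "?solvable lam"
    if lam: "0 \<le> lam" and pl: "plateau w H B K" and c: "ereal c < Lplus"
      and gap: "Lpow p \<Omega> H / p < lam * (c * measure M K - C * measure M (B - K))" for lam w H B K c
  proof (cases "l = 0")
    case True
    have "\<alpha> \<longlonglongrightarrow> 0" using \<open>(\<lambda>n. ereal (\<alpha> n)) \<longlonglongrightarrow> l\<close> True by (simp add: zero_ereal_def)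
    from small_solutions[OF \<open>continuous_on UNIV f\<close> \<open>f 0 \<ge> 0\<close> lam pl gap C _ _ \<open>\<And>n. \<alpha> n > 0\<close> \<open>\<And>n. f (\<alpha> n) = 0\<close> this]
      lower upper[OF c] True
    show ?thesis by (simp add: toward_def)
  next
    case False
    then have l: "l = \<infinity>" using \<open>l \<in> {0, \<infinity>}\<close> by simp
    then have "filterlim \<alpha> at_top sequentially"
      using \<open>(\<lambda>n. ereal (\<alpha> n)) \<longlonglongrightarrow> l\<close> by (simp add: tendsto_PInfty filterlim_at_top_dense)
    from large_solutions[OF \<open>continuous_on UNIV f\<close> \<open>f 0 \<ge> 0\<close> lam pl gap C _ _ \<open>\<And>n. \<alpha> n > 0\<close> \<open>\<And>n. f (\<alpha> n) = 0\<close> this]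
      lower upper[OF c] l
    show ?thesis by (simp add: toward_def)
  qed
  show ?thesis
  proof (cases "Lplus = \<infinity>")
    case True
    obtain w H B K where pl: "plateau w H B K" "0 < measure M B" "measure M (B - K) \<le> 1/2 * measure M B"
      using plateau_exists[OF \<open>\<Omega> \<noteq> {}\<close>, of "1/2"] by auto
    have K: "0 < measure M K" using plateau_measure[OF pl(1)] pl(2,3) by linarith
    show ?thesis
    proof (intro exI[of _ 0] conjI impI allI)
      fix lam :: real assume lam: "0 < lam"
      \<comment> \<open>Every real \<open>c\<close> lies below the infinite upper limit; this one leaves the gap \<open>lam\<close>.\<close>
      define c where "c = (Lpow p \<Omega> H / p / lam + C * measure M (B - K) + 1) / measure M K"
      have "c * measure M K = Lpow p \<Omega> H / p / lam + C * measure M (B - K) + 1" using K by (simp add: c_def)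
      then have "lam * (c * measure M K - C * measure M (B - K)) = Lpow p \<Omega> H / p + lam"
        using lam by (simp add: field_simps)
      with lam True show "?solvable lam"
        by (intro solve[OF _ pl(1), of lam c]) auto
    qed auto
  next
    case False
    obtain c where c: "0 < c" "ereal c < Lplus"
      using ereal_dense2[OF \<open>0 < Lplus\<close>] by auto
    \<comment> \<open>Chosen such that the loss \<open>(c + C) |B - K|\<close> is at most half of \<open>c |B|\<close>.\<close>
    define \<delta> where "\<delta> = c / (2 * (c + C))"
    have \<delta>: "0 < \<delta>" "(c + C) * \<delta> = c / 2" using c C by (auto simp: \<delta>_def field_simps)
    obtain w H B K where pl: "plateau w H B K" "0 < measure M B" "measure M (B - K) \<le> \<delta> * measure M B"
      using plateau_exists[OF \<open>\<Omega> \<noteq> {}\<close> \<delta>(1)] by auto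
    define \<theta> where "\<theta> = c * measure M K - C * measure M (B - K)"
    have "(c + C) * measure M (B - K) \<le> (c + C) * (\<delta> * measure M B)"
      using c C pl(3) by (intro mult_left_mono) auto
    also have "\<dots> = c / 2 * measure M B" using \<delta>(2) by (metis mult.assoc)
    finally have "c * measure M (B - K) + C * measure M (B - K) \<le> c * measure M B / 2" by (simp add: algebra_simps)
    moreover have "\<theta> = c * measure M B - (c * measure M (B - K) + C * measure M (B - K))"
      unfolding \<theta>_def plateau_measure[OF pl(1)] by (simp add: right_diff_distrib)
    moreover have "0 < c * measure M B" using c pl(2) by simp
    ultimately have \<theta>: "0 < \<theta>" by linarith
    define lam_bar where "lam_bar = Lpow p \<Omega> H / p / \<theta>"
    have bar: "0 \<le> lam_bar" using \<theta> p_gt_1 Lpow_nonneg[of p \<Omega> H] by (simp add: lam_bar_def)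
    show ?thesis
    proof (intro exI[of _ lam_bar] conjI impI allI bar)
      fix lam assume lam: "lam_bar < lam"
      then have "Lpow p \<Omega> H / p < lam * \<theta>"
        unfolding lam_bar_def using pos_divide_less_eq[OF \<theta>, of "Lpow p \<Omega> H / p" lam] by blast
      with lam bar show "?solvable lam"
        unfolding \<theta>_def by (intro solve[OF _ pl(1) c(2)]) auto
    qed (use False in simp)
  qed
qed

end
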